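(* Suppose $G$ is a residually solvable group and $\phi : B \to A$ is an isomorphism between subgroups $A, B \leq G$. Suppose there exists a group homomorphism $\pi: G \to A \times B$ such that $\pi(a) = (a,1)$ for all $a \in A$ and $\pi(b) = (1,b)$ for all $b \in B$. Then $\mathrm{Hig}_k(G, \phi)$ and $\overline{\mathrm{Hig}}_k(G, \phi)$ are residually solvable for all integers $k \geq 4$.
   Context: Conventions: $b^t = t^{-1} b t$. Given a group $G$, subgroups $A,B\le G$, an isomorphism $\phi: B\to A$, and a positive integer $k$: for $1\le i\le k$ let $G_i$ be a copy of $G$, let $A_i,B_i\le G_i$ be the corresponding copies of $A,B$, and let $\phi_i: B_i \to A_{i+1}$ (indices mod $k$) be the isomorphism induced by $\phi$. Define $$\overline{\mathrm{Hig}}_k(G,\phi) := \langle G_1,\ldots,G_k \mid b_i=\phi_i(b_i) \text{ for all } i \text{ and all } b_i\in B_i\rangle,$$ i.e. the quotient of the free product $G_1 * \cdots * G_k$ by the normal closure of the elements $b_i^{-1}\phi_i(b_i)$. Define $$\mathrm{Hig}_k(G,\phi) := \langle G, t \mid t^k=1,\ b^t=\phi(b)\ \forall b\in B\rangle,$$ i.e. the quotient of $G * \langle t\rangle$ ($\langle t \rangle$ infinite cyclic) by these relations; it is the semidirect product of $\overline{\mathrm{Hig}}_k(G,\phi)$ with a cyclic group of order $k$ generated by $t$, which conjugates $G_i$ to $G_{i+1}$ (indices mod $k$). A group $G$ is residually solvable if for every $x\in G\smallsetminus\{e\}$ there is a quotient of $G$ that is solvable and in which the image of $x$ is non-trivial.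 *)

theory Defs
  imports "HOL-Algebra.Algebra"
begin

section \<open>Free products\<close>

definition free_product_words :: "'i set \<Rightarrow> ('i \<Rightarrow> ('a, 'm) monoid_scheme) \<Rightarrow> ('i \<times> 'a) list set" where
  "free_product_words I Gs = lists (SIGMA i:I. carrier (Gs i))"

text \<open>The smallest congruence on the monoid of words that makes each map
  \<open>x \<mapsto> [(i, x)]\<close> a homomorphism modulo it. Formal inverses are not needed, since the
  letter \<open>(i, inv x)\<close> is available.\<close>

inductive_set free_product_rel ::
  "'i set \<Rightarrow> ('i \<Rightarrow> ('a, 'm) monoid_scheme) \<Rightarrow> (('i \<times> 'a) list \<times> ('i \<times> 'a) list) set"
  for I :: "'i set" and Gs :: "'i \<Rightarrow> ('a, 'm) monoid_scheme" where
  refl: "w \<in> free_product_words I Gs \<Longrightarrow> (w, w) \<in> free_product_rel I Gs"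
| sym: "(v, w) \<in> free_product_rel I Gs \<Longrightarrow> (w, v) \<in> free_product_rel I Gs"
| trans: "(u, v) \<in> free_product_rel I Gs \<Longrightarrow> (v, w) \<in> free_product_rel I Gs
    \<Longrightarrow> (u, w) \<in> free_product_rel I Gs"
| one: "\<lbrakk>u \<in> free_product_words I Gs; v \<in> free_product_words I Gs; i \<in> I\<rbrakk>
    \<Longrightarrow> (u @ [(i, \<one>\<^bsub>Gs i\<^esub>)] @ v, u @ v) \<in> free_product_rel I Gs"
| mult: "\<lbrakk>u \<in> free_product_words I Gs; v \<in> free_product_words I Gs; i \<in> I;
      x \<in> carrier (Gs i); y \<in> carrier (Gs i)\<rbrakk>
    \<Longrightarrow> (u @ [(i, x), (i, y)] @ v, u @ [(i, x \<otimes>\<^bsub>Gs i\<^esub> y)] @ v) \<in> free_product_rel I Gs"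

definition free_product ::
  "'i set \<Rightarrow> ('i \<Rightarrow> ('a, 'm) monoid_scheme) \<Rightarrow> ('i \<times> 'a) list set monoid" where
  "free_product I Gs =
    \<lparr>carrier = free_product_words I Gs // free_product_rel I Gs,
     monoid.mult = (\<lambda>U V. \<Union>u\<in>U. \<Union>v\<in>V. free_product_rel I Gs `` {u @ v}),
     one = free_product_rel I Gs `` {[]}\<rparr>"

definition free_product_incl ::
  "'i set \<Rightarrow> ('i \<Rightarrow> ('a, 'm) monoid_scheme) \<Rightarrow> 'i \<Rightarrow> 'a \<Rightarrow> ('i \<times> 'a) list set" where
  "free_product_incl I Gs i x = free_product_rel I Gs `` {[(i, x)]}"

definition normal_closure :: "('a, 'm) monoid_scheme \<Rightarrow> 'a set \<Rightarrow> 'a set" where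
  "normal_closure G S = \<Inter>{N. N \<lhd> G \<and> S \<subseteq> N}"


section \<open>The generalised Higman groups\<close>

text \<open>The subgroup \<open>A\<close> is not a parameter, as it is \<open>\<phi> ` B\<close>. The copies of \<open>G\<close> are
  indexed by \<open>0, \<dots>, k - 1\<close>.\<close>

definition Hig_bar ::
  "nat \<Rightarrow> ('a, 'm) monoid_scheme \<Rightarrow> 'a set \<Rightarrow> ('a \<Rightarrow> 'a) \<Rightarrow> (nat \<times> 'a) list set set monoid" where
  "Hig_bar k G B \<phi> =
    (let F = free_product {0..<k} (\<lambda>_. G);
         \<iota> = free_product_incl {0..<k} (\<lambda>_. G)
     in F Mod normal_closure F
          {inv\<^bsub>F\<^esub> (\<iota> i b) \<otimes>\<^bsub>F\<^esub> \<iota> ((i + 1) mod k) (\<phi> b) | i b. i \<in> {0..<k} \<and> b \<in> B})"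

text \<open>The factors of a free product share one element type, so the factors \<open>G\<close> and
  \<open>\<int> = \<langle>t\<rangle>\<close> of \<open>G * \<langle>t\<rangle>\<close> are transported to the sum type; they are indexed by
  \<open>True\<close> and \<open>False\<close>, respectively.\<close>

definition G_and_Z :: "('a, 'm) monoid_scheme \<Rightarrow> bool \<Rightarrow> ('a + int) monoid" where
  "G_and_Z G i = (if i then image_group Inl G else image_group Inr integer_group)"

definition Hig ::
  "nat \<Rightarrow> ('a, 'm) monoid_scheme \<Rightarrow> 'a set \<Rightarrow> ('a \<Rightarrow> 'a) \<Rightarrow> (bool \<times> ('a + int)) list set set monoid"
  where
  "Hig k G B \<phi> =
    (let F = free_product UNIV (G_and_Z G);
         \<iota> = (\<lambda>g. free_product_incl UNIV (G_and_Z G) True (Inl g));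
         t = free_product_incl UNIV (G_and_Z G) False (Inr 1)
     in F Mod normal_closure F
          ({t [^]\<^bsub>F\<^esub> k} \<union>
           {inv\<^bsub>F\<^esub> (inv\<^bsub>F\<^esub> t \<otimes>\<^bsub>F\<^esub> \<iota> b \<otimes>\<^bsub>F\<^esub> t) \<otimes>\<^bsub>F\<^esub> \<iota> (\<phi> b) | b. b \<in> B}))"


section \<open>Residual solvability\<close>

definition residually_solvable :: "('a, 'm) monoid_scheme \<Rightarrow> bool" where
  "residually_solvable G \<longleftrightarrow> group G \<and>
    (\<forall>x \<in> carrier G - {\<one>\<^bsub>G\<^esub>}. \<exists>N. N \<lhd> G \<and> solvable (G Mod N) \<and> N #>\<^bsub>G\<^esub> x \<noteq> \<one>\<^bsub>G Mod N\<^esub>)"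

end

theory Submission
  imports Defs
begin

text \<open>
  A group is residually solvable iff its derived series has trivial intersection, and the main
  tool is that an amalgamated product \<open>P *\<^sub>F Q\<close> of residually solvable groups along a common
  retract \<open>F\<close> is residually solvable. Indeed, since \<open>F\<close> is a retract, the letters of a reduced word
  stay outside the image of \<open>F\<close> in some solvable quotient \<open>S\<close> of the amalgam. It thus suffices to find
  a solvable image of the double \<open>S *\<^sub>F S\<close> in which a given reduced word survives: let \<open>S\<close> act by left
  translation on \<open>S \<times> V\<close>, where \<open>V\<close> is the space of \<open>0\<close>-\<open>1\<close> sequences, and let the second copy of \<open>S\<close>
  act by the conjugate under an involution \<open>\<tau>\<close> that commutes with \<open>F\<close> and applies to \<open>V\<close> a unitriangular
  map depending only on the coset of the first coordinate. Consecutive cosets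
  visited by the word are distinct, so \<open>\<tau>\<close> can be chosen to push the support of a vector one step
  further each time it is applied.

  The projections of \<open>G\<close> onto \<open>A\<close> and \<open>B\<close> provide the retractions: each path of copies of \<open>G\<close> is an
  iterated amalgam along a retract, and for \<open>k \<ge> 4\<close> the cycle is an amalgam of the paths \<open>G\<^sub>1, G\<^sub>2\<close> and
  \<open>G\<^sub>3, \<dots>, G\<^sub>k\<close> along the free product of two edge groups. Finally, \<open>Hig\<close> is an extension of
  the cycle group by a finite cyclic group.
\<close>

section \<open>Residual solvability and the derived series\<close>

text \<open>Amalgams are recognised inside a given group, by two generating subgroups
  \<open>P\<close> and \<open>Q\<close> and a universal property, so that presentations can be
  treated directly. The intersection \<open>P \<inter> Q\<close> of two subgroups given by
  generators is hard to describe in a presentation; elements are shown to lie in it by exhibiting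
  them as generators of both sides.

  The retractions serve two purposes. They embed \<open>P\<close> and \<open>Q\<close> into groups
  already known to be residually solvable, and they keep letters outside \<open>P \<inter> Q\<close>
  modulo a late derived subgroup, which rests on derived subgroups being mapped into themselves by
  every endomorphism.

  The bound 4 lets both arcs of the cut cycle have two vertices. The edges at a vertex carry
  \<open>A\<close> and \<open>B\<close>, and the projection to either one kills the other. When an
  arc is collapsed onto its complement, each of its end vertices has to keep the edge group that is
  cut and forget the other one, which is possible as the two ends are different vertices.\<close>

abbreviation derived_series :: "('a, 'm) monoid_scheme \<Rightarrow> nat \<Rightarrow> 'a set" where
  "derived_series G n \<equiv> (derived G ^^ n) (carrier G)"

lemma (in group) derived_series_normal: "derived_series G n \<lhd> G"
  by (induction n) (simp_all add: normal_self derived_is_normal)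

lemma (in group) derived_series_subset_carrier: "derived_series G n \<subseteq> carrier G"
  by (simp add: exp_of_derived_in_carrier)

lemma (in group) derived_series_decreasing: "derived_series G (m + n) \<subseteq> derived_series G n"
proof (induction m)
  case (Suc m)
  have "derived G (derived_series G (m + n)) \<subseteq> derived_series G (m + n)"
    by (intro derived_incl exp_of_derived_is_subgroup subgroup_self order_refl)
  with Suc show ?case by auto
qed simp

lemma (in group_hom) hom_derived_series:
  assumes "x \<in> derived_series G n"
  shows "h x \<in> derived_series H n"
proof -
  have "h ` derived_series G n = (derived H ^^ n) (h ` carrier G)"
    by (simp add: exp_of_derived_img)
  also have "\<dots> \<subseteq> derived_series H n"
    by (rule H.mono_exp_of_derived) (rule hom_carrier[OF homh])
  finally show ?thesis using assms by blast
qed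

lemma hom_in_derived_series:
  "\<lbrakk>group G; group H; h \<in> hom G H; x \<in> derived_series G n\<rbrakk> \<Longrightarrow> h x \<in> derived_series H n"
  using group_hom.hom_derived_series[OF group_hom.intro[OF _ _ group_hom_axioms.intro]] .

lemma (in group) solvable_Mod_derived_series: "solvable (G Mod derived_series G n)"
proof -
  interpret N: normal "derived_series G n" G by (rule derived_series_normal)
  interpret Q: group "G Mod derived_series G n" by (rule N.factorgroup_is_group)
  interpret h: group_hom G "G Mod derived_series G n" "\<lambda>x. derived_series G n #> x"
    by unfold_locales (rule N.r_coset_hom_Mod)
  have "derived_series (G Mod derived_series G n) n = (\<lambda>x. derived_series G n #> x) ` derived_series G n"
    using h.exp_of_derived_img[of "carrier G" n] by (simp add: carrier_FactGroup)
  also have "\<dots> = (\<lambda>x. derived_series G n) ` derived_series G n"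
    by (rule image_cong[OF HOL.refl]) (rule N.rcos_const[OF is_group])
  also have "\<dots> = {\<one>\<^bsub>G Mod derived_series G n\<^esub>}"
    unfolding one_FactGroup by (rule image_constant[OF subgroup.one_closed[OF N.is_subgroup]])
  finally show ?thesis using Q.solvable_iff_trivial_derived_seq by blast
qed

text \<open>A solvable quotient of derived length \<open>n\<close> kills the \<open>n\<close>-th
  derived subgroup, so whatever survives in it lies outside that subgroup. Conversely the quotient
  by a derived subgroup is itself solvable, and everything outside the subgroup survives
  there.\<close>

lemma residually_solvable_iff:
  "residually_solvable G \<longleftrightarrow>
    group G \<and> (\<forall>x\<in>carrier G. (\<forall>n. x \<in> derived_series G n) \<longrightarrow> x = \<one>\<^bsub>G\<^esub>)"
proof (cases "group G")
  case True
  interpret group G by fact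
  show ?thesis
  proof (intro iffI conjI ballI impI True)
    fix x assume rs: "residually_solvable G" and x: "x \<in> carrier G" and D: "\<forall>n. x \<in> derived_series G n"
    show "x = \<one>\<^bsub>G\<^esub>"
    proof (rule ccontr)
      assume "x \<noteq> \<one>\<^bsub>G\<^esub>"
      then obtain N where N: "N \<lhd> G" "solvable (G Mod N)" "N #>\<^bsub>G\<^esub> x \<noteq> \<one>\<^bsub>G Mod N\<^esub>"
        using rs x unfolding residually_solvable_def by blast
      interpret N: normal N G by fact
      interpret Q: group "G Mod N" by (rule N.factorgroup_is_group)
      obtain n where "derived_series (G Mod N) n = {\<one>\<^bsub>G Mod N\<^esub>}"
        using N(2) Q.solvable_iff_trivial_derived_seq by blast
      with hom_in_derived_series[OF True Q.is_group N.r_coset_hom_Mod, of x n] D N(3)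
      show False by auto
    qed
  next
    assume *: "group G \<and> (\<forall>x\<in>carrier G. (\<forall>n. x \<in> derived_series G n) \<longrightarrow> x = \<one>\<^bsub>G\<^esub>)"
    show "residually_solvable G"
      unfolding residually_solvable_def
    proof (intro conjI ballI True)
      fix x assume x: "x \<in> carrier G - {\<one>\<^bsub>G\<^esub>}"
      then obtain n where n: "x \<notin> derived_series G n" using * by blast
      interpret N: normal "derived_series G n" G by (rule derived_series_normal)
      have "derived_series G n #>\<^bsub>G\<^esub> x \<noteq> \<one>\<^bsub>G Mod derived_series G n\<^esub>"
        using n x coset_join1[of "derived_series G n" x] N.subset N.is_subgroup by auto
      then show "\<exists>N. N \<lhd> G \<and> solvable (G Mod N) \<and> N #>\<^bsub>G\<^esub> x \<noteq> \<one>\<^bsub>G Mod N\<^esub>"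
        using derived_series_normal solvable_Mod_derived_series by blast
    qed
  qed
qed (simp add: residually_solvable_def)

text \<open>Meant for homomorphisms with a kernel, such as retractions: only the element under
  consideration has to survive.\<close>

lemma residually_solvable_separated:
  assumes "group H" "residually_solvable G" "h \<in> hom H G" "x \<in> carrier H" "h x \<noteq> \<one>\<^bsub>G\<^esub>"
  shows "\<exists>n. x \<notin> derived_series H n"
  using assms hom_in_derived_series[OF assms(1) _ assms(3)] hom_in_carrier[OF assms(3,4)]
  unfolding residually_solvable_iff by blast

lemma residually_solvable_inj_hom:
  assumes "group H" "residually_solvable G" "h \<in> hom H G"
    and "\<And>x. \<lbrakk>x \<in> carrier H; h x = \<one>\<^bsub>G\<^esub>\<rbrakk> \<Longrightarrow> x = \<one>\<^bsub>H\<^esub>"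
  shows "residually_solvable H"
  unfolding residually_solvable_iff
  using residually_solvable_separated[OF assms(1-3)] assms(1,4) by blast

section \<open>Groups of triangular permutations\<close>

text \<open>A set of natural numbers stands for a sequence over the field with two elements. Coordinate
  \<open>j\<close> is changed by a function of the group coordinate and the coordinates below \<open>j\<close>.\<close>

definition triangular_maps ::
  "('a, 'm) monoid_scheme \<Rightarrow> nat \<Rightarrow> ('a \<times> nat set \<Rightarrow> 'a \<times> nat set) set" where
  "triangular_maps G n = {f.
     (\<forall>h v. h \<notin> carrier G \<longrightarrow> f (h, v) = (h, v)) \<and>
     (\<exists>g\<in>carrier G. \<forall>h\<in>carrier G. \<forall>v. fst (f (h, v)) = g \<otimes>\<^bsub>G\<^esub> h) \<and>
     (\<forall>h\<in>carrier G. \<forall>v w j. v \<inter> {..<j} = w \<inter> {..<j} \<longrightarrow>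
        ((j \<in> snd (f (h, v)) \<longleftrightarrow> j \<in> v) \<longleftrightarrow> (j \<in> snd (f (h, w)) \<longleftrightarrow> j \<in> w))) \<and>
     (\<forall>h\<in>carrier G. \<forall>v. \<forall>j\<ge>n. j \<in> snd (f (h, v)) \<longleftrightarrow> j \<in> v)}"

definition triangular_monoid ::
  "('a, 'm) monoid_scheme \<Rightarrow> nat \<Rightarrow> ('a \<times> nat set \<Rightarrow> 'a \<times> nat set) monoid" where
  "triangular_monoid G n = \<lparr>carrier = triangular_maps G n, monoid.mult = (\<circ>), one = id\<rparr>"

text \<open>Passing to the units replaces a proof that inverses of triangular maps are triangular;
  the elements constructed later come with explicit inverses, being translations, an involution, or
  products of these.\<close>

abbreviation triangular_group ::
  "('a, 'm) monoid_scheme \<Rightarrow> nat \<Rightarrow> ('a \<times> nat set \<Rightarrow> 'a \<times> nat set) monoid" where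
  "triangular_group G n \<equiv> units_of (triangular_monoid G n)"

lemma triangular_maps_translation:
  assumes "f \<in> triangular_maps G n"
  obtains g where "g \<in> carrier G" "\<And>h v. h \<in> carrier G \<Longrightarrow> fst (f (h, v)) = g \<otimes>\<^bsub>G\<^esub> h"
  using assms unfolding triangular_maps_def mem_Collect_eq by (elim conjE bexE) metis

lemma triangular_maps_outside:
  assumes "f \<in> triangular_maps G n" "h \<notin> carrier G"
  shows "f (h, v) = (h, v)"
  using assms unfolding triangular_maps_def mem_Collect_eq by (elim conjE) metis

lemma triangular_maps_bit:
  assumes "f \<in> triangular_maps G n" "h \<in> carrier G" "v \<inter> {..<j} = w \<inter> {..<j}"
  shows "(j \<in> snd (f (h, v)) \<longleftrightarrow> j \<in> v) \<longleftrightarrow> (j \<in> snd (f (h, w)) \<longleftrightarrow> j \<in> w)"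
  using assms unfolding triangular_maps_def mem_Collect_eq by (elim conjE) metis

lemma triangular_maps_high:
  assumes "f \<in> triangular_maps G n" "h \<in> carrier G" "n \<le> j"
  shows "j \<in> snd (f (h, v)) \<longleftrightarrow> j \<in> v"
  using assms unfolding triangular_maps_def mem_Collect_eq by (elim conjE) metis

lemma Int_lessThan_eq_iff: "v \<inter> {..<j} = w \<inter> {..<j} \<longleftrightarrow> (\<forall>i<j. i \<in> v \<longleftrightarrow> i \<in> w)"
  for j :: nat
  by blast

lemma triangular_maps_lower:
  assumes "f \<in> triangular_maps G n" "h \<in> carrier G" "v \<inter> {..<j} = w \<inter> {..<j}"
  shows "snd (f (h, v)) \<inter> {..<j} = snd (f (h, w)) \<inter> {..<j}"
  unfolding Int_lessThan_eq_iff
proof (intro allI impI)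
  fix i assume "i < j"
  then have "v \<inter> {..<i} = w \<inter> {..<i}" "i \<in> v \<longleftrightarrow> i \<in> w"
    using assms(3) unfolding Int_lessThan_eq_iff by simp_all
  then show "i \<in> snd (f (h, v)) \<longleftrightarrow> i \<in> snd (f (h, w))"
    using triangular_maps_bit[OF assms(1,2), of v i w] by argo
qed

context group
begin

lemma triangular_maps_fst:
  assumes "f \<in> triangular_maps G n" "h \<in> carrier G"
  shows "fst (f (h, v)) \<in> carrier G"
proof -
  obtain g where "g \<in> carrier G" "\<And>h v. h \<in> carrier G \<Longrightarrow> fst (f (h, v)) = g \<otimes> h"
    using triangular_maps_translation[OF assms(1)] by metis
  then show ?thesis using assms by simp
qed

lemma triangular_maps_comp:
  assumes f: "f \<in> triangular_maps G n" and f': "f' \<in> triangular_maps G n"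
  shows "f \<circ> f' \<in> triangular_maps G n"
proof -
  obtain g where g: "g \<in> carrier G" "\<And>h v. h \<in> carrier G \<Longrightarrow> fst (f (h, v)) = g \<otimes> h"
    using triangular_maps_translation[OF f] by metis
  obtain g' where g': "g' \<in> carrier G" "\<And>h v. h \<in> carrier G \<Longrightarrow> fst (f' (h, v)) = g' \<otimes> h"
    using triangular_maps_translation[OF f'] by metis
  have eq: "f' (h, v) = (g' \<otimes> h, snd (f' (h, v)))" if "h \<in> carrier G" for h v
    using g'(2)[OF that, of v] by (simp add: prod_eq_iff)
  show ?thesis
    unfolding triangular_maps_def mem_Collect_eq
  proof (intro conjI allI impI ballI)
    fix h v assume "h \<notin> carrier G"
    then show "(f \<circ> f') (h, v) = (h, v)" by (simp add: triangular_maps_outside[OF f] triangular_maps_outside[OF f'])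
  next
    have "fst ((f \<circ> f') (h, v)) = (g \<otimes> g') \<otimes> h" if h: "h \<in> carrier G" for h v
    proof -
      have "fst ((f \<circ> f') (h, v)) = fst (f (g' \<otimes> h, snd (f' (h, v))))"
        using eq[OF h, of v] by simp
      then show ?thesis using g g'(1) h by (simp add: m_assoc)
    qed
    then show "\<exists>g\<in>carrier G. \<forall>h\<in>carrier G. \<forall>v. fst ((f \<circ> f') (h, v)) = g \<otimes> h"
      using g(1) g'(1) by (intro bexI[of _ "g \<otimes> g'"]) simp_all
  next
    \<comment> \<open>The change of bit \<open>j\<close> under the composite is the sum modulo 2 of
      the two single changes. By \<open>triangular_maps_lower\<close> both depend only on
      \<open>h\<close> and the bits below \<open>j\<close>.\<close>
    fix h v w j assume h: "h \<in> carrier G" and vw: "v \<inter> {..<j} = w \<inter> {..<j :: nat}"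
    have h': "g' \<otimes> h \<in> carrier G" using h g' by simp
    have "j \<in> snd (f' (h, v)) \<longleftrightarrow> j \<in> v \<longleftrightarrow> (j \<in> snd (f' (h, w)) \<longleftrightarrow> j \<in> w)"
      using triangular_maps_bit[OF f' h vw] by argo
    moreover have "j \<in> snd (f (g' \<otimes> h, snd (f' (h, v)))) \<longleftrightarrow> j \<in> snd (f' (h, v)) \<longleftrightarrow>
        (j \<in> snd (f (g' \<otimes> h, snd (f' (h, w)))) \<longleftrightarrow> j \<in> snd (f' (h, w)))"
      using triangular_maps_bit[OF f h' triangular_maps_lower[OF f' h vw]] by argo
    ultimately show "(j \<in> snd ((f \<circ> f') (h, v)) \<longleftrightarrow> j \<in> v) \<longleftrightarrow> (j \<in> snd ((f \<circ> f') (h, w)) \<longleftrightarrow> j \<in> w)"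
      unfolding comp_apply eq[OF h, of v, symmetric] eq[OF h, of w, symmetric] by argo
  next
    fix h v and j :: nat assume h: "h \<in> carrier G" and j: "n \<le> j"
    have h': "g' \<otimes> h \<in> carrier G" using h g' by simp
    show "j \<in> snd ((f \<circ> f') (h, v)) \<longleftrightarrow> j \<in> v"
      using triangular_maps_high[OF f h' j, of "snd (f' (h, v))"] triangular_maps_high[OF f' h j, of v]
      unfolding comp_apply eq[OF h, of v, symmetric] by argo
  qed
qed

lemma monoid_triangular_monoid: "monoid (triangular_monoid G n)"
proof (rule monoidI)
  show "\<one>\<^bsub>triangular_monoid G n\<^esub> \<in> carrier (triangular_monoid G n)"
    by (auto simp: triangular_monoid_def triangular_maps_def intro!: bexI[of _ \<one>])
qed (auto simp: triangular_monoid_def triangular_maps_comp[unfolded comp_def] comp_def)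

lemma group_triangular_group: "group (triangular_group G n)"
  by (rule monoid.units_group[OF monoid_triangular_monoid])

lemma carrier_triangular_group:
  "f \<in> carrier (triangular_group G n) \<longleftrightarrow>
    f \<in> triangular_maps G n \<and> (\<exists>f'\<in>triangular_maps G n. f' \<circ> f = id \<and> f \<circ> f' = id)"
  by (auto simp: units_of_def Units_def triangular_monoid_def)

lemma mult_triangular_group [simp]: "f \<otimes>\<^bsub>triangular_group G n\<^esub> f' = f \<circ> f'"
  by (simp add: units_of_def triangular_monoid_def)

lemma one_triangular_group [simp]: "\<one>\<^bsub>triangular_group G n\<^esub> = id"
  by (simp add: units_of_def triangular_monoid_def)

lemma inv_triangular_group:
  assumes "f \<in> carrier (triangular_group G n)"
  shows "inv\<^bsub>triangular_group G n\<^esub> f \<circ> f = id" "f \<circ> inv\<^bsub>triangular_group G n\<^esub> f = id"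
  using group.l_inv[OF group_triangular_group assms] group.r_inv[OF group_triangular_group assms]
  by simp_all

section \<open>Filtration by the kernels of the actions on the group coordinate and the first
  \<open>j\<close> bits\<close>

definition triangular_level :: "nat \<Rightarrow> nat \<Rightarrow> ('a \<times> nat set \<Rightarrow> 'a \<times> nat set) set" where
  "triangular_level n j = {f \<in> carrier (triangular_group G n).
     \<forall>h\<in>carrier G. \<forall>v. fst (f (h, v)) = h \<and> snd (f (h, v)) \<inter> {..<j} = v \<inter> {..<j}}"

lemma triangular_levelD:
  assumes "f \<in> triangular_level n j" "h \<in> carrier G"
  obtains w where "f (h, v) = (h, w)" "w \<inter> {..<j} = v \<inter> {..<j}"
proof
  have *: "fst (f (h, v)) = h \<and> snd (f (h, v)) \<inter> {..<j} = v \<inter> {..<j}"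
    using assms unfolding triangular_level_def mem_Collect_eq by (elim conjE) blast
  then show "f (h, v) = (h, snd (f (h, v)))" by (simp add: prod_eq_iff)
  show "snd (f (h, v)) \<inter> {..<j} = v \<inter> {..<j}" using * by blast
qed

lemma triangular_levelI:
  assumes "f \<in> carrier (triangular_group G n)"
    and "\<And>h v. h \<in> carrier G \<Longrightarrow> fst (f (h, v)) = h \<and> snd (f (h, v)) \<inter> {..<j} = v \<inter> {..<j}"
  shows "f \<in> triangular_level n j"
  using assms unfolding triangular_level_def mem_Collect_eq by meson

lemma subgroup_triangular_level: "subgroup (triangular_level n j) (triangular_group G n)"
proof -
  interpret T: group "triangular_group G n" by (rule group_triangular_group)
  show ?thesis
  proof (rule T.subgroupI)
    show "triangular_level n j \<subseteq> carrier (triangular_group G n)"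
      by (auto simp: triangular_level_def)
    have "id \<in> triangular_level n j"
      using T.one_closed by (simp add: triangular_level_def)
    then show "triangular_level n j \<noteq> {}" by blast
  next
    fix f assume f: "f \<in> triangular_level n j"
    let ?f' = "inv\<^bsub>triangular_group G n\<^esub> f"
    have fT: "f \<in> carrier (triangular_group G n)" using f by (simp add: triangular_level_def)
    then have f': "?f' \<in> carrier (triangular_group G n)" by simp
    have "fst (?f' (h, v)) = h \<and> snd (?f' (h, v)) \<inter> {..<j} = v \<inter> {..<j}"
      if h: "h \<in> carrier G" for h v
    proof -
      obtain k u where ku: "?f' (h, v) = (k, u)" by fastforce
      have 1: "f (k, u) = (h, v)"
        using inv_triangular_group(2)[OF fT] ku by (metis comp_apply id_apply)
      have "k \<in> carrier G"
        using f' ku triangular_maps_fst[OF _ h, of ?f' n v] unfolding carrier_triangular_group by simp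
      then have "fst (f (k, u)) = k" "snd (f (k, u)) \<inter> {..<j} = u \<inter> {..<j}"
        by (metis fst_conv snd_conv triangular_levelD[OF f])+
      then show ?thesis using 1 ku by simp
    qed
    then show "?f' \<in> triangular_level n j" by (rule triangular_levelI[OF f'])
  next
    fix f f' assume f: "f \<in> triangular_level n j" and f': "f' \<in> triangular_level n j"
    have "fst (f (f' (h, v))) = h \<and> snd (f (f' (h, v))) \<inter> {..<j} = v \<inter> {..<j}"
      if h: "h \<in> carrier G" for h v
    proof -
      obtain w where w: "f' (h, v) = (h, w)" "w \<inter> {..<j} = v \<inter> {..<j}"
        by (rule triangular_levelD[OF f' h])
      obtain u where "f (h, w) = (h, u)" "u \<inter> {..<j} = w \<inter> {..<j}"
        by (rule triangular_levelD[OF f h])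
      then show ?thesis using w by simp
    qed
    moreover have "f \<circ> f' \<in> carrier (triangular_group G n)"
      using f f' T.m_closed[of f f'] by (simp add: triangular_level_def)
    ultimately show "f \<otimes>\<^bsub>triangular_group G n\<^esub> f' \<in> triangular_level n j"
      by (simp add: triangular_level_def)
  qed
qed

text \<open>Each of the two maps changes bit \<open>j\<close> by a function of \<open>h\<close> and
  the bits below \<open>j\<close>, and both leave these data fixed. The two changes of bit
  \<open>j\<close> therefore add up modulo 2, in either order.\<close>

lemma triangular_level_commute:
  assumes f: "f \<in> triangular_level n j" and g: "g \<in> triangular_level n j"
    and h: "h \<in> carrier G"
  shows "snd (f (g (h, v))) \<inter> {..<Suc j} = snd (g (f (h, v))) \<inter> {..<Suc j}"
proof -
  have fT: "f \<in> triangular_maps G n" and gT: "g \<in> triangular_maps G n"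
    using f g by (auto simp: triangular_level_def carrier_triangular_group)
  obtain v' where v': "f (h, v) = (h, v')" "v' \<inter> {..<j} = v \<inter> {..<j}"
    by (rule triangular_levelD[OF f h])
  obtain w' where w': "g (h, v) = (h, w')" "w' \<inter> {..<j} = v \<inter> {..<j}"
    by (rule triangular_levelD[OF g h])
  obtain v'' where v'': "g (h, v') = (h, v'')" "v'' \<inter> {..<j} = v' \<inter> {..<j}"
    by (rule triangular_levelD[OF g h])
  obtain w'' where w'': "f (h, w') = (h, w'')" "w'' \<inter> {..<j} = w' \<inter> {..<j}"
    by (rule triangular_levelD[OF f h])
  have "(j \<in> w'' \<longleftrightarrow> j \<in> w') \<longleftrightarrow> (j \<in> v' \<longleftrightarrow> j \<in> v)"
    using triangular_maps_bit[OF fT h w'(2)] unfolding v'(1) w''(1) snd_conv .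
  moreover have "(j \<in> v'' \<longleftrightarrow> j \<in> v') \<longleftrightarrow> (j \<in> w' \<longleftrightarrow> j \<in> v)"
    using triangular_maps_bit[OF gT h v'(2)] unfolding v''(1) w'(1) snd_conv .
  ultimately have j: "j \<in> w'' \<longleftrightarrow> j \<in> v''" by argo
  have "w'' \<inter> {..<j} = v'' \<inter> {..<j}" using v'(2) v''(2) w'(2) w''(2) by argo
  then have "w'' \<inter> {..<Suc j} = v'' \<inter> {..<Suc j}"
    using j unfolding Int_lessThan_eq_iff less_Suc_eq by metis
  then show ?thesis unfolding v'(1) w'(1) v''(1) w''(1) snd_conv .
qed

lemma derived_triangular_level:
  "derived (triangular_group G n) (triangular_level n j) \<subseteq> triangular_level n (Suc j)"
proof -
  interpret T: group "triangular_group G n" by (rule group_triangular_group)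
  interpret L: subgroup "triangular_level n j" "triangular_group G n"
    by (rule subgroup_triangular_level)
  let ?inv = "\<lambda>f. inv\<^bsub>triangular_group G n\<^esub> f"
  have comm: "f \<circ> g \<circ> ?inv f \<circ> ?inv g \<in> triangular_level n (Suc j)"
    if f: "f \<in> triangular_level n j" and g: "g \<in> triangular_level n j" for f g
  proof -
    define f' g' where "f' = ?inv f" and "g' = ?inv g"
    have fT: "f \<in> carrier (triangular_group G n)" and gT: "g \<in> carrier (triangular_group G n)"
      by (rule L.mem_carrier[OF f], rule L.mem_carrier[OF g])
    have f': "f' \<in> triangular_level n j" and g': "g' \<in> triangular_level n j"
      unfolding f'_def g'_def by (rule L.m_inv_closed[OF f], rule L.m_inv_closed[OF g])
    have ff': "f (f' x) = x" and gg': "g (g' x) = x" for x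
      unfolding f'_def g'_def
      by (rule pointfree_idE[OF inv_triangular_group(2)[OF fT]],
          rule pointfree_idE[OF inv_triangular_group(2)[OF gT]])
    define c where "c = f \<circ> g \<circ> f' \<circ> g'"
    have c: "c \<in> triangular_level n j"
      using L.m_closed[OF L.m_closed[OF L.m_closed[OF f g] f'] g']
      unfolding c_def mult_triangular_group .
    have "fst (c (h, v)) = h \<and> snd (c (h, v)) \<inter> {..<Suc j} = v \<inter> {..<Suc j}"
      if h: "h \<in> carrier G" for h v
    proof -
      \<comment> \<open>The commutator at \<open>(h, v)\<close> is a comparison of
        \<open>f \<circ> g\<close> and \<open>g \<circ> f\<close> at the point \<open>(h, w)\<close>
        obtained from \<open>(h, v)\<close> by \<open>f' \<circ> g'\<close>: the second composite
        returns to \<open>(h, v)\<close>, the first one gives the value of \<open>c\<close>.\<close>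
      obtain w' where w': "g' (h, v) = (h, w')" by (rule triangular_levelD[OF g' h])
      obtain w where w: "f' (h, w') = (h, w)" by (rule triangular_levelD[OF f' h])
      have "f (h, w) = (h, w')" using ff'[of "(h, w')"] w by simp
      then have gf: "g (f (h, w)) = (h, v)" using gg'[of "(h, v)"] w' by simp
      obtain u where u: "c (h, v) = (h, u)" by (rule triangular_levelD[OF c h])
      then have "f (g (h, w)) = (h, u)" by (simp add: c_def w w')
      then have "u \<inter> {..<Suc j} = v \<inter> {..<Suc j}"
        using triangular_level_commute[OF f g h, of w] unfolding gf by simp
      then show ?thesis unfolding u by simp
    qed
    then have "c \<in> triangular_level n (Suc j)"
      by (rule triangular_levelI[OF L.mem_carrier[OF c]])
    then show ?thesis unfolding c_def f'_def g'_def .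
  qed
  have "derived_set (triangular_group G n) (triangular_level n j) \<subseteq> triangular_level n (Suc j)"
    unfolding mult_triangular_group
    by (intro UN_least) (simp only: insert_subset empty_subsetI comm simp_thms)
  then show ?thesis
    unfolding derived_def by (rule T.generate_subgroup_incl[OF _ subgroup_triangular_level])
qed

text \<open>Bits below \<open>n\<close> are fixed by the level and bits from \<open>n\<close> on by
  every triangular map, so nothing is left to move.\<close>

lemma triangular_level_top: "triangular_level n n = {id}"
proof -
  have "f = id" if "f \<in> triangular_level n n" for f
  proof (rule ext, clarify)
    fix h v
    have f: "f \<in> triangular_maps G n"
      using that by (auto simp: triangular_level_def carrier_triangular_group)
    show "f (h, v) = id (h, v)"
    proof (cases "h \<in> carrier G")
      case True
      then have 1: "fst (f (h, v)) = h" "snd (f (h, v)) \<inter> {..<n} = v \<inter> {..<n}"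
        using that by (auto simp: triangular_level_def)
      have "snd (f (h, v)) = v"
      proof (rule Set.set_eqI)
        show "j \<in> snd (f (h, v)) \<longleftrightarrow> j \<in> v" for j
          using 1(2) triangular_maps_high[OF f True, of j v]
          unfolding Int_lessThan_eq_iff by (meson not_le_imp_less)
      qed
      then show ?thesis using 1(1) by (simp add: prod_eq_iff)
    qed (simp add: triangular_maps_outside[OF f])
  qed
  moreover have "id \<in> triangular_level n n"
    using subgroup.one_closed[OF subgroup_triangular_level] by simp
  ultimately show ?thesis by blast
qed

text \<open>Taking the translation part is a homomorphism to \<open>G\<close> with kernel at level
  0. The derived length \<open>r\<close> of \<open>G\<close> brings the derived series down to that
  kernel, and each further derived subgroup fixes one more bit, so that \<open>n + r\<close> steps
  suffice.\<close>

lemma solvable_triangular_group: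
  assumes "solvable G"
  shows "solvable (triangular_group G n)"
proof -
  interpret T: group "triangular_group G n" by (rule group_triangular_group)
  obtain r where r: "derived_series G r = {\<one>}"
    using assms solvable_iff_trivial_derived_seq by blast
  \<comment> \<open>The translation part is read off at the identity. The set argument is arbitrary,
    as it does not influence the group coordinate.\<close>
  define p where "p f = fst (f (\<one>, {} :: nat set))" for f :: "'a \<times> nat set \<Rightarrow> 'a \<times> nat set"
  have p: "p f \<in> carrier G" "h \<in> carrier G \<Longrightarrow> fst (f (h, v)) = p f \<otimes> h"
    if "f \<in> carrier (triangular_group G n)" for f h v
  proof -
    have f: "f \<in> triangular_maps G n" using that unfolding carrier_triangular_group ..
    obtain g where g: "g \<in> carrier G" "\<And>h v. h \<in> carrier G \<Longrightarrow> fst (f (h, v)) = g \<otimes> h"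
      using triangular_maps_translation[OF f] by metis
    then have "p f = g" unfolding p_def g(2)[OF one_closed] by simp
    then show "p f \<in> carrier G" "h \<in> carrier G \<Longrightarrow> fst (f (h, v)) = p f \<otimes> h"
      using g by metis+
  qed
  have "p \<in> hom (triangular_group G n) G"
  proof (rule homI)
    fix f g assume f: "f \<in> carrier (triangular_group G n)" and g: "g \<in> carrier (triangular_group G n)"
    show "p (f \<otimes>\<^bsub>triangular_group G n\<^esub> g) = p f \<otimes> p g"
    proof -
      obtain h v where hv: "g (\<one>, {}) = (h, v)" by (cases "g (\<one>, {})")
      then have h: "h = p g" unfolding p_def by simp
      have "p (f \<otimes>\<^bsub>triangular_group G n\<^esub> g) = fst (f (h, v))"
        unfolding p_def mult_triangular_group comp_apply hv ..
      also have "\<dots> = p f \<otimes> p g" unfolding h by (rule p(2)[OF f p(1)[OF g]])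
      finally show ?thesis .
    qed
  qed (rule p(1))
  have "derived_series (triangular_group G n) r \<subseteq> triangular_level n 0"
  proof
    fix f assume f: "f \<in> derived_series (triangular_group G n) r"
    then have fT: "f \<in> carrier (triangular_group G n)"
      using T.derived_series_subset_carrier by blast
    have "p f = \<one>"
      using hom_in_derived_series[OF T.is_group is_group \<open>p \<in> _\<close> f] r by simp
    then show "f \<in> triangular_level n 0"
      using p(2)[OF fT] by (intro triangular_levelI[OF fT]) simp
  qed
  then have "(derived (triangular_group G n) ^^ j) (derived_series (triangular_group G n) r)
      \<subseteq> triangular_level n j" for j
  proof (induction j)
    case (Suc j)
    then show ?case
      unfolding funpow.simps(2) comp_apply
      by (intro order_trans[OF T.mono_derived derived_triangular_level]) simp
  qed simp
  from this[of n] have "derived_series (triangular_group G n) (n + r) \<subseteq> {id}"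
    by (simp add: funpow_add triangular_level_top)
  moreover have "id \<in> derived_series (triangular_group G n) (n + r)"
    using subgroup.one_closed[OF T.exp_of_derived_is_subgroup[OF T.subgroup_self]] by simp
  ultimately have "derived_series (triangular_group G n) (n + r) = {\<one>\<^bsub>triangular_group G n\<^esub>}"
    by auto
  then show ?thesis using T.solvable_iff_trivial_derived_seq by blast
qed

end

section \<open>Alternating products in a double of a solvable group\<close>

definition translation :: "('a, 'm) monoid_scheme \<Rightarrow> 'a \<Rightarrow> 'a \<times> nat set \<Rightarrow> 'a \<times> nat set" where
  "translation G g = (\<lambda>(h, v). (if h \<in> carrier G then g \<otimes>\<^bsub>G\<^esub> h else h, v))"

text \<open>Over a fixed \<open>h\<close> this is the linear map \<open>1 + N\<close> over the field
  with two elements, where \<open>N\<close> shifts bit \<open>i\<close> to place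
  \<open>i + 1\<close> if \<open>h \<in> C i\<close> and drops it otherwise.\<close>

definition toggle :: "(nat \<Rightarrow> 'a set) \<Rightarrow> 'a \<times> nat set \<Rightarrow> 'a \<times> nat set" where
  "toggle C = (\<lambda>(h, v). (h, {j. (j \<in> v) \<noteq> (\<exists>i\<in>v. j = Suc i \<and> h \<in> C i)}))"

text \<open>In characteristic 2 the square of \<open>1 + N\<close> is \<open>1 + N^2\<close>, and a
  nonzero entry of \<open>N^2\<close> would put \<open>h\<close> into both \<open>C i\<close> and
  \<open>C (Suc i)\<close>.\<close>

lemma toggle_involution:
  assumes "\<And>i. C i \<inter> C (Suc i) = {}"
  shows "toggle C \<circ> toggle C = id"
proof (rule ext, clarify)
  fix h and v :: "nat set"
  let ?w = "{j. (j \<in> v) \<noteq> (\<exists>i\<in>v. j = Suc i \<and> h \<in> C i)}"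
  \<comment> \<open>A bit that the map reads, that is one with \<open>h \<in> C i\<close>, is not
    written by it: writing would require \<open>h\<close> to lie in the preceding set as
    well.\<close>
  have w: "i \<in> ?w \<longleftrightarrow> i \<in> v" if "h \<in> C i" for i
  proof -
    have "h \<notin> C k" if "i = Suc k" for k using assms[of k] \<open>h \<in> C i\<close> that by blast
    then show ?thesis by blast
  qed
  have "(\<exists>i\<in>W. j = Suc i \<and> h \<in> C i) \<longleftrightarrow> (\<exists>i\<in>v. j = Suc i \<and> h \<in> C i)"
    if "\<And>i. h \<in> C i \<Longrightarrow> i \<in> W \<longleftrightarrow> i \<in> v" for W j
    using that by blast
  from this[of ?w, OF w]
  have "{j. (j \<in> ?w) \<noteq> (\<exists>i\<in>?w. j = Suc i \<and> h \<in> C i)} = v"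
    by (intro Set.set_eqI) (simp only: mem_Collect_eq, argo)
  then show "(toggle C \<circ> toggle C) (h, v) = id (h, v)"
    by (simp only: toggle_def comp_apply split_conv id_apply)
qed

context group
begin

lemma translation_triangular_maps:
  assumes "g \<in> carrier G"
  shows "translation G g \<in> triangular_maps G n"
  unfolding triangular_maps_def mem_Collect_eq translation_def using assms
  by (intro conjI allI ballI impI bexI[of _ g]) simp_all

lemma translation_mult:
  assumes "g \<in> carrier G" "g' \<in> carrier G"
  shows "translation G (g \<otimes> g') = translation G g \<circ> translation G g'"
  by (rule ext) (auto simp: translation_def m_assoc assms)

lemma translation_one: "translation G \<one> = id"
  by (rule ext) (auto simp: translation_def)

lemma translation_hom: "translation G \<in> hom G (triangular_group G n)"
proof (rule homI)
  fix g assume g: "g \<in> carrier G"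
  have "translation G (inv g) \<circ> translation G g = id" "translation G g \<circ> translation G (inv g) = id"
    using g by (simp_all add: translation_one flip: translation_mult)
  then show "translation G g \<in> carrier (triangular_group G n)"
    unfolding carrier_triangular_group
    using translation_triangular_maps[OF g] translation_triangular_maps[OF inv_closed[OF g]] by blast
qed (simp add: translation_mult)

lemma toggle_triangular_maps:
  assumes "\<And>i. C i \<subseteq> carrier G" "\<And>i. n \<le> Suc i \<Longrightarrow> C i = {}"
  shows "toggle C \<in> triangular_maps G n"
  unfolding triangular_maps_def mem_Collect_eq
proof (intro conjI allI ballI impI)
  fix h v assume "h \<notin> carrier G"
  then have "\<And>i. h \<notin> C i" using assms(1) by blast
  then show "toggle C (h, v) = (h, v)" by (simp add: toggle_def)
next
  show "\<exists>g\<in>carrier G. \<forall>h\<in>carrier G. \<forall>v. fst (toggle C (h, v)) = g \<otimes> h"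
    by (rule bexI[of _ \<one>]) (simp_all add: toggle_def)
next
  fix h v w and j :: nat assume "v \<inter> {..<j} = w \<inter> {..<j}"
  then have "(\<exists>i\<in>v. j = Suc i \<and> h \<in> C i) \<longleftrightarrow> (\<exists>i\<in>w. j = Suc i \<and> h \<in> C i)"
    unfolding Int_lessThan_eq_iff by (metis lessI)
  then show "(j \<in> snd (toggle C (h, v)) \<longleftrightarrow> j \<in> v) \<longleftrightarrow> (j \<in> snd (toggle C (h, w)) \<longleftrightarrow> j \<in> w)"
    unfolding toggle_def split_conv snd_conv mem_Collect_eq by argo
next
  fix h v and j :: nat assume "n \<le> j"
  then have "\<not> (\<exists>i\<in>v. j = Suc i \<and> h \<in> C i)" using assms(2) by blast
  then show "j \<in> snd (toggle C (h, v)) \<longleftrightarrow> j \<in> v"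
    unfolding toggle_def split_conv snd_conv mem_Collect_eq by argo
qed

text \<open>The \<open>h t\<close> are the partial products of a reduced word folded into
  \<open>G\<close>, and \<open>y t\<close> stands for their images under a homomorphism that is
  \<open>c\<close> on one factor and \<open>c'\<close> on the other. Followed from the single point
  \<open>(\<one>, v0)\<close>, the group coordinate of \<open>y t\<close> runs through the
  \<open>h t\<close>, while the highest bit grows by two at each letter of the second copy and is
  unchanged by letters of the first. At the end it exceeds every bit of \<open>v0\<close>.\<close>

lemma alternating_product_separated:
  assumes "solvable G" and m: "2 \<le> m" and F: "subgroup F G" and h: "\<And>t. t \<le> m \<Longrightarrow> h t \<in> carrier G"
    and "h 0 = \<one>" and step: "\<And>t. t < m \<Longrightarrow> h (Suc t) \<otimes> inv (h t) \<notin> F"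
  obtains T :: "('a \<times> nat set \<Rightarrow> 'a \<times> nat set) monoid" and c c'
  where "group T" "solvable T" "c \<in> hom G T" "c' \<in> hom G T" "\<forall>f\<in>F. c f = c' f"
    "\<forall>y. y 0 = \<one>\<^bsub>T\<^esub> \<longrightarrow> (\<forall>t<m.
       y (Suc t) = (if even t = s then c' else c) (h (Suc t) \<otimes> inv (h t)) \<otimes>\<^bsub>T\<^esub> y t)
       \<longrightarrow> y m \<noteq> \<one>\<^bsub>T\<^esub>"
proof -
  interpret F: subgroup F G by fact
  \<comment> \<open>The sets \<open>C i\<close> with \<open>i \<le> m\<close> write bits up to
    \<open>m + 1\<close>, so \<open>m + 2\<close> coordinates are in use.\<close>
  define n where "n = m + 2"
  define T where "T = triangular_group G n"
  interpret T: group T unfolding T_def by (rule group_triangular_group)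
  \<comment> \<open>The set \<open>C i\<close> is the coset visited at time \<open>i\<close>. Cosets
    at non-consecutive times may coincide; they are told apart by the bit that they read, which
    serves as a clock.\<close>
  define C where "C i = (if i \<le> m then F #> h i else {})" for i
  have C_carrier: "C i \<subseteq> carrier G" for i
    by (simp add: C_def r_coset_subset_G[OF F.subset h])
  have hC: "h i \<in> C i" if "i \<le> m" for i
    using that rcos_self[OF h F] by (simp add: C_def)
  have C_disjoint: "C i \<inter> C (Suc i) = {}" for i
  proof (cases "i < m")
    case True
    have "h (Suc i) \<notin> F #> h i"
      using step[OF True] F.rcos_module_imp[OF is_group h, of i] True by auto
    then have "F #> h i \<noteq> F #> h (Suc i)"
      using rcos_self[OF h F, of "Suc i"] True by auto
    moreover have "F #> h i \<in> rcosets F" "F #> h (Suc i) \<in> rcosets F"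
      using True h F.subset by (auto intro!: rcosetsI)
    ultimately show ?thesis
      using rcos_disjoint[OF F] True unfolding pairwise_def disjnt_def C_def by simp
  qed (simp add: C_def)
  have C_F: "f \<otimes> k \<in> C i \<longleftrightarrow> k \<in> C i" if f: "f \<in> F" and k: "k \<in> carrier G" for f k i
  proof (cases "i \<le> m")
    case True
    have *: "f \<otimes> k \<in> F #> h i" if f: "f \<in> F" and k: "k \<in> F #> h i" for f k
    proof -
      obtain x where "x \<in> F" "k = x \<otimes> h i" using k by (auto simp: r_coset_def)
      then have "f \<otimes> k = (f \<otimes> x) \<otimes> h i" using f h[OF True] by (simp add: m_assoc)
      then show ?thesis using f \<open>x \<in> F\<close> by (auto simp: r_coset_def)
    qed
    have "inv f \<otimes> (f \<otimes> k) = k" using f k by (simp add: m_assoc[symmetric])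
    then show ?thesis
      using *[OF f, of k] *[OF F.m_inv_closed[OF f], of "f \<otimes> k"] True unfolding C_def by auto
  qed (simp add: C_def)
  define \<tau> where "\<tau> = toggle C"
  have \<tau>\<tau>: "\<tau> (\<tau> x) = x" for x
    unfolding \<tau>_def using toggle_involution[of C, OF C_disjoint] by (rule pointfree_idE)
  have \<tau>T: "\<tau> \<in> carrier T"
  proof -
    have "C i = {}" if "n \<le> Suc i" for i using that by (simp add: C_def n_def)
    then have "\<tau> \<in> triangular_maps G n"
      unfolding \<tau>_def by (intro toggle_triangular_maps C_carrier)
    then show ?thesis
      unfolding T_def carrier_triangular_group
      using toggle_involution[of C, OF C_disjoint] unfolding \<tau>_def by blast
  qed
  have mult_T [simp]: "f \<otimes>\<^bsub>T\<^esub> g = f \<circ> g" for f g unfolding T_def by simp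
  have one_T [simp]: "\<one>\<^bsub>T\<^esub> = id" unfolding T_def by simp
  have c_hom: "translation G \<in> hom G T" unfolding T_def by (rule translation_hom)
  define c' where "c' g = \<tau> \<circ> translation G g \<circ> \<tau>" for g
  have c'_hom: "c' \<in> hom G T"
  proof (rule homI)
    fix g assume g: "g \<in> carrier G"
    show "c' g \<in> carrier T"
      using T.m_closed[OF T.m_closed[OF \<tau>T hom_in_carrier[OF c_hom g]] \<tau>T] unfolding mult_T c'_def .
  next
    fix g g' assume "g \<in> carrier G" "g' \<in> carrier G"
    then show "c' (g \<otimes> g') = c' g \<otimes>\<^bsub>T\<^esub> c' g'"
      unfolding c'_def mult_T by (intro ext) (simp add: translation_mult \<tau>\<tau>)
  qed
  \<comment> \<open>The involution sees the group coordinate only through right cosets of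
    \<open>F\<close>. Left translation by \<open>F\<close> preserves these, hence commutes with
    \<open>\<tau>\<close> and is unchanged by the conjugation.\<close>
  have agree: "translation G f = c' f" if f: "f \<in> F" for f
  proof (rule ext, clarify)
    fix k and v :: "nat set"
    have comm: "translation G f (\<tau> (k, v)) = \<tau> (translation G f (k, v))"
      using C_F[OF f] unfolding \<tau>_def toggle_def translation_def by (cases "k \<in> carrier G") simp_all
    show "translation G f (k, v) = c' f (k, v)" unfolding c'_def by (simp add: comm \<tau>\<tau>)
  qed
  have sep: "y m \<noteq> \<one>\<^bsub>T\<^esub>"
    if y0: "y 0 = \<one>\<^bsub>T\<^esub>"
      and y: "\<And>t. t < m \<Longrightarrow>
       y (Suc t) = (if even t = s then c' else translation G) (h (Suc t) \<otimes> inv (h t)) \<otimes>\<^bsub>T\<^esub> y t" for y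
  proof -
    \<comment> \<open>The value \<open>top t\<close> is the index of the coset at which
      \<open>\<tau>\<close> is applied next, counted from time \<open>t\<close>. The initial bit is
      \<open>top 0\<close>: it is 0 if the second copy supplies the first letter, and 1
      otherwise.\<close>
    define v0 :: "nat set" where "v0 = (if s then {0} else {1})"
    define top where "top t = (if even t = s then t else Suc t)" for t
    have "\<exists>v. y t (\<one>, v0) = (h t, v) \<and> top t \<in> v \<and> (\<forall>i>top t. i \<notin> v)" if "t \<le> m" for t
      using that
    proof (induction t)
      case 0
      then show ?case by (auto simp: y0 v0_def top_def \<open>h 0 = \<one>\<close>)
    next
      case (Suc t)
      then obtain v where v: "y t (\<one>, v0) = (h t, v)" "top t \<in> v" "\<forall>i>top t. i \<notin> v" by auto
      have t: "t < m" "h t \<in> carrier G" "h (Suc t) \<in> carrier G" using Suc.prems h by simp_all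
      have tr: "translation G (h (Suc t) \<otimes> inv (h t)) (h t, w) = (h (Suc t), w)" for w
        using t by (simp add: translation_def m_assoc)
      \<comment> \<open>The highest bit \<open>i\<close>, read at a point of \<open>C i\<close>,
        creates bit \<open>i + 1\<close>; lower bits can only write places up to \<open>i\<close>,
        so they cannot cancel it.\<close>
      have tog: "\<exists>w. \<tau> (h i, u) = (h i, w) \<and> Suc i \<in> w \<and> (\<forall>j>Suc i. j \<notin> w)"
        if "i \<le> m" "i \<in> u" "\<forall>j>i. j \<notin> u" for i u
      proof -
        define w where "w = {j. (j \<in> u) \<noteq> (\<exists>k\<in>u. j = Suc k \<and> h i \<in> C k)}"
        have "h i \<in> C i" using hC[OF that(1)] .
        then have "Suc i \<in> w" unfolding w_def using that by auto
        moreover have "\<forall>j>Suc i. j \<notin> w" unfolding w_def using that by auto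
        moreover have "\<tau> (h i, u) = (h i, w)" by (simp only: \<tau>_def toggle_def w_def split_conv)
        ultimately show ?thesis by blast
      qed
      show ?case
      proof (cases "even t = s")
        case True
        obtain w where w: "\<tau> (h t, v) = (h t, w)" "Suc t \<in> w" "\<forall>j>Suc t. j \<notin> w"
          using tog[of t v] t v True by (auto simp: top_def)
        obtain u where u: "\<tau> (h (Suc t), w) = (h (Suc t), u)" "Suc (Suc t) \<in> u" "\<forall>j>Suc (Suc t). j \<notin> u"
          using tog[of "Suc t" w] t w by auto
        have "y (Suc t) (\<one>, v0) = (h (Suc t), u)"
          using y[OF t(1)] True v(1) w(1) tr u(1) by (simp add: c'_def)
        moreover have "top (Suc t) = Suc (Suc t)" using True by (auto simp: top_def)
        ultimately show ?thesis using u by auto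
      next
        case False
        have "y (Suc t) (\<one>, v0) = (h (Suc t), v)"
          using y[OF t(1)] False v(1) tr by simp
        moreover have "top (Suc t) = Suc t" "top t = Suc t" using False by (auto simp: top_def)
        ultimately show ?thesis using v by auto
      qed
    qed
    from this[of m] obtain v where v: "y m (\<one>, v0) = (h m, v)" "top m \<in> v" by auto
    \<comment> \<open>This is where \<open>2 \<le> m\<close> enters: \<open>top m\<close> is at
      least \<open>m\<close>, while \<open>v0\<close> consists of 0 or 1. A single letter of the
      first copy would leave \<open>v0\<close> as it is.\<close>
    have "top m \<notin> v0" using m by (auto simp: v0_def top_def)
    then have "y m (\<one>, v0) \<noteq> (\<one>, v0)" using v by auto
    then show ?thesis by auto
  qed
  have "solvable T" unfolding T_def using \<open>solvable G\<close> by (rule solvable_triangular_group)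
  show ?thesis
  proof (rule that[of T "translation G" c'])
    show "\<forall>f\<in>F. translation G f = c' f" using agree by blast
    show "\<forall>y. y 0 = \<one>\<^bsub>T\<^esub> \<longrightarrow> (\<forall>t<m.
       y (Suc t) = (if even t = s then c' else translation G) (h (Suc t) \<otimes> inv (h t)) \<otimes>\<^bsub>T\<^esub> y t)
       \<longrightarrow> y m \<noteq> \<one>\<^bsub>T\<^esub>"
      using sep by blast
  qed (fact T.is_group \<open>solvable T\<close> c_hom c'_hom)+
qed

end

section \<open>Amalgamated products along a common retract\<close>

context group
begin

text \<open>The sequence \<open>x\<close> lists the partial products of a reduced word, built up from its right end;
  the flag \<open>s\<close> tells whether the first letter used lies in \<open>Q\<close>.\<close>

definition alternating :: "'a set \<Rightarrow> 'a set \<Rightarrow> bool \<Rightarrow> nat \<Rightarrow> (nat \<Rightarrow> 'a) \<Rightarrow> bool" where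
  "alternating P Q s m x \<longleftrightarrow> x 0 = \<one> \<and> (\<forall>t\<le>m. x t \<in> carrier G) \<and>
     (\<forall>t<m. x (Suc t) \<otimes> inv (x t) \<in> (if even t = s then Q else P) - P \<inter> Q)"

lemma alternating_extend:
  assumes "alternating P Q s m x" "p \<in> carrier G" "p \<in> (if even m = s then Q else P) - P \<inter> Q"
  shows "alternating P Q s (Suc m) (x(Suc m := p \<otimes> x m))"
  using assms unfolding alternating_def by (auto simp: m_assoc less_Suc_eq le_Suc_eq)

lemma alternating_replace_last:
  assumes "alternating P Q s (Suc m) x" "p \<in> carrier G"
    "p \<otimes> (x (Suc m) \<otimes> inv (x m)) \<in> (if even m = s then Q else P) - P \<inter> Q"
  shows "alternating P Q s (Suc m) (x(Suc m := p \<otimes> x (Suc m)))"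
  using assms unfolding alternating_def by (auto simp: m_assoc less_Suc_eq le_Suc_eq)

lemma in_subgroup_mult_iff:
  assumes "subgroup F G" "f \<in> F" "x \<in> carrier G"
  shows "f \<otimes> x \<in> F \<longleftrightarrow> x \<in> F"
proof
  interpret F: subgroup F G by fact
  assume "f \<otimes> x \<in> F"
  then have "inv f \<otimes> (f \<otimes> x) \<in> F" using assms(2) by blast
  then show "x \<in> F" using assms by (simp add: m_assoc[symmetric])
qed (rule subgroup.m_closed[OF assms(1,2)])

text \<open>One step of word reduction. Either \<open>p\<close> merges with the leftmost letter
  \<open>l\<close>, or \<open>p \<otimes> l\<close> falls into \<open>P \<inter> Q\<close> and is
  absorbed by the letter next to it, or \<open>p\<close> belongs to the other factor and becomes a
  new letter. The product ends up in \<open>P \<inter> Q\<close> when no letter is left to absorb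
  it.\<close>

lemma alternating_mult:
  assumes P: "subgroup P G" and Q: "subgroup Q G"
    and x: "alternating P Q s m x" and p: "p \<in> P \<union> Q"
  shows "p \<otimes> x m \<in> P \<inter> Q \<or> (\<exists>s' m' x'. alternating P Q s' m' x' \<and> x' m' = p \<otimes> x m)"
proof -
  have PQ: "subgroup (P \<inter> Q) G" using subgroups_Inter_pair[OF P Q] .
  have pc: "p \<in> carrier G" using p subgroup.subset[OF P] subgroup.subset[OF Q] by blast
  define R where "R b = (if b then Q else P)" for b :: bool
  have R: "subgroup (R b) G" for b using P Q by (simp add: R_def)
  have alt: "alternating P Q s m x \<longleftrightarrow> x 0 = \<one> \<and> (\<forall>t\<le>m. x t \<in> carrier G) \<and>
     (\<forall>t<m. x (Suc t) \<otimes> inv (x t) \<in> R (even t = s) - P \<inter> Q)" for s m x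
    unfolding alternating_def R_def ..
  show ?thesis
  proof (cases m)
    case 0
    then have x0: "x m = \<one>" using x by (simp add: alternating_def)
    show ?thesis
    proof (cases "p \<in> P \<inter> Q")
      case True
      then show ?thesis using x0 pc by simp
    next
      case False
      define s' where "s' = (p \<in> Q)"
      have "alternating P Q s' 0 (\<lambda>_. \<one>)" by (simp add: alternating_def)
      moreover have "p \<in> (if even 0 = s' then Q else P) - P \<inter> Q"
        using p False by (auto simp: s'_def)
      ultimately have "alternating P Q s' (Suc 0) ((\<lambda>_. \<one>)(Suc 0 := p \<otimes> \<one>))"
        using alternating_extend pc by blast
      then show ?thesis unfolding x0 by (intro disjI2 exI conjI) (assumption, simp)
    qed
  next
    case (Suc n)
    define l where "l = x (Suc n) \<otimes> inv (x n)"
    have xc: "x n \<in> carrier G" "x (Suc n) \<in> carrier G" using x Suc by (simp_all add: alternating_def)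
    have l: "l \<in> R (even n = s)" "l \<notin> P \<inter> Q" "l \<in> carrier G"
      using x Suc xc unfolding alt l_def by auto
    have xS: "x (Suc n) = l \<otimes> x n" using xc by (simp add: l_def m_assoc)
    show ?thesis
    proof (cases "p \<in> R (even n = s) \<and> p \<otimes> l \<notin> P \<inter> Q")
      case True
      then have "p \<otimes> l \<in> R (even n = s)" using subgroup.m_closed[OF R _ l(1)] by simp
      then have "alternating P Q s (Suc n) (x(Suc n := p \<otimes> x (Suc n)))"
        using True x Suc pc by (intro alternating_replace_last) (auto simp: l_def R_def)
      then show ?thesis using Suc by (intro disjI2 exI conjI) (assumption, simp)
    next
      case False
      \<comment> \<open>Multiplying a letter by an element of \<open>P \<inter> Q\<close> keeps it
        in its factor and outside the intersection, so such a \<open>p\<close> was merged in the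
        previous case.\<close>
      have pF: "p \<notin> P \<inter> Q"
        using False in_subgroup_mult_iff[OF PQ _ l(3), of p] l(2) unfolding R_def by auto
      show ?thesis
      proof (cases "p \<in> R (even n = s)")
        case True
        then have f: "p \<otimes> l \<in> P \<inter> Q" using False by blast
        have px: "p \<otimes> x m = (p \<otimes> l) \<otimes> x n" using xS Suc xc l pc by (simp add: m_assoc)
        have x': "alternating P Q s n x" using x Suc by (simp add: alternating_def)
        show ?thesis
        proof (cases n)
          case 0
          then have "x n = \<one>" using x by (simp add: alternating_def)
          then show ?thesis using f px pc l by simp
        next
          case (Suc k)
          \<comment> \<open>The letter below the cancelled one takes up
            \<open>p \<otimes> l\<close>; both its factor and its being outside
            \<open>P \<inter> Q\<close> are preserved, since \<open>p \<otimes> l\<close> lies in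
            both factors.\<close>
          have "x (Suc k) \<otimes> inv (x k) \<in> (if even k = s then Q else P) - P \<inter> Q"
            using x' Suc by (simp add: alternating_def)
          moreover have "x (Suc k) \<otimes> inv (x k) \<in> carrier G"
            using x' Suc by (simp add: alternating_def)
          ultimately have "(p \<otimes> l) \<otimes> (x (Suc k) \<otimes> inv (x k)) \<in> (if even k = s then Q else P) - P \<inter> Q"
            using f in_subgroup_mult_iff[OF PQ f] in_subgroup_mult_iff[OF P, of "p \<otimes> l"]
              in_subgroup_mult_iff[OF Q, of "p \<otimes> l"] by (cases "even k = s") auto
          then have "alternating P Q s (Suc k) (x(Suc k := (p \<otimes> l) \<otimes> x (Suc k)))"
            using x' Suc pc l(3) by (intro alternating_replace_last) auto
          then show ?thesis unfolding px Suc by (intro disjI2 exI conjI) (assumption, simp)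
        qed
      next
        case False
        then have "p \<in> R (even m = s)" using p Suc by (auto simp: R_def split: if_splits)
        then have "alternating P Q s (Suc m) (x(Suc m := p \<otimes> x m))"
          using pF x pc by (intro alternating_extend) (auto simp: R_def)
        then show ?thesis by (intro disjI2 exI conjI) (assumption, simp)
      qed
    qed
  qed
qed

lemma generate_alternating:
  assumes P: "subgroup P G" and Q: "subgroup Q G" and y: "y \<in> generate G (P \<union> Q)"
  shows "y \<in> P \<inter> Q \<or> (\<exists>s m x. alternating P Q s m x \<and> x m = y)"
proof -
  define N where "N = {y. y \<in> P \<inter> Q \<or> (\<exists>s m x. alternating P Q s m x \<and> x m = y)}"
  have PQ: "subgroup (P \<inter> Q) G" using subgroups_Inter_pair[OF P Q] .
  have mult: "p \<otimes> z \<in> N" if p: "p \<in> P \<union> Q" and z: "z \<in> N" for p z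
  proof -
    have pc: "p \<in> carrier G" using p subgroup.subset[OF P] subgroup.subset[OF Q] by blast
    from z consider "z \<in> P \<inter> Q" | s m x where "alternating P Q s m x" "x m = z"
      unfolding N_def by blast
    then show ?thesis
    proof cases
      case 1
      show ?thesis
      proof (cases "p \<otimes> z \<in> P \<inter> Q")
        case False
        have pz: "p \<otimes> z \<in> P \<union> Q" using p 1 subgroup.m_closed[OF P] subgroup.m_closed[OF Q] by blast
        \<comment> \<open>Now \<open>p \<otimes> z\<close> is a single element of one factor, so it
          can be treated as a letter applied to the empty word.\<close>
        have "alternating P Q True 0 (\<lambda>_. \<one>)" by (simp add: alternating_def)
        from alternating_mult[OF P Q this pz] have "(p \<otimes> z) \<otimes> \<one> \<in> N" unfolding N_def by blast
        then show ?thesis using pc 1 subgroup.mem_carrier[OF P] by simp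
      qed (simp add: N_def)
    next
      case 2
      then show ?thesis using alternating_mult[OF P Q 2(1) p] unfolding N_def by blast
    qed
  qed
  have sub: "P \<union> Q \<subseteq> carrier G"
    using subgroup.subset[OF P] subgroup.subset[OF Q] by blast
  \<comment> \<open>The claim is about left multiplication by \<open>y\<close>, not about
    \<open>y\<close> itself: \<open>generate\<close> multiplies two arbitrary generated elements,
    and left multiplications compose.\<close>
  have "\<forall>z\<in>N. y \<otimes> z \<in> N"
    using y
  proof (induction y rule: generate.induct)
    case one
    have "N \<subseteq> carrier G"
      unfolding N_def using subgroup.subset[OF P] by (auto simp: alternating_def)
    then show ?case by auto
  next
    case (incl h)
    then show ?case using mult by blast
  next
    case (inv h)
    then have "inv h \<in> P \<union> Q" using subgroup.m_inv_closed[OF P] subgroup.m_inv_closed[OF Q] by blast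
    then show ?case using mult by blast
  next
    case (eng h1 h2)
    have "N \<subseteq> carrier G"
      unfolding N_def using subgroup.subset[OF P] by (auto simp: alternating_def)
    moreover have "h1 \<in> carrier G" "h2 \<in> carrier G"
      using eng generate_in_carrier[OF sub] by blast+
    ultimately show ?case using eng.IH by (auto simp: m_assoc)
  qed
  moreover have "\<one> \<in> N" unfolding N_def using subgroup.one_closed[OF PQ] by blast
  ultimately have "y \<otimes> \<one> \<in> N" by blast
  moreover have "y \<in> carrier G" using generate_in_carrier[OF sub y] .
  ultimately show ?thesis unfolding N_def by simp
qed

end

text \<open>If \<open>l = d \<otimes> f\<close>, then \<open>e l = e d \<otimes> f\<close>, so
  \<open>l \<otimes> inv (e l) = d \<otimes> inv (e d)\<close> lies in the derived subgroup, which
  \<open>e\<close> maps into itself. But \<open>l \<otimes> inv (e l)\<close> is a nontrivial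
  element of \<open>P\<close> and hence avoids a late derived subgroup. The conclusion means that
  modulo this subgroup the image of \<open>l\<close> stays outside the image of
  \<open>F\<close>.\<close>

lemma (in group) retract_letter_separated:
  assumes P: "subgroup P G" and F: "subgroup F G" "F \<subseteq> P"
    and e: "e \<in> hom G G" "\<And>p. p \<in> P \<Longrightarrow> e p \<in> F" "\<And>f. f \<in> F \<Longrightarrow> e f = f"
    and sep: "\<And>x. \<lbrakk>x \<in> P; x \<noteq> \<one>\<rbrakk> \<Longrightarrow> \<exists>n. x \<notin> derived_series G n"
    and l: "l \<in> P - F"
  shows "\<exists>n. \<forall>d\<in>derived_series G n. \<forall>f\<in>F. l \<noteq> d \<otimes> f"
proof -
  have lc: "l \<in> carrier G" using l subgroup.subset[OF P] by blast
  have elF: "e l \<in> F" using e(2) l by blast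
  then have elP: "e l \<in> P" using F(2) by blast
  then have elc: "e l \<in> carrier G" using subgroup.subset[OF P] by blast
  have "l \<otimes> inv (e l) \<in> P"
    using subgroup.m_closed[OF P _ subgroup.m_inv_closed[OF P elP]] l by blast
  moreover have "l \<otimes> inv (e l) \<noteq> \<one>"
  proof
    assume "l \<otimes> inv (e l) = \<one>"
    then have "l = e l" using lc elc by (metis inv_closed inv_equality inv_inv)
    then show False using elF l by simp
  qed
  ultimately obtain n where n: "l \<otimes> inv (e l) \<notin> derived_series G n" using sep by blast
  have "l \<noteq> d \<otimes> f" if d: "d \<in> derived_series G n" and f: "f \<in> F" for d f
  proof
    assume eq: "l = d \<otimes> f"
    interpret D: normal "derived_series G n" G by (rule derived_series_normal)
    have dc: "d \<in> carrier G" using d D.subset by blast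
    have fc: "f \<in> carrier G" using f subgroup.subset[OF F(1)] by blast
    have ed: "e d \<in> derived_series G n" by (rule hom_in_derived_series[OF is_group is_group e(1) d])
    then have edc: "e d \<in> carrier G" using D.subset by blast
    have "e l = e d \<otimes> f" unfolding eq hom_mult[OF e(1) dc fc] e(3)[OF f] ..
    then have "l \<otimes> inv (e l) = d \<otimes> inv (e d)"
      unfolding eq using dc fc edc by (simp add: inv_mult_group m_assoc) (simp add: m_assoc[symmetric])
    moreover have "d \<otimes> inv (e d) \<in> derived_series G n"
      using D.m_closed[OF d D.m_inv_closed[OF ed]] .
    ultimately show False using n by simp
  qed
  then show ?thesis by blast
qed

text \<open>An assumption cannot quantify over types, so the universal property is demanded only for
  targets of the type in which the separating solvable group lives.\<close>

theorem (in group) residually_solvable_amalgam: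
  assumes P: "subgroup P G" and Q: "subgroup Q G" and gen: "carrier G = generate G (P \<union> Q)"
    and eP: "eP \<in> hom G G" "\<And>p. p \<in> P \<Longrightarrow> eP p = p" "\<And>q. q \<in> Q \<Longrightarrow> eP q \<in> P \<inter> Q"
    and eQ: "eQ \<in> hom G G" "\<And>q. q \<in> Q \<Longrightarrow> eQ q = q" "\<And>p. p \<in> P \<Longrightarrow> eQ p \<in> P \<inter> Q"
    and sep: "\<And>x. \<lbrakk>x \<in> P \<union> Q; x \<noteq> \<one>\<rbrakk> \<Longrightarrow> \<exists>n. x \<notin> derived_series G n"
    and universal: "\<And>(T :: ('a set \<times> nat set \<Rightarrow> 'a set \<times> nat set) monoid) c c'.
      \<lbrakk>group T; c \<in> hom G T; c' \<in> hom G T; \<And>f. f \<in> P \<inter> Q \<Longrightarrow> c f = c' f\<rbrakk>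
      \<Longrightarrow> \<exists>\<Theta>\<in>hom G T. (\<forall>p\<in>P. \<Theta> p = c p) \<and> (\<forall>q\<in>Q. \<Theta> q = c' q)"
  shows "residually_solvable G"
  unfolding residually_solvable_iff
proof (intro conjI ballI impI)
  show "group G" by (rule is_group)
  have PQ: "subgroup (P \<inter> Q) G" using subgroups_Inter_pair[OF P Q] .
  fix z assume z: "z \<in> carrier G" and zD: "\<forall>n. z \<in> derived_series G n"
  show "z = \<one>"
  proof (rule ccontr)
    assume "z \<noteq> \<one>"
    then have zPQ: "z \<notin> P \<union> Q" using sep zD by blast
    then obtain s m x where x: "alternating P Q s m x" "x m = z"
      using generate_alternating[OF P Q] z gen by blast
    define l where "l t = x (Suc t) \<otimes> inv (x t)" for t
    have xc: "x t \<in> carrier G" if "t \<le> m" for t using x(1) that by (simp add: alternating_def)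
    have x0: "x 0 = \<one>" using x(1) by (simp add: alternating_def)
    have l: "l t \<in> (if even t = s then Q else P) - P \<inter> Q" if "t < m" for t
      using x(1) that unfolding alternating_def l_def by blast
    have lc: "l t \<in> carrier G" if "t < m" for t
      using xc[of t] xc[of "Suc t"] that by (simp add: l_def)
    have xS: "x (Suc t) = l t \<otimes> x t" if "t < m" for t
      using xc[of t] xc[of "Suc t"] that by (simp add: l_def m_assoc)
    have m: "2 \<le> m"
    proof (rule ccontr)
      assume "\<not> 2 \<le> m"
      then consider "m = 0" | "m = Suc 0" by linarith
      then show False
      proof cases
        case 1
        then show False using x(2) x0 \<open>z \<noteq> \<one>\<close> by simp
      next
        case 2
        then have "l 0 \<in> P \<union> Q" using l[of 0] by (simp split: if_splits)
        moreover have "l 0 = z" using xS[of 0] 2 x0 x(2) lc[of 0] by simp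
        ultimately show False using zPQ by simp
      qed
    qed
    \<comment> \<open>The retractions are used crosswise: \<open>eP\<close> retracts
      \<open>Q\<close> onto \<open>P \<inter> Q\<close>, and \<open>eQ\<close> retracts
      \<open>P\<close> onto it.\<close>
    have "\<exists>n. \<forall>d\<in>derived_series G n. \<forall>f\<in>P \<inter> Q. l t \<noteq> d \<otimes> f" if t: "t < m" for t
    proof (cases "even t = s")
      case True
      then show ?thesis
        using l[OF t] eP sep by (intro retract_letter_separated[OF Q PQ _ eP(1)]) auto
    next
      case False
      then show ?thesis
        using l[OF t] eQ sep by (intro retract_letter_separated[OF P PQ _ eQ(1)]) auto
    qed
    then obtain n where n: "\<And>t d f. \<lbrakk>t < m; d \<in> derived_series G (n t); f \<in> P \<inter> Q\<rbrakk> \<Longrightarrow> l t \<noteq> d \<otimes> f"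
      by metis
    \<comment> \<open>One solvable quotient has to serve all letters. As the derived series
      decreases, the sum of the indices is late enough for each of them.\<close>
    define D where "D = derived_series G (\<Sum>t<m. n t)"
    have D: "D \<subseteq> derived_series G (n t)" if "t < m" for t
    proof -
      have "n t \<le> (\<Sum>t<m. n t)" using that by (intro member_le_sum) auto
      then show ?thesis
        unfolding D_def using derived_series_decreasing[of "(\<Sum>t<m. n t) - n t" "n t"] by simp
    qed
    interpret D: normal D G unfolding D_def by (rule derived_series_normal)
    interpret S: group "G Mod D" by (rule D.factorgroup_is_group)
    let ?\<sigma> = "\<lambda>x. D #> x"
    interpret \<sigma>: group_hom G "G Mod D" ?\<sigma>
      by unfold_locales (rule D.r_coset_hom_Mod)
    have solv: "solvable (G Mod D)" unfolding D_def by (rule solvable_Mod_derived_series)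
    have F: "subgroup (?\<sigma> ` (P \<inter> Q)) (G Mod D)" by (rule \<sigma>.subgroup_img_is_subgroup[OF PQ])
    have hl: "?\<sigma> (x (Suc t)) \<otimes>\<^bsub>G Mod D\<^esub> inv\<^bsub>G Mod D\<^esub> ?\<sigma> (x t) = ?\<sigma> (l t)" if "t < m" for t
      unfolding l_def using xc[of t] xc[of "Suc t"] that
      by (simp only: \<sigma>.hom_mult \<sigma>.hom_inv inv_closed Suc_leI less_imp_le)
    have step: "?\<sigma> (x (Suc t)) \<otimes>\<^bsub>G Mod D\<^esub> inv\<^bsub>G Mod D\<^esub> ?\<sigma> (x t) \<notin> ?\<sigma> ` (P \<inter> Q)"
      if t: "t < m" for t
    proof
      assume "?\<sigma> (x (Suc t)) \<otimes>\<^bsub>G Mod D\<^esub> inv\<^bsub>G Mod D\<^esub> ?\<sigma> (x t) \<in> ?\<sigma> ` (P \<inter> Q)"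
      then obtain f where f: "f \<in> P \<inter> Q" "D #> l t = D #> f" unfolding hl[OF t] by blast
      have "l t \<in> D #> f" using rcos_self[OF lc[OF t] D.is_subgroup] f(2) by simp
      then obtain d where "d \<in> D" "l t = d \<otimes> f" unfolding r_coset_def by blast
      then show False using n[OF t _ f(1)] D[OF t] by blast
    qed
    have hc: "?\<sigma> (x t) \<in> carrier (G Mod D)" if "t \<le> m" for t by (rule \<sigma>.hom_closed[OF xc[OF that]])
    have h0: "?\<sigma> (x 0) = \<one>\<^bsub>G Mod D\<^esub>" unfolding x0 by (rule \<sigma>.hom_one)
    obtain T :: "('a set \<times> nat set \<Rightarrow> 'a set \<times> nat set) monoid" and c c'
      where T: "group T" "solvable T" "c \<in> hom (G Mod D) T" "c' \<in> hom (G Mod D) T"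
        "\<forall>f\<in>?\<sigma> ` (P \<inter> Q). c f = c' f"
      and ne: "\<forall>y. y 0 = \<one>\<^bsub>T\<^esub> \<longrightarrow> (\<forall>t<m. y (Suc t) = (if even t = s then c' else c)
           (?\<sigma> (x (Suc t)) \<otimes>\<^bsub>G Mod D\<^esub> inv\<^bsub>G Mod D\<^esub> ?\<sigma> (x t)) \<otimes>\<^bsub>T\<^esub> y t) \<longrightarrow> y m \<noteq> \<one>\<^bsub>T\<^esub>"
      by (rule S.alternating_product_separated[of m "?\<sigma> ` (P \<inter> Q)" "\<lambda>t. ?\<sigma> (x t)" s,
          OF solv m F hc h0 step])
    interpret T: group T by (rule T(1))
    have "c \<circ> ?\<sigma> \<in> hom G T" "c' \<circ> ?\<sigma> \<in> hom G T"
      by (rule Group.hom_compose[OF D.r_coset_hom_Mod], fact)+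
    then obtain \<Theta> where \<Theta>: "\<Theta> \<in> hom G T" "\<And>p. p \<in> P \<Longrightarrow> \<Theta> p = c (?\<sigma> p)" "\<And>q. q \<in> Q \<Longrightarrow> \<Theta> q = c' (?\<sigma> q)"
      using universal[OF T(1), of "c \<circ> ?\<sigma>" "c' \<circ> ?\<sigma>"] T(5) unfolding comp_apply by blast
    \<comment> \<open>The images of the partial products satisfy the recursion demanded by
      \<open>ne\<close>, since the parity that selects \<open>c'\<close> or \<open>c\<close> is the
      one that puts the letter into \<open>Q\<close> or \<open>P\<close>.\<close>
    have "\<Theta> (x m) \<noteq> \<one>\<^bsub>T\<^esub>"
    proof (rule ne[rule_format, of "\<lambda>t. \<Theta> (x t)"])
      show "\<Theta> (x 0) = \<one>\<^bsub>T\<^esub>" unfolding x0 by (rule hom_one[OF \<Theta>(1) is_group T(1)])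
      fix t assume t: "t < m"
      have "\<Theta> (x (Suc t)) = \<Theta> (l t) \<otimes>\<^bsub>T\<^esub> \<Theta> (x t)"
        unfolding xS[OF t] using hom_mult[OF \<Theta>(1) lc[OF t] xc[of t]] t by simp
      moreover have "\<Theta> (l t) = (if even t = s then c' else c) (?\<sigma> (l t))"
        using l[OF t] \<Theta>(2,3) by (simp split: if_splits)
      ultimately show "\<Theta> (x (Suc t)) = (if even t = s then c' else c)
           (?\<sigma> (x (Suc t)) \<otimes>\<^bsub>G Mod D\<^esub> inv\<^bsub>G Mod D\<^esub> ?\<sigma> (x t)) \<otimes>\<^bsub>T\<^esub> \<Theta> (x t)"
        unfolding hl[OF t] by simp
    qed
    moreover obtain r where "derived_series T r = {\<one>\<^bsub>T\<^esub>}"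
      using T(2) T.solvable_iff_trivial_derived_seq by blast
    ultimately show False
      using hom_in_derived_series[OF is_group T(1) \<Theta>(1), of z r] zD x(2) by auto
  qed
qed

section \<open>Free products and presentations\<close>

locale group_family =
  fixes I :: "'i set" and Gs :: "'i \<Rightarrow> ('a, 'm) monoid_scheme"
  assumes groups: "i \<in> I \<Longrightarrow> group (Gs i)"
begin

abbreviation W where "W \<equiv> free_product_words I Gs"
abbreviation R where "R \<equiv> free_product_rel I Gs"
abbreviation F where "F \<equiv> free_product I Gs"
abbreviation \<iota> where "\<iota> \<equiv> free_product_incl I Gs"

lemma words_Nil: "[] \<in> W"
  by (simp add: free_product_words_def)

lemma words_Cons: "(i, x) # w \<in> W \<longleftrightarrow> i \<in> I \<and> x \<in> carrier (Gs i) \<and> w \<in> W"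
  by (auto simp: free_product_words_def)

lemma words_append: "v @ w \<in> W \<longleftrightarrow> v \<in> W \<and> w \<in> W"
  by (auto simp: free_product_words_def)

lemmas words_simps = words_Nil words_Cons words_append

lemma rel_words:
  assumes "(v, w) \<in> R"
  shows "v \<in> W \<and> w \<in> W"
  using assms
proof (induction rule: free_product_rel.induct)
  case (one u v i)
  then interpret group "Gs i" using groups by blast
  show ?case using one by (simp add: words_simps)
next
  case (mult u v i x y)
  then interpret group "Gs i" using groups by blast
  show ?case using mult by (simp add: words_simps)
qed auto

lemma rel_equiv: "equiv W R"
proof (rule equivI)
  show "R \<subseteq> W \<times> W" using rel_words by auto
  show "refl_on W R"
    by (rule refl_onI) (rule free_product_rel.refl)
  show "sym R" by (rule symI) (rule free_product_rel.sym)
  show "trans R" by (rule transI) (rule free_product_rel.trans)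
qed

lemma rel_context:
  assumes "(v, v') \<in> R" "u \<in> W" "w \<in> W"
  shows "(u @ v @ w, u @ v' @ w) \<in> R"
  using assms
proof (induction rule: free_product_rel.induct)
  case (refl v)
  then show ?case by (intro free_product_rel.refl) (simp add: words_simps)
next
  case (sym v v')
  then show ?case by (blast intro: free_product_rel.sym)
next
  case (trans v v' v'')
  then show ?case by (blast intro: free_product_rel.trans)
next
  case (one a b i)
  then show ?case using free_product_rel.one[of "u @ a" I Gs "b @ w" i] by (simp add: words_simps)
next
  case (mult a b i x y)
  then show ?case using free_product_rel.mult[of "u @ a" I Gs "b @ w" i x y] by (simp add: words_simps)
qed

lemma rel_append:
  assumes "(u, u') \<in> R" "(v, v') \<in> R"
  shows "(u @ v, u' @ v') \<in> R"
proof (rule free_product_rel.trans)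
  show "(u @ v, u' @ v) \<in> R"
    using rel_context[OF assms(1) words_Nil, of v] rel_words[OF assms(2)] by simp
  show "(u' @ v, u' @ v') \<in> R"
    using rel_context[OF assms(2) _ words_Nil, of u'] rel_words[OF assms(1)] by simp
qed

definition word_class where "word_class w = R `` {w}"

lemma carrier_free_product: "carrier F = word_class ` W"
  by (auto simp: free_product_def quotient_def word_class_def)

lemma word_class_eq_iff: "\<lbrakk>v \<in> W; w \<in> W\<rbrakk> \<Longrightarrow> word_class v = word_class w \<longleftrightarrow> (v, w) \<in> R"
  unfolding word_class_def by (rule eq_equiv_class_iff[OF rel_equiv])

lemma word_class_mult:
  assumes "v \<in> W" "w \<in> W"
  shows "word_class v \<otimes>\<^bsub>F\<^esub> word_class w = word_class (v @ w)"
proof -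
  have "(\<lambda>u v. R `` {u @ v}) respects2 R"
  proof (rule congruent2I')
    fix u u' v v' assume "(u, u') \<in> R" "(v, v') \<in> R"
    then show "R `` {u @ v} = R `` {u' @ v'}"
      using equiv_class_eq[OF rel_equiv rel_append] by blast
  qed
  then show ?thesis
    unfolding word_class_def free_product_def
    by (simp add: UN_equiv_class2[OF rel_equiv rel_equiv _ assms])
qed

lemma word_class_one: "\<one>\<^bsub>F\<^esub> = word_class []"
  by (simp add: free_product_def word_class_def)

lemma incl_eq_word_class: "\<iota> i x = word_class [(i, x)]"
  by (simp add: free_product_incl_def word_class_def)

lemma word_left_inverse:
  assumes "w \<in> W"
  shows "\<exists>v\<in>W. (v @ w, []) \<in> R"
  using assms
proof (induction w)
  case Nil
  then show ?case using words_Nil free_product_rel.refl[OF words_Nil] by (intro bexI[of _ "[]"]) simp_all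
next
  case (Cons a w)
  obtain i x where a: "a = (i, x)" by fastforce
  have ix: "i \<in> I" "x \<in> carrier (Gs i)" "w \<in> W" using Cons.prems by (simp_all add: a words_simps)
  interpret group "Gs i" using groups ix by blast
  obtain v where v: "v \<in> W" "(v @ w, []) \<in> R" using Cons.IH ix by blast
  let ?v = "v @ [(i, inv\<^bsub>Gs i\<^esub> x)]"
  have "(v @ [(i, inv\<^bsub>Gs i\<^esub> x), (i, x)] @ w, v @ [(i, inv\<^bsub>Gs i\<^esub> x \<otimes>\<^bsub>Gs i\<^esub> x)] @ w) \<in> R"
    by (rule free_product_rel.mult) (use v ix in auto)
  moreover have "(v @ [(i, \<one>\<^bsub>Gs i\<^esub>)] @ w, v @ w) \<in> R"
    by (rule free_product_rel.one) (use v ix in auto)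
  ultimately have "(?v @ a # w, v @ w) \<in> R"
    using ix free_product_rel.trans by (simp add: a) 
  then have "(?v @ a # w, []) \<in> R" using v(2) by (rule free_product_rel.trans)
  moreover have "?v \<in> W" using v ix by (simp add: words_simps)
  ultimately show ?case by blast
qed

lemma group_free_product: "group F"
proof (rule groupI)
  fix x y assume "x \<in> carrier F" "y \<in> carrier F"
  then show "x \<otimes>\<^bsub>F\<^esub> y \<in> carrier F"
    by (auto simp: carrier_free_product word_class_mult words_simps)
next
  show "\<one>\<^bsub>F\<^esub> \<in> carrier F" by (simp add: carrier_free_product word_class_one words_simps)
next
  fix x y z assume "x \<in> carrier F" "y \<in> carrier F" "z \<in> carrier F"
  then show "x \<otimes>\<^bsub>F\<^esub> y \<otimes>\<^bsub>F\<^esub> z = x \<otimes>\<^bsub>F\<^esub> (y \<otimes>\<^bsub>F\<^esub> z)"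
    by (auto simp: carrier_free_product word_class_mult words_simps)
next
  fix x assume "x \<in> carrier F"
  then obtain w where w: "w \<in> W" "x = word_class w" by (auto simp: carrier_free_product)
  then show "\<one>\<^bsub>F\<^esub> \<otimes>\<^bsub>F\<^esub> x = x" by (simp add: word_class_one word_class_mult words_simps)
  obtain v where v: "v \<in> W" "(v @ w, []) \<in> R" using word_left_inverse w by blast
  then have "word_class v \<otimes>\<^bsub>F\<^esub> x = \<one>\<^bsub>F\<^esub>"
    using w by (simp add: word_class_mult word_class_one word_class_eq_iff words_simps)
  then show "\<exists>y\<in>carrier F. y \<otimes>\<^bsub>F\<^esub> x = \<one>\<^bsub>F\<^esub>" using v by (auto simp: carrier_free_product)
qed

lemma incl_hom:
  assumes i: "i \<in> I"
  shows "\<iota> i \<in> hom (Gs i) F"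
proof (rule homI)
  fix x assume "x \<in> carrier (Gs i)"
  then show "\<iota> i x \<in> carrier F"
    using i by (auto simp: incl_eq_word_class carrier_free_product words_simps)
next
  fix x y assume xy: "x \<in> carrier (Gs i)" "y \<in> carrier (Gs i)"
  have "([] @ [(i, x), (i, y)] @ [], [] @ [(i, x \<otimes>\<^bsub>Gs i\<^esub> y)] @ []) \<in> R"
    by (rule free_product_rel.mult) (use xy i words_Nil in auto)
  then have "word_class [(i, x), (i, y)] = word_class [(i, x \<otimes>\<^bsub>Gs i\<^esub> y)]"
    using rel_words word_class_eq_iff by auto
  then show "\<iota> i (x \<otimes>\<^bsub>Gs i\<^esub> y) = \<iota> i x \<otimes>\<^bsub>F\<^esub> \<iota> i y"
    using xy i by (simp add: incl_eq_word_class word_class_mult words_simps)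
qed

text \<open>Inverses of letters are letters, so left multiplication by letters reaches every element
  from the identity.\<close>

lemma free_product_induct [consumes 1, case_names one mult]:
  assumes "x \<in> carrier F" and "P \<one>\<^bsub>F\<^esub>"
    and step: "\<And>i g x. \<lbrakk>i \<in> I; g \<in> carrier (Gs i); x \<in> carrier F; P x\<rbrakk> \<Longrightarrow> P (\<iota> i g \<otimes>\<^bsub>F\<^esub> x)"
  shows "P x"
proof -
  have "P (word_class w)" if "w \<in> W" for w
    using that
  proof (induction w)
    case Nil
    then show ?case using \<open>P \<one>\<^bsub>F\<^esub>\<close> by (simp add: word_class_one)
  next
    case (Cons a w)
    obtain i g where a: "a = (i, g)" by fastforce
    have *: "i \<in> I" "g \<in> carrier (Gs i)" "w \<in> W" using Cons.prems by (simp_all add: a words_simps)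
    have "word_class (a # w) = \<iota> i g \<otimes>\<^bsub>F\<^esub> word_class w"
      using * by (simp add: a incl_eq_word_class word_class_mult words_simps)
    then show ?case using step[OF *(1,2), of "word_class w"] Cons.IH[OF *(3)] *(3)
      by (simp add: carrier_free_product)
  qed
  then show ?thesis using assms(1) by (auto simp: carrier_free_product)
qed

lemma free_product_hom:
  assumes K: "group K" and f: "\<And>i. i \<in> I \<Longrightarrow> f i \<in> hom (Gs i) K"
  shows "\<exists>h\<in>hom F K. \<forall>i\<in>I. \<forall>g\<in>carrier (Gs i). h (\<iota> i g) = f i g"
proof -
  interpret K: group K by fact
  define ev where "ev w = foldr (\<lambda>(i, x) a. f i x \<otimes>\<^bsub>K\<^esub> a) w \<one>\<^bsub>K\<^esub>" for w
  have fc: "f i x \<in> carrier K" if "i \<in> I" "x \<in> carrier (Gs i)" for i x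
    using hom_in_carrier[OF f] that by blast
  have ev_Nil: "ev [] = \<one>\<^bsub>K\<^esub>" and ev_Cons: "ev ((i, x) # w) = f i x \<otimes>\<^bsub>K\<^esub> ev w" for i x w
    by (simp_all add: ev_def)
  have ev_closed: "ev w \<in> carrier K" if "w \<in> W" for w
    using that by (induction w) (auto simp: ev_Nil ev_Cons words_simps fc)
  have ev_append: "ev (v @ w) = ev v \<otimes>\<^bsub>K\<^esub> ev w" if "v \<in> W" "w \<in> W" for v w
    using that by (induction v) (auto simp: ev_Nil ev_Cons words_simps fc ev_closed K.m_assoc)
  have ev_rel: "ev v = ev w" if "(v, w) \<in> R" for v w
    using that
  proof (induction rule: free_product_rel.induct)
    case (one u v i)
    interpret Gi: group "Gs i" using groups one by blast
    have "f i \<one>\<^bsub>Gs i\<^esub> = \<one>\<^bsub>K\<^esub>" using hom_one[OF f Gi.is_group K] one by blast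
    then show ?case using one by (simp add: ev_append ev_Nil ev_Cons words_simps ev_closed)
  next
    case (mult u v i x y)
    interpret Gi: group "Gs i" using groups mult by blast
    have "f i (x \<otimes>\<^bsub>Gs i\<^esub> y) = f i x \<otimes>\<^bsub>K\<^esub> f i y" using hom_mult[OF f] mult by blast
    then show ?case
      using mult by (simp add: ev_append ev_Nil ev_Cons words_simps ev_closed fc K.m_assoc)
  qed auto
  \<comment> \<open>A class is evaluated at a chosen representative; by \<open>ev_rel\<close> the
    choice does not affect the value.\<close>
  define h where "h U = ev (SOME w. w \<in> U)" for U
  have h: "h (word_class w) = ev w" if w: "w \<in> W" for w
  proof -
    have "w \<in> word_class w"
      unfolding word_class_def using w free_product_rel.refl by blast
    then have "(SOME v. v \<in> word_class w) \<in> word_class w" by (rule someI)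
    then have "(w, SOME v. v \<in> word_class w) \<in> R" unfolding word_class_def by blast
    from ev_rel[OF this] show ?thesis by (simp add: h_def)
  qed
  have "h \<in> hom F K"
  proof (rule homI)
    fix x y assume "x \<in> carrier F" "y \<in> carrier F"
    then show "h (x \<otimes>\<^bsub>F\<^esub> y) = h x \<otimes>\<^bsub>K\<^esub> h y"
      by (auto simp: carrier_free_product word_class_mult h ev_append words_simps)
  qed (auto simp: carrier_free_product h ev_closed)
  moreover have "h (\<iota> i g) = f i g" if "i \<in> I" "g \<in> carrier (Gs i)" for i g
    using that by (simp add: incl_eq_word_class h words_simps ev_Nil ev_Cons fc)
  ultimately show ?thesis by blast
qed

end

text \<open>The set must lie in the carrier: otherwise no normal subgroup contains it, and the
  intersection over the empty family is the whole type.\<close>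

lemma (in group) normal_closure_normal:
  assumes "S \<subseteq> carrier G"
  shows "normal_closure G S \<lhd> G" "S \<subseteq> normal_closure G S"
proof -
  have ne: "{N. N \<lhd> G \<and> S \<subseteq> N} \<noteq> {}" using normal_self assms by blast
  show "normal_closure G S \<lhd> G"
    unfolding normal_closure_def
  proof (rule normal_inv_iff[THEN iffD2], intro conjI ballI)
    show "subgroup (\<Inter>{N. N \<lhd> G \<and> S \<subseteq> N}) G"
      by (rule subgroups_Inter) (use ne normal_imp_subgroup in auto)
  next
    fix x h assume x: "x \<in> carrier G" and h: "h \<in> \<Inter>{N. N \<lhd> G \<and> S \<subseteq> N}"
    show "x \<otimes> h \<otimes> inv x \<in> \<Inter>{N. N \<lhd> G \<and> S \<subseteq> N}"
      using x h normal_invE(2) by blast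
  qed
qed (auto simp: normal_closure_def)

section \<open>Quotients of free products by relators\<close>

locale presentation = group_family +
  fixes S
  assumes relators: "S \<subseteq> carrier (free_product I Gs)"
begin

definition presented where "presented = F Mod normal_closure F S"
definition gen where "gen i g = normal_closure F S #>\<^bsub>F\<^esub> \<iota> i g"

lemma closure_normal: "normal_closure F S \<lhd> F"
  using group.normal_closure_normal(1)[OF group_free_product relators] .

lemma group_presented: "group presented"
  unfolding presented_def by (rule normal.factorgroup_is_group[OF closure_normal])

lemma quotient_hom: "(\<lambda>x. normal_closure F S #>\<^bsub>F\<^esub> x) \<in> hom F presented"
  unfolding presented_def by (rule normal.r_coset_hom_Mod[OF closure_normal])

lemma gen_hom: "i \<in> I \<Longrightarrow> gen i \<in> hom (Gs i) presented"
  using Group.hom_compose[OF incl_hom quotient_hom] by (simp add: gen_def[abs_def] comp_def)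

lemma quotient_relator:
  assumes "s \<in> S"
  shows "normal_closure F S #>\<^bsub>F\<^esub> s = \<one>\<^bsub>presented\<^esub>"
proof -
  have "s \<in> normal_closure F S"
    using group.normal_closure_normal(2)[OF group_free_product relators] assms by blast
  then show ?thesis
    unfolding presented_def one_FactGroup
    by (rule subgroup.rcos_const[OF normal_imp_subgroup[OF closure_normal] group_free_product])
qed

lemma presented_induct [consumes 1, case_names one mult]:
  assumes "x \<in> carrier presented" and one: "P \<one>\<^bsub>presented\<^esub>"
    and mult: "\<And>i g x. \<lbrakk>i \<in> I; g \<in> carrier (Gs i); x \<in> carrier presented; P x\<rbrakk> \<Longrightarrow> P (gen i g \<otimes>\<^bsub>presented\<^esub> x)"
  shows "P x"
proof -
  have "P (normal_closure F S #>\<^bsub>F\<^esub> y)" if "y \<in> carrier F" for y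
    using that
  proof (induction rule: free_product_induct)
    case one
    then show ?case
      using hom_one[OF quotient_hom group_free_product group_presented] \<open>P \<one>\<^bsub>presented\<^esub>\<close> by simp
  next
    case (mult i g y)
    have "normal_closure F S #>\<^bsub>F\<^esub> (\<iota> i g \<otimes>\<^bsub>F\<^esub> y) = gen i g \<otimes>\<^bsub>presented\<^esub> (normal_closure F S #>\<^bsub>F\<^esub> y)"
      unfolding gen_def using hom_mult[OF quotient_hom hom_in_carrier[OF incl_hom]] mult by blast
    then show ?case
      using assms(3)[OF mult(1,2) hom_in_carrier[OF quotient_hom mult(3)] mult(4)] by simp
  qed
  then show ?thesis using assms(1) by (auto simp: presented_def carrier_FactGroup)
qed

text \<open>Relators live in the free product, so they can only be evaluated by a homomorphism
  \<open>h\<close> defined there. Such an \<open>h\<close> is known merely to exist, which is why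
  the condition speaks of every \<open>h\<close> with the prescribed values on the factors.\<close>

lemma presented_hom:
  assumes K: "group K" and f: "\<And>i. i \<in> I \<Longrightarrow> f i \<in> hom (Gs i) K"
    and S: "\<And>h s. \<lbrakk>h \<in> hom F K; \<And>i g. \<lbrakk>i \<in> I; g \<in> carrier (Gs i)\<rbrakk> \<Longrightarrow> h (\<iota> i g) = f i g; s \<in> S\<rbrakk>
      \<Longrightarrow> h s = \<one>\<^bsub>K\<^esub>"
  shows "\<exists>h\<in>hom presented K. \<forall>i\<in>I. \<forall>g\<in>carrier (Gs i). h (gen i g) = f i g"
proof -
  obtain h where h: "h \<in> hom F K" "\<And>i g. \<lbrakk>i \<in> I; g \<in> carrier (Gs i)\<rbrakk> \<Longrightarrow> h (\<iota> i g) = f i g"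
    using free_product_hom[OF K f] by blast
  interpret h: group_hom F K h
    by (intro group_hom.intro group_free_product K group_hom_axioms.intro h(1))
  have "S \<subseteq> kernel F K h" using S[OF h] relators by (auto simp: kernel_def)
  then have "normal_closure F S \<subseteq> kernel F K h"
    unfolding normal_closure_def using h.normal_kernel by blast
  then obtain g where g: "g \<in> hom presented K" "\<And>x. x \<in> carrier F \<Longrightarrow> g (normal_closure F S #>\<^bsub>F\<^esub> x) = h x"
    using h.FactGroup_universal_kernel[OF closure_normal] unfolding presented_def by metis
  show ?thesis
  proof (intro bexI[OF _ g(1)] ballI)
    fix i x assume "i \<in> I" "x \<in> carrier (Gs i)"
    then show "g (gen i x) = f i x"
      using g(2)[OF hom_in_carrier[OF incl_hom]] h(2) by (simp add: gen_def)
  qed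
qed

lemma presented_hom_eq:
  assumes "group K" "h \<in> hom presented K" "h' \<in> hom presented K"
    and "\<And>i g. \<lbrakk>i \<in> I; g \<in> carrier (Gs i)\<rbrakk> \<Longrightarrow> h (gen i g) = h' (gen i g)" and "x \<in> carrier presented"
  shows "h x = h' x"
  using assms(5)
proof (induction rule: presented_induct)
  case one
  then show ?case by (simp add: hom_one[OF assms(2) group_presented assms(1)] hom_one[OF assms(3) group_presented assms(1)])
next
  case (mult i g x)
  have "gen i g \<in> carrier presented" using hom_in_carrier[OF gen_hom] mult by blast
  then show ?case using hom_mult[OF assms(2)] hom_mult[OF assms(3)] mult assms(4) by simp
qed

end

section \<open>Copies of a group glued along subgroups\<close>

text \<open>The edge set is a parameter so that paths and cycles are instances of one construction;
  the edges of a cycle give the relators of \<open>Hig_bar\<close>.\<close>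

definition gluing_relators ::
  "'i set \<Rightarrow> ('i \<times> 'i) set \<Rightarrow> ('a, 'm) monoid_scheme \<Rightarrow> 'a set \<Rightarrow> ('a \<Rightarrow> 'a) \<Rightarrow> ('i \<times> 'a) list set set"
  where
  "gluing_relators I E G B \<phi> =
    (let F = free_product I (\<lambda>_. G); \<iota> = free_product_incl I (\<lambda>_. G)
     in {inv\<^bsub>F\<^esub> (\<iota> i b) \<otimes>\<^bsub>F\<^esub> \<iota> j (\<phi> b) | i j b. (i, j) \<in> E \<and> b \<in> B})"

locale gluing =
  fixes G :: "('a, 'm) monoid_scheme" and B :: "'a set" and \<phi> :: "'a \<Rightarrow> 'a"
    and I :: "'i set" and E :: "('i \<times> 'i) set"
  assumes group_G: "group G" and B_carrier: "b \<in> B \<Longrightarrow> b \<in> carrier G"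
    and \<phi>_carrier: "b \<in> B \<Longrightarrow> \<phi> b \<in> carrier G" and edges: "E \<subseteq> I \<times> I"

sublocale gluing \<subseteq> presentation I "\<lambda>_. G" "gluing_relators I E G B \<phi>"
proof -
  interpret group_family I "\<lambda>_. G" by (rule group_family.intro) (rule group_G)
  interpret F: group F by (rule group_free_product)
  show "presentation I (\<lambda>_. G) (gluing_relators I E G B \<phi>)"
  proof unfold_locales
    show "gluing_relators I E G B \<phi> \<subseteq> carrier F"
      using edges hom_in_carrier[OF incl_hom] B_carrier \<phi>_carrier
      by (auto simp: gluing_relators_def Let_def)
  qed
qed

context gluing
begin

lemma gen_closed: "\<lbrakk>i \<in> I; g \<in> carrier G\<rbrakk> \<Longrightarrow> gen i g \<in> carrier presented"
  using hom_in_carrier[OF gen_hom] .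

lemma gen_glue:
  assumes "(i, j) \<in> E" "b \<in> B"
  shows "gen i b = gen j (\<phi> b)"
proof -
  interpret F: group F by (rule group_free_product)
  interpret X: group presented by (rule group_presented)
  interpret q: group_hom F presented "\<lambda>x. normal_closure F (gluing_relators I E G B \<phi>) #>\<^bsub>F\<^esub> x"
    by unfold_locales (rule quotient_hom)
  have ij: "i \<in> I" "j \<in> I" using assms edges by auto
  note b = B_carrier[OF assms(2)] \<phi>_carrier[OF assms(2)]
  have c: "\<iota> i b \<in> carrier F" "\<iota> j (\<phi> b) \<in> carrier F"
    using hom_in_carrier[OF incl_hom] ij b by blast+
  have "inv\<^bsub>F\<^esub> (\<iota> i b) \<otimes>\<^bsub>F\<^esub> \<iota> j (\<phi> b) \<in> gluing_relators I E G B \<phi>"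
    unfolding gluing_relators_def Let_def using assms by blast
  from quotient_relator[OF this] have "inv\<^bsub>presented\<^esub> (gen i b) \<otimes>\<^bsub>presented\<^esub> gen j (\<phi> b) = \<one>\<^bsub>presented\<^esub>"
    unfolding gen_def using c by (simp only: q.hom_mult q.hom_inv F.inv_closed)
  then show ?thesis
    using X.inv_equality[of "inv\<^bsub>presented\<^esub> (gen i b)" "gen j (\<phi> b)"] gen_closed ij b
    by (metis X.inv_closed X.inv_inv X.r_inv X.l_cancel)
qed

lemma glue_hom:
  assumes K: "group K" and f: "\<And>i. i \<in> I \<Longrightarrow> f i \<in> hom G K"
    and E: "\<And>i j b. \<lbrakk>(i, j) \<in> E; b \<in> B\<rbrakk> \<Longrightarrow> f i b = f j (\<phi> b)"
  shows "\<exists>h\<in>hom presented K. \<forall>i\<in>I. \<forall>g\<in>carrier G. h (gen i g) = f i g"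
proof (rule presented_hom[OF K f])
  interpret F: group F by (rule group_free_product)
  interpret K: group K by fact
  fix h s assume h: "h \<in> hom F K" "\<And>i g. \<lbrakk>i \<in> I; g \<in> carrier G\<rbrakk> \<Longrightarrow> h (\<iota> i g) = f i g"
    and "s \<in> gluing_relators I E G B \<phi>"
  then obtain i j b where ijb: "(i, j) \<in> E" "b \<in> B" and s: "s = inv\<^bsub>F\<^esub> (\<iota> i b) \<otimes>\<^bsub>F\<^esub> \<iota> j (\<phi> b)"
    unfolding gluing_relators_def Let_def by blast
  interpret h: group_hom F K h by unfold_locales (rule h(1))
  have ij: "i \<in> I" "j \<in> I" using ijb edges by auto
  note b = B_carrier[OF ijb(2)] \<phi>_carrier[OF ijb(2)]
  have c: "\<iota> i b \<in> carrier F" "\<iota> j (\<phi> b) \<in> carrier F"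
    using hom_in_carrier[OF incl_hom] ij b by blast+
  have "h s = inv\<^bsub>K\<^esub> (f i b) \<otimes>\<^bsub>K\<^esub> f j (\<phi> b)"
    unfolding s using c h(2) ij b by simp
  then show "h s = \<one>\<^bsub>K\<^esub>"
    using E[OF ijb] hom_in_carrier[OF f[OF ij(2)] b(2)] by simp
qed

end

section \<open>Splitting the vertex set of a gluing into two parts\<close>

lemma hom_eq_on_generate:
  assumes G: "group G" and H: "group H" and h: "h \<in> hom G H" "h' \<in> hom G H"
    and S: "S \<subseteq> carrier G" "\<And>x. x \<in> S \<Longrightarrow> h x = h' x" and x: "x \<in> generate G S"
  shows "h x = h' x"
proof -
  interpret G: group G by fact
  interpret h: group_hom G H h by (intro group_hom.intro G H group_hom_axioms.intro h)
  interpret h': group_hom G H h' by (intro group_hom.intro G H group_hom_axioms.intro h)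
  show ?thesis
    using x
  proof (induction rule: generate.induct)
    case (inv s)
    then have "s \<in> carrier G" using S by blast
    then show ?case using S(2)[OF inv] by simp
  next
    case (eng x y)
    then show ?case using G.generate_in_carrier[OF S(1)] by simp
  qed (auto simp: S)
qed

lemma hom_generate_subset:
  assumes G: "group G" and H: "group H" and h: "h \<in> hom G H"
    and S: "S \<subseteq> carrier G" "\<And>x. x \<in> S \<Longrightarrow> h x \<in> K" and K: "subgroup K H" and x: "x \<in> generate G S"
  shows "h x \<in> K"
proof -
  interpret H: group H by fact
  interpret h: group_hom G H h by (intro group_hom.intro G H group_hom_axioms.intro h)
  have "h ` generate G S = generate H (h ` S)" using h.generate_img[OF S(1)] by (rule HOL.sym)
  also have "\<dots> \<subseteq> K" using S(2) by (intro H.generate_subgroup_incl[OF _ K]) blast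
  finally show ?thesis using x by blast
qed

text \<open>The composites \<open>j1 \<circ> s1\<close> and \<open>j2 \<circ> s2\<close> are the
  retractions that \<open>residually_solvable_amalgam\<close> asks for, with \<open>P\<close> and
  \<open>Q\<close> generated by the copies in \<open>I1\<close> and in \<open>I2\<close>. Everything
  is reduced to generators: those of the own side are fixed, and those of the other side become
  trivial or equal to a generator from each side, which certifies that they lie in
  \<open>P \<inter> Q\<close>.\<close>

theorem (in gluing) residually_solvable_split:
  assumes I: "I = I1 \<union> I2" "I1 \<inter> I2 = {}"
    and rs: "residually_solvable X1" "residually_solvable X2"
    and s1: "s1 \<in> hom presented X1" "j1 \<in> hom X1 presented"
      "\<And>i g. \<lbrakk>i \<in> I1; g \<in> carrier G\<rbrakk> \<Longrightarrow> j1 (s1 (gen i g)) = gen i g"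
      "\<And>i g. \<lbrakk>i \<in> I2; g \<in> carrier G\<rbrakk> \<Longrightarrow> j1 (s1 (gen i g)) = \<one>\<^bsub>presented\<^esub> \<or>
        (\<exists>i1\<in>I1. \<exists>i2\<in>I2. \<exists>g1\<in>carrier G. \<exists>g2\<in>carrier G.
           j1 (s1 (gen i g)) = gen i1 g1 \<and> gen i1 g1 = gen i2 g2)"
    and s2: "s2 \<in> hom presented X2" "j2 \<in> hom X2 presented"
      "\<And>i g. \<lbrakk>i \<in> I2; g \<in> carrier G\<rbrakk> \<Longrightarrow> j2 (s2 (gen i g)) = gen i g"
      "\<And>i g. \<lbrakk>i \<in> I1; g \<in> carrier G\<rbrakk> \<Longrightarrow> j2 (s2 (gen i g)) = \<one>\<^bsub>presented\<^esub> \<or>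
        (\<exists>i1\<in>I1. \<exists>i2\<in>I2. \<exists>g1\<in>carrier G. \<exists>g2\<in>carrier G.
           j2 (s2 (gen i g)) = gen i1 g1 \<and> gen i1 g1 = gen i2 g2)"
  shows "residually_solvable presented"
proof -
  interpret X: group presented by (rule group_presented)
  define gens where "gens J = (\<Union>i\<in>J. gen i ` carrier G)" for J
  have gens: "gens J \<subseteq> carrier presented" if "J \<subseteq> I" for J
    using that gen_closed unfolding gens_def by blast
  have gensI: "gen i g \<in> gens J" if "i \<in> J" "g \<in> carrier G" for i g J
    using that unfolding gens_def by blast
  define P where "P = generate presented (gens I1)"
  define Q where "Q = generate presented (gens I2)"
  have g1: "gens I1 \<subseteq> carrier presented" and g2: "gens I2 \<subseteq> carrier presented" using gens I by auto
  have P: "subgroup P presented" and Q: "subgroup Q presented"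
    unfolding P_def Q_def by (intro X.generate_is_subgroup g1 g2)+
  have PQ: "subgroup (P \<inter> Q) presented" using X.subgroups_Inter_pair[OF P Q] .
  have genP: "gen i g \<in> P" if "i \<in> I1" "g \<in> carrier G" for i g
    unfolding P_def by (intro generate.incl gensI that)
  have genQ: "gen i g \<in> Q" if "i \<in> I2" "g \<in> carrier G" for i g
    unfolding Q_def by (intro generate.incl gensI that)
  have groups12: "group X1" "group X2" using rs by (simp_all add: residually_solvable_def)
  have e1: "j1 \<circ> s1 \<in> hom presented presented" and e2: "j2 \<circ> s2 \<in> hom presented presented"
    using Group.hom_compose s1(1,2) s2(1,2) by blast+
  have id_hom: "(\<lambda>x. x) \<in> hom presented presented" by (rule homI) auto
  have e1_P: "(j1 \<circ> s1) p = p" if "p \<in> P" for p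
    using that unfolding P_def
    by (rule hom_eq_on_generate[OF group_presented group_presented e1 id_hom g1, rotated])
      (use s1(3) in \<open>auto simp: gens_def\<close>)
  have e2_Q: "(j2 \<circ> s2) q = q" if "q \<in> Q" for q
    using that unfolding Q_def
    by (rule hom_eq_on_generate[OF group_presented group_presented e2 id_hom g2, rotated])
      (use s2(3) in \<open>auto simp: gens_def\<close>)
  have one_PQ: "\<one>\<^bsub>presented\<^esub> \<in> P \<inter> Q" by (rule subgroup.one_closed[OF PQ])
  have edge_PQ: "gen i1 g1 \<in> P \<inter> Q"
    if "i1 \<in> I1" "i2 \<in> I2" "g1 \<in> carrier G" "g2 \<in> carrier G" "gen i1 g1 = gen i2 g2" for i1 i2 g1 g2
    using genP[OF that(1,3)] genQ[OF that(2,4)] that(5) by simp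
  have e1_gens: "(j1 \<circ> s1) x \<in> P \<inter> Q" if x: "x \<in> gens I2" for x
  proof -
    obtain i g where "i \<in> I2" "g \<in> carrier G" "x = gen i g" using x unfolding gens_def by blast
    then show ?thesis using s1(4)[of i g] one_PQ edge_PQ unfolding comp_apply by metis
  qed
  have e2_gens: "(j2 \<circ> s2) x \<in> P \<inter> Q" if x: "x \<in> gens I1" for x
  proof -
    obtain i g where "i \<in> I1" "g \<in> carrier G" "x = gen i g" using x unfolding gens_def by blast
    then show ?thesis using s2(4)[of i g] one_PQ edge_PQ unfolding comp_apply by metis
  qed
  show ?thesis
  proof (rule X.residually_solvable_amalgam[OF P Q _ e1 e1_P _ e2 e2_Q])
    show "(j1 \<circ> s1) q \<in> P \<inter> Q" if "q \<in> Q" for q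
      by (rule hom_generate_subset[OF group_presented group_presented e1 g2 e1_gens PQ that[unfolded Q_def]])
    show "(j2 \<circ> s2) p \<in> P \<inter> Q" if "p \<in> P" for p
      by (rule hom_generate_subset[OF group_presented group_presented e2 g1 e2_gens PQ that[unfolded P_def]])
    have sub: "P \<union> Q \<subseteq> carrier presented" using subgroup.subset[OF P] subgroup.subset[OF Q] by blast
    show "carrier presented = generate presented (P \<union> Q)"
    proof
      show "generate presented (P \<union> Q) \<subseteq> carrier presented" using X.generate_incl[OF sub] .
      show "carrier presented \<subseteq> generate presented (P \<union> Q)"
      proof
        fix x assume "x \<in> carrier presented"
        then show "x \<in> generate presented (P \<union> Q)"
        proof (induction rule: presented_induct)
          case one
          show ?case by (rule generate.one)
        next
          case (mult i g x)
          then have "gen i g \<in> P \<union> Q" using genP genQ I by blast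
          then show ?case by (rule generate.eng[OF generate.incl mult(4)])
        qed
      qed
    qed
  next
    fix x assume x: "x \<in> P \<union> Q" "x \<noteq> \<one>\<^bsub>presented\<^esub>"
    have xc: "x \<in> carrier presented" using x(1) subgroup.subset[OF P] subgroup.subset[OF Q] by blast
    from x(1) show "\<exists>n. x \<notin> derived_series presented n"
    proof
      assume "x \<in> P"
      \<comment> \<open>Since \<open>j1\<close> undoes \<open>s1\<close> on \<open>P\<close>, a
        nontrivial element of \<open>P\<close> stays nontrivial in \<open>X1\<close>, where it can
        be separated.\<close>
      then have "j1 (s1 x) = x" using e1_P by simp
      then have "s1 x \<noteq> \<one>\<^bsub>X1\<^esub>" using hom_one[OF s1(2) groups12(1) group_presented] x(2) by auto
      then show ?thesis by (rule residually_solvable_separated[OF group_presented rs(1) s1(1) xc])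
    next
      assume "x \<in> Q"
      then have "j2 (s2 x) = x" using e2_Q by simp
      then have "s2 x \<noteq> \<one>\<^bsub>X2\<^esub>" using hom_one[OF s2(2) groups12(2) group_presented] x(2) by auto
      then show ?thesis by (rule residually_solvable_separated[OF group_presented rs(2) s2(1) xc])
    qed
  next
    fix T :: "(('i \<times> 'a) list set set set \<times> nat set \<Rightarrow> ('i \<times> 'a) list set set set \<times> nat set) monoid"
      and c c'
    assume T: "group T" and c: "c \<in> hom presented T" "c' \<in> hom presented T"
      and agree: "\<And>f. f \<in> P \<inter> Q \<Longrightarrow> c f = c' f"
    define f where "f i = (if i \<in> I1 then c \<circ> gen i else c' \<circ> gen i)" for i
    have f_hom: "f i \<in> hom G T" if "i \<in> I" for i
      using Group.hom_compose[OF gen_hom[OF that] c(1)] Group.hom_compose[OF gen_hom[OF that] c(2)]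
      by (simp add: f_def)
    have f_edge: "f i b = f j (\<phi> b)" if ij: "(i, j) \<in> E" and b: "b \<in> B" for i j b
    proof -
      have eq: "gen i b = gen j (\<phi> b)" by (rule gen_glue[OF ij b])
      have "i \<in> I1 \<or> i \<in> I2" "j \<in> I1 \<or> j \<in> I2" using edges I ij by auto
      then have "(i \<in> I1 \<longleftrightarrow> j \<in> I1) \<or> gen i b \<in> P \<inter> Q"
        using genP genQ eq B_carrier[OF b] \<phi>_carrier[OF b] by (metis IntI)
      then show ?thesis
        using eq agree[of "gen i b"] unfolding f_def by auto
    qed
    obtain \<Theta> where \<Theta>: "\<Theta> \<in> hom presented T" "\<And>i g. \<lbrakk>i \<in> I; g \<in> carrier G\<rbrakk> \<Longrightarrow> \<Theta> (gen i g) = f i g"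
      using glue_hom[where f = f, OF T f_hom f_edge] by blast
    have "\<Theta> p = c p" if "p \<in> P" for p
      using that unfolding P_def
      by (rule hom_eq_on_generate[OF group_presented T \<Theta>(1) c(1) g1, rotated])
        (use \<Theta>(2) I in \<open>auto simp: gens_def f_def\<close>)
    moreover have "\<Theta> q = c' q" if "q \<in> Q" for q
      using that unfolding Q_def
      by (rule hom_eq_on_generate[OF group_presented T \<Theta>(1) c(2) g2, rotated])
        (use \<Theta>(2) I in \<open>auto simp: gens_def f_def\<close>)
    ultimately show "\<exists>\<Theta>\<in>hom presented T. (\<forall>p\<in>P. \<Theta> p = c p) \<and> (\<forall>q\<in>Q. \<Theta> q = c' q)"
      using \<Theta>(1) by blast
  qed
qed

section \<open>Paths and cycles of copies\<close>

definition path_edges :: "nat \<Rightarrow> (nat \<times> nat) set" where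
  "path_edges n = {(i, Suc i) | i. Suc i < n}"

lemma path_edges_iff [simp]: "(i, j) \<in> path_edges n \<longleftrightarrow> j = Suc i \<and> j < n"
  by (auto simp: path_edges_def)

definition cycle_edges :: "nat \<Rightarrow> (nat \<times> nat) set" where
  "cycle_edges k = {(i, (i + 1) mod k) | i. i \<in> {0..<k}}"

lemma cycle_edges_iff [simp]:
  "(i, j) \<in> cycle_edges k \<longleftrightarrow> j = Suc i \<and> j < k \<or> Suc i = k \<and> j = 0"
proof -
  consider "Suc i < k" | "k = Suc i" | "k \<le> i" by linarith
  then show ?thesis by cases (auto simp: cycle_edges_def)
qed

text \<open>In the application \<open>\<alpha>\<close> is the projection to \<open>A\<close> followed by the inverse of \<open>\<phi>\<close>, and
  \<open>\<rho>\<close> is the projection to \<open>B\<close>.\<close>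

locale retracting =
  fixes G :: "('a, 'm) monoid_scheme" and B :: "'a set" and \<phi> \<alpha> \<rho> :: "'a \<Rightarrow> 'a"
  assumes rs_G: "residually_solvable G" and B_sub: "b \<in> B \<Longrightarrow> b \<in> carrier G"
    and \<phi>_closed: "b \<in> B \<Longrightarrow> \<phi> b \<in> carrier G"
    and \<alpha>_hom: "\<alpha> \<in> hom G G" and \<rho>_hom: "\<rho> \<in> hom G G" and \<phi>\<rho>_hom: "\<phi> \<circ> \<rho> \<in> hom G G"
    and \<alpha>_B: "g \<in> carrier G \<Longrightarrow> \<alpha> g \<in> B" and \<rho>_B: "g \<in> carrier G \<Longrightarrow> \<rho> g \<in> B"
    and \<alpha>_on_B: "b \<in> B \<Longrightarrow> \<alpha> b = \<one>\<^bsub>G\<^esub>" and \<alpha>_\<phi>: "b \<in> B \<Longrightarrow> \<alpha> (\<phi> b) = b"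
    and \<rho>_on_B: "b \<in> B \<Longrightarrow> \<rho> b = b" and \<rho>_\<phi>: "b \<in> B \<Longrightarrow> \<rho> (\<phi> b) = \<one>\<^bsub>G\<^esub>"
begin

lemma grp: "group G"
  using rs_G by (simp add: residually_solvable_def)

lemma \<phi>_one: "\<phi> \<one>\<^bsub>G\<^esub> = \<one>\<^bsub>G\<^esub>"
  using hom_one[OF \<phi>\<rho>_hom grp grp] hom_one[OF \<rho>_hom grp grp] by simp

lemma one_hom: "group H \<Longrightarrow> (\<lambda>_. \<one>\<^bsub>H\<^esub>) \<in> hom G H"
  using group.is_monoid monoid.one_closed monoid.l_one by (intro homI) fastforce+

lemma gluingI: "E \<subseteq> I \<times> I \<Longrightarrow> gluing G B \<phi> I E"
  by (rule gluing.intro) (use grp B_sub \<phi>_closed in auto)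

section \<open>Paths of copies\<close>

abbreviation path :: "nat \<Rightarrow> (nat \<times> 'a) list set set monoid" where
  "path n \<equiv> presentation.presented {..<n} (\<lambda>_. G) (gluing_relators {..<n} (path_edges n) G B \<phi>)"

lemma gluing_path: "gluing G B \<phi> {..<n} (path_edges n)"
  by (rule gluingI) auto

text \<open>The last copy is split off along its only edge. To retract onto the shorter path, the
  last copy is sent by \<open>\<alpha>\<close> into \<open>B\<close> in its neighbour. To retract
  onto the last copy, the neighbour is sent there by \<open>\<phi> \<circ> \<rho>\<close> and all
  earlier copies to the identity, which respects the edge before the neighbour since
  \<open>\<rho>\<close> kills every \<open>\<phi> b\<close>.\<close>

lemma residually_solvable_path: "residually_solvable (path (Suc n))"
proof (induction n)
  case 0
  interpret P: gluing G B \<phi> "{..<Suc 0}" "path_edges (Suc 0)" by (rule gluing_path)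
  have id_hom: "(\<lambda>x. x) \<in> hom G G" by (rule homI) auto
  obtain h where h: "h \<in> hom P.presented G" "\<And>i g. \<lbrakk>i < Suc 0; g \<in> carrier G\<rbrakk> \<Longrightarrow> h (P.gen i g) = g"
    using P.glue_hom[of G "\<lambda>i x. x", OF grp id_hom] by auto
  have 0: "0 \<in> {..<Suc 0}" by simp
  have inv: "P.gen 0 (h x) = x" if "x \<in> carrier P.presented" for x
  proof -
    have "(P.gen 0 \<circ> h) x = (\<lambda>x. x) x"
    proof (rule P.presented_hom_eq[OF P.group_presented _ _ _ that])
      show "P.gen 0 \<circ> h \<in> hom P.presented P.presented"
        by (rule Group.hom_compose[OF h(1) P.gen_hom[OF 0]])
      show "(\<lambda>x. x) \<in> hom P.presented P.presented" by (rule homI) auto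
    qed (use h(2) in auto)
    then show ?thesis by simp
  qed
  show ?case
  proof (rule residually_solvable_inj_hom[OF P.group_presented rs_G h(1)])
    fix x assume "x \<in> carrier P.presented" "h x = \<one>\<^bsub>G\<^esub>"
    then show "x = \<one>\<^bsub>P.presented\<^esub>"
      using inv[of x] hom_one[OF P.gen_hom[OF 0] grp P.group_presented] by simp
  qed
next
  case (Suc n)
  interpret P: gluing G B \<phi> "{..<Suc n}" "path_edges (Suc n)" by (rule gluing_path)
  interpret Q: gluing G B \<phi> "{..<Suc (Suc n)}" "path_edges (Suc (Suc n))" by (rule gluing_path)
  define f where "f i = (if i \<le> n then P.gen i else P.gen n \<circ> \<alpha>)" for i
  have "\<exists>h\<in>hom Q.presented P.presented. \<forall>i\<in>{..<Suc (Suc n)}. \<forall>g\<in>carrier G. h (Q.gen i g) = f i g"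
  proof (rule Q.glue_hom[OF P.group_presented])
    show "f i \<in> hom G P.presented" if "i \<in> {..<Suc (Suc n)}" for i
      unfolding f_def using P.gen_hom Group.hom_compose[OF \<alpha>_hom P.gen_hom] by auto
    fix i j b assume ij: "(i, j) \<in> path_edges (Suc (Suc n))" and b: "b \<in> B"
    then have "j = Suc i" "i \<le> n" by auto
    then show "f i b = f j (\<phi> b)"
      using P.gen_glue[of i "Suc i" b] b by (cases "i = n") (auto simp: f_def \<alpha>_\<phi>)
  qed
  then obtain s1 where s1: "s1 \<in> hom Q.presented P.presented"
    "\<And>i g. \<lbrakk>i \<le> Suc n; g \<in> carrier G\<rbrakk> \<Longrightarrow> s1 (Q.gen i g) = f i g" by (auto simp: less_Suc_eq_le)
  have "\<exists>h\<in>hom P.presented Q.presented. \<forall>i\<in>{..<Suc n}. \<forall>g\<in>carrier G. h (P.gen i g) = Q.gen i g"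
    by (rule P.glue_hom[OF Q.group_presented Q.gen_hom Q.gen_glue]) auto
  then obtain j1 where j1: "j1 \<in> hom P.presented Q.presented"
    "\<And>i g. \<lbrakk>i \<le> n; g \<in> carrier G\<rbrakk> \<Longrightarrow> j1 (P.gen i g) = Q.gen i g" by (auto simp: less_Suc_eq_le)
  define f' where "f' i = (if i = Suc n then (\<lambda>x. x) else if i = n then \<phi> \<circ> \<rho> else (\<lambda>_. \<one>\<^bsub>G\<^esub>))" for i
  have "\<exists>h\<in>hom Q.presented G. \<forall>i\<in>{..<Suc (Suc n)}. \<forall>g\<in>carrier G. h (Q.gen i g) = f' i g"
  proof (rule Q.glue_hom[OF grp])
    have "(\<lambda>x. x) \<in> hom G G" by (rule homI) auto
    then show "f' i \<in> hom G G" for i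
      unfolding f'_def using \<phi>\<rho>_hom one_hom[OF grp] by auto
    fix i j b assume ij: "(i, j) \<in> path_edges (Suc (Suc n))" and b: "b \<in> B"
    then have "j = Suc i" "i \<le> n" by auto
    then show "f' i b = f' j (\<phi> b)"
      using b by (auto simp: f'_def \<rho>_on_B \<rho>_\<phi> \<phi>_one)
  qed
  then obtain s2 where s2: "s2 \<in> hom Q.presented G"
    "\<And>i g. \<lbrakk>i \<le> Suc n; g \<in> carrier G\<rbrakk> \<Longrightarrow> s2 (Q.gen i g) = f' i g" by (auto simp: less_Suc_eq_le)
  have edge: "(n, Suc n) \<in> path_edges (Suc (Suc n))" by simp
  have one: "Q.gen (Suc n) \<one>\<^bsub>G\<^esub> = \<one>\<^bsub>Q.presented\<^esub>"
    by (rule hom_one[OF Q.gen_hom grp Q.group_presented]) simp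
  show ?case
  proof (rule Q.residually_solvable_split[of "{..n}" "{Suc n}", OF _ _ Suc.IH rs_G s1(1) j1(1) _ _ s2(1)])
    show "Q.gen (Suc n) \<in> hom G Q.presented" by (rule Q.gen_hom) simp
    fix i g assume i: "i \<in> {Suc n}" and g: "g \<in> carrier G"
    have "j1 (s1 (Q.gen i g)) = Q.gen n (\<alpha> g)"
      using i g s1(2) j1(2) B_sub[OF \<alpha>_B] by (simp add: f_def)
    moreover have "Q.gen n (\<alpha> g) = Q.gen (Suc n) (\<phi> (\<alpha> g))" by (rule Q.gen_glue[OF edge \<alpha>_B[OF g]])
    ultimately show "j1 (s1 (Q.gen i g)) = \<one>\<^bsub>Q.presented\<^esub> \<or> (\<exists>i1\<in>{..n}. \<exists>i2\<in>{Suc n}. \<exists>g1\<in>carrier G.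
        \<exists>g2\<in>carrier G. j1 (s1 (Q.gen i g)) = Q.gen i1 g1 \<and> Q.gen i1 g1 = Q.gen i2 g2)"
      using i B_sub[OF \<alpha>_B[OF g]] \<phi>_closed[OF \<alpha>_B[OF g]] by blast
  next
    fix i g assume i: "i \<in> {..n}" and g: "g \<in> carrier G"
    show "Q.gen (Suc n) (s2 (Q.gen i g)) = \<one>\<^bsub>Q.presented\<^esub> \<or> (\<exists>i1\<in>{..n}. \<exists>i2\<in>{Suc n}. \<exists>g1\<in>carrier G.
        \<exists>g2\<in>carrier G. Q.gen (Suc n) (s2 (Q.gen i g)) = Q.gen i1 g1 \<and> Q.gen i1 g1 = Q.gen i2 g2)"
    proof (cases "i = n")
      case True
      then have "Q.gen (Suc n) (s2 (Q.gen i g)) = Q.gen (Suc n) (\<phi> (\<rho> g))"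
        using g s2(2) by (simp add: f'_def)
      moreover have "Q.gen n (\<rho> g) = Q.gen (Suc n) (\<phi> (\<rho> g))" by (rule Q.gen_glue[OF edge \<rho>_B[OF g]])
      ultimately show ?thesis
        using i True B_sub[OF \<rho>_B[OF g]] \<phi>_closed[OF \<rho>_B[OF g]] by (metis singletonI)
    qed (use i g s2(2) one in \<open>simp add: f'_def\<close>)
  next
    fix i g assume "i \<in> {..n}" "g \<in> carrier G"
    then show "j1 (s1 (Q.gen i g)) = Q.gen i g" by (simp add: s1 j1 f_def)
  next
    fix i g assume "i \<in> {Suc n}" "g \<in> carrier G"
    then show "Q.gen (Suc n) (s2 (Q.gen i g)) = Q.gen i g" by (simp add: s2 f'_def)
  qed auto
qed

section \<open>Cycles of copies\<close>

lemma gluing_cycle: "gluing G B \<phi> {0..<k} (cycle_edges k)"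
  by (rule gluingI) auto

abbreviation cycle :: "nat \<Rightarrow> (nat \<times> 'a) list set set monoid" where
  "cycle k \<equiv> presentation.presented {0..<k} (\<lambda>_. G) (gluing_relators {0..<k} (cycle_edges k) G B \<phi>)"

text \<open>To retract the cycle onto one arc, the other arc is collapsed: the end entered by a cut
  edge is mapped by \<open>\<alpha>\<close>, the end left by a cut edge by
  \<open>\<phi> \<circ> \<rho>\<close>, and inner vertices go to the identity. The cut edges are
  respected by \<open>\<alpha> (\<phi> b) = b\<close> and \<open>\<rho> b = b\<close>. On the
  remaining edges of the collapsed arc both sides are trivial, by \<open>\<alpha> b = \<one>\<close>
  and \<open>\<rho> (\<phi> b) = \<one>\<close>.\<close>

lemma residually_solvable_cycle:
  assumes k: "4 \<le> k"
  shows "residually_solvable (cycle k)"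
proof -
  \<comment> \<open>The second arc has \<open>k - 2 = Suc m\<close> vertices, the form in which
    \<open>residually_solvable_path\<close> applies, and \<open>4 \<le> k\<close> becomes
    \<open>1 \<le> m\<close>.\<close>
  define m where "m = k - 3"
  have km: "k = Suc (Suc (Suc m))" "1 \<le> m" using k by (auto simp: m_def)
  interpret C: gluing G B \<phi> "{0..<k}" "cycle_edges k" by (rule gluing_cycle)
  interpret P: gluing G B \<phi> "{..<Suc (Suc 0)}" "path_edges (Suc (Suc 0))" by (rule gluing_path)
  interpret Q: gluing G B \<phi> "{..<Suc m}" "path_edges (Suc m)" by (rule gluing_path)
  interpret PG: group P.presented by (rule P.group_presented)
  interpret QG: group Q.presented by (rule Q.group_presented)
  have kb: "0 < k" "1 < k" using km by simp_all
  have edge: "(i, Suc i) \<in> cycle_edges k" if "Suc i < k" for i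
    using that by simp
  have last_edge: "(Suc (Suc m), 0) \<in> cycle_edges k"
    using km by simp
  have Pgen: "P.gen i \<in> hom G P.presented" if "i \<le> 1" for i using P.gen_hom[of i] that by simp
  have Qgen: "Q.gen i \<in> hom G Q.presented" if "i \<le> m" for i using Q.gen_hom[of i] that by simp
  have Cgen: "C.gen i \<in> hom G C.presented" if "i < k" for i using C.gen_hom[of i] that by simp
  have Pone: "P.gen i \<one>\<^bsub>G\<^esub> = \<one>\<^bsub>P.presented\<^esub>" if "i \<le> 1" for i
    using hom_one[OF Pgen grp P.group_presented] that by blast
  have Qone: "Q.gen i \<one>\<^bsub>G\<^esub> = \<one>\<^bsub>Q.presented\<^esub>" if "i \<le> m" for i
    using hom_one[OF Qgen grp Q.group_presented] that by blast
  define f where "f i = (if i \<le> 1 then P.gen i else if i = 2 then P.gen 1 \<circ> \<alpha>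
    else if i = Suc (Suc m) then P.gen 0 \<circ> (\<phi> \<circ> \<rho>) else (\<lambda>_. \<one>\<^bsub>P.presented\<^esub>))" for i
  have "\<exists>h\<in>hom C.presented P.presented. \<forall>i\<in>{0..<k}. \<forall>g\<in>carrier G. h (C.gen i g) = f i g"
  proof (rule C.glue_hom[OF P.group_presented])
    show "f i \<in> hom G P.presented" for i
      unfolding f_def
      using Pgen Group.hom_compose[OF \<alpha>_hom Pgen] Group.hom_compose[OF \<phi>\<rho>_hom Pgen]
        one_hom[OF P.group_presented] by simp
    fix i j b assume ij: "(i, j) \<in> cycle_edges k" and b: "b \<in> B"
    have 01: "P.gen 0 b = P.gen 1 (\<phi> b)" using P.gen_glue[of 0 1 b] b by simp
    have in_trivial: "f j (\<phi> b) = \<one>\<^bsub>P.presented\<^esub>" if "3 \<le> j" for j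
      using that b by (auto simp: f_def \<rho>_\<phi> \<phi>_one Pone)
    have out_trivial: "f i b = \<one>\<^bsub>P.presented\<^esub>" if "2 \<le> i" "i < Suc (Suc m)" for i
      using that b by (auto simp: f_def \<alpha>_on_B Pone)
    show "f i b = f j (\<phi> b)"
      using ij
    proof (simp only: cycle_edges_iff, elim disjE conjE)
      assume ij: "j = Suc i" "j < k"
      consider "i = 0" | "i = 1" | "2 \<le> i" by linarith
      then show ?thesis
      proof cases
        case 1
        then show ?thesis using 01 ij(1) by (simp add: f_def)
      next
        case 2
        then show ?thesis using b ij(1) by (simp add: f_def \<alpha>_\<phi>)
      next
        case 3
        then show ?thesis using in_trivial[of j] out_trivial[of i] ij km by simp
      qed
    next
      assume "Suc i = k" "j = 0"
      \<comment> \<open>Here \<open>4 \<le> k\<close> matters: the vertex before 0 is not the vertex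
        2, whose map \<open>\<alpha>\<close> would kill \<open>b\<close> instead of keeping
        it.\<close>
      moreover from this have "i = Suc (Suc m)" "i \<noteq> 2" using km by auto
      ultimately show ?thesis using b by (simp add: f_def \<rho>_on_B)
    qed
  qed
  then obtain s1 where s1: "s1 \<in> hom C.presented P.presented"
    "\<And>i g. \<lbrakk>i < k; g \<in> carrier G\<rbrakk> \<Longrightarrow> s1 (C.gen i g) = f i g" by auto
  have "\<exists>h\<in>hom P.presented C.presented. \<forall>i\<in>{..<Suc (Suc 0)}. \<forall>g\<in>carrier G. h (P.gen i g) = C.gen i g"
  proof (rule P.glue_hom[OF C.group_presented])
    show "C.gen i \<in> hom G C.presented" if "i \<in> {..<Suc (Suc 0)}" for i using that km by (intro Cgen) simp
    show "C.gen i b = C.gen j (\<phi> b)" if "(i, j) \<in> path_edges (Suc (Suc 0))" "b \<in> B" for i j b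
      using that C.gen_glue[OF edge, of i b] km by auto
  qed
  then obtain j1 where j1: "j1 \<in> hom P.presented C.presented"
    "\<And>i g. \<lbrakk>i \<le> 1; g \<in> carrier G\<rbrakk> \<Longrightarrow> j1 (P.gen i g) = C.gen i g" by (auto simp: less_Suc_eq_le)
  define f' where "f' i = (if i = 0 then Q.gen m \<circ> \<alpha> else if i = 1 then Q.gen 0 \<circ> (\<phi> \<circ> \<rho>)
    else Q.gen (i - 2))" for i
  have "\<exists>h\<in>hom C.presented Q.presented. \<forall>i\<in>{0..<k}. \<forall>g\<in>carrier G. h (C.gen i g) = f' i g"
  proof (rule C.glue_hom[OF Q.group_presented])
    show "f' i \<in> hom G Q.presented" if "i \<in> {0..<k}" for i
      unfolding f'_def
      using that km Qgen[of "i - 2"] Group.hom_compose[OF \<alpha>_hom Qgen[of m]]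
        Group.hom_compose[OF \<phi>\<rho>_hom Qgen[of 0]] by auto
    fix i j b assume ij: "(i, j) \<in> cycle_edges k" and b: "b \<in> B"
    show "f' i b = f' j (\<phi> b)"
      using ij
    proof (simp only: cycle_edges_iff, elim disjE conjE)
      assume ij: "j = Suc i" "j < k"
      consider "i = 0" | "i = 1" | "2 \<le> i" by linarith
      then show ?thesis
      proof cases
        case 1
        then show ?thesis using b ij(1) by (simp add: f'_def \<alpha>_on_B \<rho>_\<phi> \<phi>_one Qone)
      next
        case 2
        then show ?thesis using b ij(1) by (simp add: f'_def \<rho>_on_B)
      next
        case 3
        then obtain i' where i': "i = Suc (Suc i')" by (metis Suc_le_D numeral_2_eq_2 Suc_le_mono)
        then have "Q.gen i' b = Q.gen (Suc i') (\<phi> b)" using Q.gen_glue[of i' "Suc i'" b] b ij km by simp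
        then show ?thesis using i' ij(1) by (simp add: f'_def)
      qed
    next
      assume "Suc i = k" "j = 0"
      moreover from this have "i = Suc (Suc m)" using km by auto
      ultimately show ?thesis using b by (simp add: f'_def \<alpha>_\<phi>)
    qed
  qed
  then obtain s2 where s2: "s2 \<in> hom C.presented Q.presented"
    "\<And>i g. \<lbrakk>i < k; g \<in> carrier G\<rbrakk> \<Longrightarrow> s2 (C.gen i g) = f' i g" by auto
  have "\<exists>h\<in>hom Q.presented C.presented. \<forall>i\<in>{..<Suc m}. \<forall>g\<in>carrier G. h (Q.gen i g) = C.gen (i + 2) g"
  proof (rule Q.glue_hom[OF C.group_presented])
    show "C.gen (i + 2) \<in> hom G C.presented" if "i \<in> {..<Suc m}" for i using that km by (intro Cgen) simp
    show "C.gen (i + 2) b = C.gen (j + 2) (\<phi> b)" if "(i, j) \<in> path_edges (Suc m)" "b \<in> B" for i j b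
      using that C.gen_glue[OF edge, of "i + 2" b] km by auto
  qed
  then obtain j2 where j2: "j2 \<in> hom Q.presented C.presented"
    "\<And>i g. \<lbrakk>i \<le> m; g \<in> carrier G\<rbrakk> \<Longrightarrow> j2 (Q.gen i g) = C.gen (i + 2) g" by (auto simp: less_Suc_eq_le)
  have j1_one: "j1 \<one>\<^bsub>P.presented\<^esub> = \<one>\<^bsub>C.presented\<^esub>"
    by (rule hom_one[OF j1(1) P.group_presented C.group_presented])
  have edge12: "C.gen 1 b = C.gen 2 (\<phi> b)" if "b \<in> B" for b
    using C.gen_glue[OF edge that, of 1] km by (simp add: numeral_2_eq_2)
  have edge_last: "C.gen (Suc (Suc m)) b = C.gen 0 (\<phi> b)" if "b \<in> B" for b
    using C.gen_glue[OF last_edge that] .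
  show ?thesis
  proof (rule C.residually_solvable_split[of "{0, 1}" "{2..<k}",
        OF _ _ residually_solvable_path residually_solvable_path s1(1) j1(1) _ _ s2(1) j2(1)])
    show "{0..<k} = {0, 1} \<union> {2..<k}" using km by auto
    show "{0, 1} \<inter> {2..<k} = {}" by auto
  next
    fix i g assume i: "i \<in> {0, 1 :: nat}" and g: "g \<in> carrier G"
    then have "i < k" "i \<le> 1" using km by auto
    then show "j1 (s1 (C.gen i g)) = C.gen i g" using g by (simp add: s1 j1 f_def)
  next
    fix i g assume i: "i \<in> {2..<k}" and g: "g \<in> carrier G"
    then have "i < k" "2 \<le> i" "i - 2 \<le> m" "i - 2 + 2 = i" using km by auto
    then show "j2 (s2 (C.gen i g)) = C.gen i g" using g by (simp add: s2 j2 f'_def)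
  next
    fix i g assume i: "i \<in> {2..<k}" and g: "g \<in> carrier G"
    note closed = B_sub[OF \<alpha>_B[OF g]] \<phi>_closed[OF \<alpha>_B[OF g]] B_sub[OF \<rho>_B[OF g]] \<phi>_closed[OF \<rho>_B[OF g]]
    consider "i = 2" | "i = Suc (Suc m)" "i \<noteq> 2" | "i \<noteq> 2" "i \<noteq> Suc (Suc m)" by blast
    then show "j1 (s1 (C.gen i g)) = \<one>\<^bsub>C.presented\<^esub> \<or> (\<exists>i1\<in>{0, 1}. \<exists>i2\<in>{2..<k}. \<exists>g1\<in>carrier G.
        \<exists>g2\<in>carrier G. j1 (s1 (C.gen i g)) = C.gen i1 g1 \<and> C.gen i1 g1 = C.gen i2 g2)"
    proof cases
      case 1
      then have "j1 (s1 (C.gen i g)) = C.gen 1 (\<alpha> g)" using i g closed by (simp add: s1 j1 f_def)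
      moreover have "C.gen 1 (\<alpha> g) = C.gen 2 (\<phi> (\<alpha> g))" by (rule edge12[OF \<alpha>_B[OF g]])
      moreover have "2 \<in> {2..<k}" using km by simp
      ultimately show ?thesis using closed by blast
    next
      case 2
      then have "j1 (s1 (C.gen i g)) = C.gen 0 (\<phi> (\<rho> g))" using i g closed by (simp add: s1 j1 f_def)
      moreover have "C.gen 0 (\<phi> (\<rho> g)) = C.gen (Suc (Suc m)) (\<rho> g)"
        using edge_last[OF \<rho>_B[OF g]] by simp
      moreover have "Suc (Suc m) \<in> {2..<k}" using km by simp
      ultimately show ?thesis using closed by blast
    next
      case 3
      then show ?thesis using i g by (simp add: s1 f_def j1_one)
    qed
  next
    fix i g assume i: "i \<in> {0, 1 :: nat}" and g: "g \<in> carrier G"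
    note closed = B_sub[OF \<alpha>_B[OF g]] \<phi>_closed[OF \<alpha>_B[OF g]] B_sub[OF \<rho>_B[OF g]] \<phi>_closed[OF \<rho>_B[OF g]]
    from i consider "i = 0" | "i = 1" by blast
    then show "j2 (s2 (C.gen i g)) = \<one>\<^bsub>C.presented\<^esub> \<or> (\<exists>i1\<in>{0, 1}. \<exists>i2\<in>{2..<k}. \<exists>g1\<in>carrier G.
        \<exists>g2\<in>carrier G. j2 (s2 (C.gen i g)) = C.gen i1 g1 \<and> C.gen i1 g1 = C.gen i2 g2)"
    proof cases
      case 1
      then have "j2 (s2 (C.gen i g)) = C.gen 0 (\<phi> (\<alpha> g))"
        using kb g closed edge_last[OF \<alpha>_B[OF g]] by (simp add: s2 j2 f'_def)
      moreover have "C.gen 0 (\<phi> (\<alpha> g)) = C.gen (Suc (Suc m)) (\<alpha> g)"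
        using edge_last[OF \<alpha>_B[OF g]] by simp
      moreover have "Suc (Suc m) \<in> {2..<k}" using km by simp
      ultimately show ?thesis using closed by blast
    next
      case 2
      then have "j2 (s2 (C.gen i g)) = C.gen 1 (\<rho> g)"
        using kb g closed edge12[OF \<rho>_B[OF g]] by (simp add: s2 j2 f'_def numeral_2_eq_2)
      moreover have "C.gen 1 (\<rho> g) = C.gen 2 (\<phi> (\<rho> g))" by (rule edge12[OF \<rho>_B[OF g]])
      moreover have "2 \<in> {2..<k}" using km by simp
      ultimately show ?thesis using closed by blast
    qed
  qed
qed

end

lemma Hig_bar_eq_cycle:
  "Hig_bar k G B \<phi> = presentation.presented {0..<k} (\<lambda>_. G)
     (gluing_relators {0..<k} (cycle_edges k) G B \<phi>)"
  if "presentation {0..<k} (\<lambda>_. G) (gluing_relators {0..<k} (cycle_edges k) G B \<phi>)"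
proof -
  have "gluing_relators {0..<k} (cycle_edges k) G B \<phi> =
    (let F = free_product {0..<k} (\<lambda>_. G); \<iota> = free_product_incl {0..<k} (\<lambda>_. G)
     in {inv\<^bsub>F\<^esub> (\<iota> i b) \<otimes>\<^bsub>F\<^esub> \<iota> ((i + 1) mod k) (\<phi> b) | i b. i \<in> {0..<k} \<and> b \<in> B})"
    unfolding gluing_relators_def cycle_edges_def Let_def by blast
  then show ?thesis
    unfolding presentation.presented_def[OF that] Hig_bar_def Let_def by simp
qed

section \<open>Cyclic extensions\<close>

text \<open>The semidirect product of \<open>H\<close> with a cyclic group of order
  \<open>k\<close>, whose elements are represented by the numbers below \<open>k\<close>. The pair
  \<open>(x, m)\<close> stands for \<open>x t^m\<close>, where \<open>t y t^-1\<close> is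
  \<open>\<alpha> y\<close>.\<close>

definition cyclic_extension :: "('a, 'm) monoid_scheme \<Rightarrow> ('a \<Rightarrow> 'a) \<Rightarrow> nat \<Rightarrow> ('a \<times> nat) monoid" where
  "cyclic_extension H \<alpha> k =
    \<lparr>carrier = carrier H \<times> {..<k},
     monoid.mult = (\<lambda>(x, m) (y, n). (x \<otimes>\<^bsub>H\<^esub> (\<alpha> ^^ m) y, (m + n) mod k)),
     one = (\<one>\<^bsub>H\<^esub>, 0)\<rparr>"

locale cyclic_action = group H for H (structure) +
  fixes \<alpha> and k :: nat
  assumes \<alpha>_hom: "\<alpha> \<in> hom H H" and k_pos: "0 < k"
    and \<alpha>_order: "x \<in> carrier H \<Longrightarrow> (\<alpha> ^^ k) x = x"
begin

abbreviation K where "K \<equiv> cyclic_extension H \<alpha> k"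

lemma carrier_K: "carrier K = carrier H \<times> {..<k}"
  by (simp add: cyclic_extension_def)

lemma mult_K [simp]: "(x, m) \<otimes>\<^bsub>K\<^esub> (y, n) = (x \<otimes> (\<alpha> ^^ m) y, (m + n) mod k)"
  by (simp add: cyclic_extension_def)

lemma one_K [simp]: "\<one>\<^bsub>K\<^esub> = (\<one>, 0)"
  by (simp add: cyclic_extension_def)

lemma funpow_hom: "\<alpha> ^^ m \<in> hom H H"
proof (induction m)
  case 0
  then show ?case by (auto intro: homI)
next
  case (Suc m)
  show ?case unfolding funpow.simps(2) by (rule Group.hom_compose[OF Suc \<alpha>_hom])
qed

lemma funpow_closed [simp]: "x \<in> carrier H \<Longrightarrow> (\<alpha> ^^ m) x \<in> carrier H"
  using hom_in_carrier[OF funpow_hom] .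

lemma funpow_mult: "\<lbrakk>x \<in> carrier H; y \<in> carrier H\<rbrakk> \<Longrightarrow> (\<alpha> ^^ m) (x \<otimes> y) = (\<alpha> ^^ m) x \<otimes> (\<alpha> ^^ m) y"
  using hom_mult[OF funpow_hom] .

lemma funpow_one [simp]: "(\<alpha> ^^ m) \<one> = \<one>"
  by (rule hom_one[OF funpow_hom is_group is_group])

lemma funpow_mod: "x \<in> carrier H \<Longrightarrow> (\<alpha> ^^ (m mod k)) x = (\<alpha> ^^ m) x"
  by (rule funpow_mod_eq[OF \<alpha>_order])

lemma group_K: "group K"
proof (rule groupI)
  fix x y assume "x \<in> carrier K" "y \<in> carrier K"
  then show "x \<otimes>\<^bsub>K\<^esub> y \<in> carrier K" using k_pos by (auto simp: carrier_K)
next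
  show "\<one>\<^bsub>K\<^esub> \<in> carrier K" using k_pos by (simp add: carrier_K)
next
  fix x y z assume "x \<in> carrier K" "y \<in> carrier K" "z \<in> carrier K"
  moreover obtain a m b n c p where "x = (a, m)" "y = (b, n)" "z = (c, p)" by (metis surj_pair)
  ultimately show "x \<otimes>\<^bsub>K\<^esub> y \<otimes>\<^bsub>K\<^esub> z = x \<otimes>\<^bsub>K\<^esub> (y \<otimes>\<^bsub>K\<^esub> z)"
    by (simp add: carrier_K funpow_mod funpow_mult m_assoc funpow_add mod_add_left_eq mod_add_right_eq add.assoc)
next
  fix x assume "x \<in> carrier K"
  then obtain a m where x: "x = (a, m)" "a \<in> carrier H" "m < k" by (auto simp: carrier_K)
  then show "\<one>\<^bsub>K\<^esub> \<otimes>\<^bsub>K\<^esub> x = x" by simp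
  \<comment> \<open>The inverse of \<open>a t^m\<close> is \<open>t^(k-m) a^-1\<close>, with the
    power of \<open>t\<close> moved to the right. The outer \<open>mod k\<close> is for
    \<open>m = 0\<close>.\<close>
  let ?y = "((\<alpha> ^^ (k - m)) (inv a), (k - m) mod k)"
  have "?y \<otimes>\<^bsub>K\<^esub> x = ((\<alpha> ^^ (k - m)) (inv a \<otimes> a), ((k - m) mod k + m) mod k)"
    unfolding x(1) mult_K using x(2) by (simp only: funpow_mod funpow_mult inv_closed)
  also have "\<dots> = \<one>\<^bsub>K\<^esub>" using x by (simp add: mod_add_left_eq)
  finally have "?y \<otimes>\<^bsub>K\<^esub> x = \<one>\<^bsub>K\<^esub>" .
  moreover have "?y \<in> carrier K" using x k_pos by (simp add: carrier_K)
  ultimately show "\<exists>y\<in>carrier K. y \<otimes>\<^bsub>K\<^esub> x = \<one>\<^bsub>K\<^esub>" by blast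
qed

lemma embedding_hom: "(\<lambda>x. (x, 0)) \<in> hom H K"
  using k_pos by (intro homI) (auto simp: carrier_K)

lemma projection_hom: "(\<lambda>x. int (snd x)) \<in> hom K (integer_mod_group k)"
  using k_pos by (intro homI) (auto simp: carrier_K carrier_integer_mod_group zmod_int)

text \<open>The quotient by \<open>H\<close> is cyclic, hence abelian, so the first derived subgroup
  already lies in \<open>H\<close>. This costs one step, after which the derived series of
  \<open>H\<close> takes over.\<close>

lemma derived_series_K: "derived_series K (Suc n) \<subseteq> (\<lambda>x. (x, 0)) ` derived_series H n"
proof (induction n)
  case 0
  interpret K: group K by (rule group_K)
  interpret Z: comm_group "integer_mod_group k" by (rule abelian_integer_mod_group)
  show ?case
  proof
    fix z assume z: "z \<in> derived_series K (Suc 0)"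
    then have zc: "z \<in> carrier K" using K.derived_series_subset_carrier by blast
    have "int (snd z) \<in> derived_series (integer_mod_group k) (Suc 0)"
      by (rule hom_in_derived_series[OF group_K Z.is_group projection_hom z])
    then have "int (snd z) = 0" using Z.derived_eq_singleton[of "carrier (integer_mod_group k)"] by simp
    then show "z \<in> (\<lambda>x. (x, 0)) ` derived_series H 0" using zc by (force simp: carrier_K)
  qed
next
  case (Suc n)
  interpret K: group K by (rule group_K)
  interpret e: group_hom H K "\<lambda>x. (x, 0)" by unfold_locales (rule embedding_hom)
  have "derived_series K (Suc (Suc n)) \<subseteq> derived K ((\<lambda>x. (x, 0)) ` derived_series H n)"
    using K.mono_derived[OF Suc] by simp
  also have "\<dots> = (\<lambda>x. (x, 0)) ` derived_series H (Suc n)"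
    using e.derived_img[OF derived_series_subset_carrier] by simp
  finally show ?case .
qed

lemma residually_solvable_K:
  assumes "residually_solvable H"
  shows "residually_solvable K"
  unfolding residually_solvable_iff
proof (intro conjI ballI impI group_K)
  fix z assume "z \<in> carrier K" and z: "\<forall>n. z \<in> derived_series K n"
  have D: "fst z \<in> derived_series H n" "snd z = 0" for n
  proof -
    have "z \<in> (\<lambda>x. (x, 0)) ` derived_series H n"
      by (rule subsetD[OF derived_series_K]) (rule z[rule_format])
    then show "fst z \<in> derived_series H n" "snd z = 0" by auto
  qed
  then have "fst z \<in> carrier H" using derived_series_subset_carrier by blast
  then have "fst z = \<one>" using assms D(1) unfolding residually_solvable_iff by blast
  then show "z = \<one>\<^bsub>K\<^esub>" using D(2) by (simp add: prod_eq_iff)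
qed

end

section \<open>The group \<open>Hig\<close> as a cyclic extension\<close>

lemma (in group) image_group_inj:
  assumes "inj f"
  shows "group (image_group f G)" "f \<in> hom G (image_group f G)"
proof -
  have mult: "f x \<otimes>\<^bsub>image_group f G\<^esub> f y = f (x \<otimes> y)" if "x \<in> carrier G" "y \<in> carrier G" for x y
    using that inv_into_f_f[OF inj_on_subset[OF assms subset_UNIV]] by (simp add: image_group_def)
  show "f \<in> hom G (image_group f G)"
    using mult by (intro homI) (simp_all add: image_group_carrier)
  show "group (image_group f G)"
  proof (rule groupI)
    fix x assume "x \<in> carrier (image_group f G)"
    then obtain g where g: "g \<in> carrier G" "x = f g" by (auto simp: image_group_carrier)
    then show "\<one>\<^bsub>image_group f G\<^esub> \<otimes>\<^bsub>image_group f G\<^esub> x = x"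
      by (simp add: image_group_one mult)
    show "\<exists>y\<in>carrier (image_group f G). y \<otimes>\<^bsub>image_group f G\<^esub> x = \<one>\<^bsub>image_group f G\<^esub>"
      using g by (intro bexI[of _ "f (inv g)"]) (simp_all add: image_group_one image_group_carrier mult)
  qed (auto simp: image_group_carrier image_group_one mult m_assoc)
qed

lemma group_G_and_Z: "group G \<Longrightarrow> group (G_and_Z G i)"
  by (cases i) (simp_all add: G_and_Z_def group.image_group_inj(1))

lemma hom_G_and_Z:
  fixes G :: "('a, 'm) monoid_scheme"
  assumes G: "group G" and K: "group K" and f: "f \<in> hom G K" and s: "s \<in> carrier K"
  shows "case_sum f (\<lambda>z. s [^]\<^bsub>K\<^esub> z) \<in> hom (G_and_Z G i) K"
proof (cases i)
  case True
  have "(Inl x :: _ + int) \<otimes>\<^bsub>image_group Inl G\<^esub> Inl y = Inl (x \<otimes>\<^bsub>G\<^esub> y)"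
    if "x \<in> carrier G" "y \<in> carrier G" for x y
    by (rule HOL.sym) (rule hom_mult[OF group.image_group_inj(2)[OF G inj_Inl] that])
  then show ?thesis
    using True hom_in_carrier[OF f] hom_mult[OF f]
    by (intro homI) (auto simp: G_and_Z_def image_group_carrier)
next
  case False
  interpret K: group K by fact
  have "(Inr x :: 'a + int) \<otimes>\<^bsub>image_group Inr integer_group\<^esub> Inr y = Inr (x + y)" for x y
  proof -
    have "(Inr (x \<otimes>\<^bsub>integer_group\<^esub> y) :: 'a + int) = Inr x \<otimes>\<^bsub>image_group Inr integer_group\<^esub> Inr y"
      by (rule hom_mult[OF group.image_group_inj(2)[OF group_integer_group inj_Inr]]) simp_all
    then show ?thesis by simp
  qed
  then show ?thesis
    using False s
    by (intro homI) (auto simp: G_and_Z_def image_group_carrier K.int_pow_mult)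
qed

definition Hig_relators ::
  "nat \<Rightarrow> ('a, 'm) monoid_scheme \<Rightarrow> 'a set \<Rightarrow> ('a \<Rightarrow> 'a) \<Rightarrow> (bool \<times> ('a + int)) list set set"
  where
  "Hig_relators k G B \<phi> =
    (let F = free_product UNIV (G_and_Z G);
         \<iota> = (\<lambda>g. free_product_incl UNIV (G_and_Z G) True (Inl g));
         t = free_product_incl UNIV (G_and_Z G) False (Inr 1)
     in {t [^]\<^bsub>F\<^esub> k} \<union>
        {inv\<^bsub>F\<^esub> (inv\<^bsub>F\<^esub> t \<otimes>\<^bsub>F\<^esub> \<iota> b \<otimes>\<^bsub>F\<^esub> t) \<otimes>\<^bsub>F\<^esub> \<iota> (\<phi> b) | b. b \<in> B})"

locale Hig_presentation = retracting +
  fixes k :: nat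
  assumes k_pos: "0 < k"

sublocale Hig_presentation \<subseteq> T: presentation UNIV "G_and_Z G" "Hig_relators k G B \<phi>"
proof -
  interpret group_family UNIV "G_and_Z G" by (rule group_family.intro) (rule group_G_and_Z[OF grp])
  interpret F: group F by (rule group_free_product)
  have \<iota>: "\<iota> True (Inl g) \<in> carrier F" if "g \<in> carrier G" for g
    using that hom_in_carrier[OF incl_hom[of True], of "Inl g"]
    by (simp add: G_and_Z_def image_group_carrier)
  have t: "\<iota> False (Inr 1) \<in> carrier F"
    using hom_in_carrier[OF incl_hom[of False], of "Inr 1"]
    by (simp add: G_and_Z_def image_group_carrier)
  show "presentation UNIV (G_and_Z G) (Hig_relators k G B \<phi>)"
  proof unfold_locales
    show "Hig_relators k G B \<phi> \<subseteq> carrier F"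
      using \<iota> t B_sub \<phi>_closed by (auto simp: Hig_relators_def Let_def)
  qed
qed

sublocale Hig_presentation \<subseteq> C: gluing G B \<phi> "{0..<k}" "cycle_edges k"
  by (rule gluing_cycle)

context Hig_presentation
begin

lemma Hig_eq: "Hig k G B \<phi> = T.presented"
  unfolding T.presented_def unfolding Hig_def Hig_relators_def Let_def ..

section \<open>Generators and universal property of \<open>Hig\<close>\<close>

definition base where "base g = T.gen True (Inl g)"
definition stable where "stable = T.gen False (Inr 1)"

lemma base_hom: "base \<in> hom G T.presented"
proof -
  have "Inl \<in> hom G (G_and_Z G True)"
    using group.image_group_inj(2)[OF grp inj_Inl] by (simp add: G_and_Z_def)
  from Group.hom_compose[OF this T.gen_hom] show ?thesis by (simp add: base_def[abs_def] comp_def)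
qed

lemma stable_closed: "stable \<in> carrier T.presented"
  unfolding stable_def using hom_in_carrier[OF T.gen_hom[of False], of "Inr 1"]
  by (simp add: G_and_Z_def image_group_carrier)

lemma gen_Inr: "T.gen False (Inr z) = stable [^]\<^bsub>T.presented\<^esub> z"
proof -
  have "Inr \<in> hom integer_group (G_and_Z G False)"
    using group.image_group_inj(2)[OF group_integer_group inj_Inr] by (simp add: G_and_Z_def)
  from Group.hom_compose[OF this T.gen_hom]
  have hom: "(\<lambda>z. T.gen False (Inr z)) \<in> hom integer_group T.presented" by (simp add: comp_def)
  show ?thesis
    using hom_int_pow[OF hom, of 1 z] T.group_presented by (simp add: stable_def)
qed

lemma stable_pow_k: "stable [^]\<^bsub>T.presented\<^esub> k = \<one>\<^bsub>T.presented\<^esub>"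
proof -
  interpret q: group_hom T.F T.presented "\<lambda>x. normal_closure T.F (Hig_relators k G B \<phi>) #>\<^bsub>T.F\<^esub> x"
    by (intro group_hom.intro T.group_free_product T.group_presented group_hom_axioms.intro T.quotient_hom)
  have t: "T.\<iota> False (Inr 1) \<in> carrier T.F"
    using hom_in_carrier[OF T.incl_hom[of False], of "Inr 1"] by (simp add: G_and_Z_def image_group_carrier)
  have "T.\<iota> False (Inr 1) [^]\<^bsub>T.F\<^esub> k \<in> Hig_relators k G B \<phi>"
    by (simp add: Hig_relators_def Let_def)
  from T.quotient_relator[OF this] show ?thesis
    unfolding stable_def T.gen_def using q.hom_nat_pow[OF t, of k] by simp
qed

lemma base_stable:
  assumes b: "b \<in> B"
  shows "base b \<otimes>\<^bsub>T.presented\<^esub> stable = stable \<otimes>\<^bsub>T.presented\<^esub> base (\<phi> b)"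
proof -
  interpret X: group T.presented by (rule T.group_presented)
  interpret q: group_hom T.F T.presented "\<lambda>x. normal_closure T.F (Hig_relators k G B \<phi>) #>\<^bsub>T.F\<^esub> x"
    by (intro group_hom.intro T.group_free_product T.group_presented group_hom_axioms.intro T.quotient_hom)
  have t: "T.\<iota> False (Inr 1) \<in> carrier T.F"
    using hom_in_carrier[OF T.incl_hom[of False], of "Inr 1"] by (simp add: G_and_Z_def image_group_carrier)
  have \<iota>: "T.\<iota> True (Inl g) \<in> carrier T.F" if "g \<in> carrier G" for g
    using that hom_in_carrier[OF T.incl_hom[of True], of "Inl g"]
    by (simp add: G_and_Z_def image_group_carrier)
  note c = \<iota>[OF B_sub[OF b]] \<iota>[OF \<phi>_closed[OF b]]
  have "inv\<^bsub>T.F\<^esub> (inv\<^bsub>T.F\<^esub> T.\<iota> False (Inr 1) \<otimes>\<^bsub>T.F\<^esub> T.\<iota> True (Inl b) \<otimes>\<^bsub>T.F\<^esub> T.\<iota> False (Inr 1))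
      \<otimes>\<^bsub>T.F\<^esub> T.\<iota> True (Inl (\<phi> b)) \<in> Hig_relators k G B \<phi>"
    unfolding Hig_relators_def Let_def using b by blast
  from T.quotient_relator[OF this]
  have rel: "inv\<^bsub>T.presented\<^esub> (inv\<^bsub>T.presented\<^esub> stable \<otimes>\<^bsub>T.presented\<^esub> base b \<otimes>\<^bsub>T.presented\<^esub> stable)
      \<otimes>\<^bsub>T.presented\<^esub> base (\<phi> b) = \<one>\<^bsub>T.presented\<^esub>"
    unfolding stable_def base_def T.gen_def using c t
    by (simp only: q.hom_mult q.hom_inv q.inv_closed q.m_closed q.G.inv_closed q.G.m_closed)
  have bc: "base b \<in> carrier T.presented" "base (\<phi> b) \<in> carrier T.presented"
    using hom_in_carrier[OF base_hom] B_sub[OF b] \<phi>_closed[OF b] by blast+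
  let ?y = "inv\<^bsub>T.presented\<^esub> stable \<otimes>\<^bsub>T.presented\<^esub> base b \<otimes>\<^bsub>T.presented\<^esub> stable"
  have yc: "?y \<in> carrier T.presented" using stable_closed bc by simp
  have "inv\<^bsub>T.presented\<^esub> ?y = inv\<^bsub>T.presented\<^esub> base (\<phi> b)"
    using X.inv_equality[OF rel bc(2)] yc by simp
  then have "base (\<phi> b) = ?y" using X.inv_inj yc bc(2) by (metis X.inv_inv)
  then have "stable \<otimes>\<^bsub>T.presented\<^esub> base (\<phi> b) = stable \<otimes>\<^bsub>T.presented\<^esub> ?y" by simp
  also have "\<dots> = base b \<otimes>\<^bsub>T.presented\<^esub> stable"
    using stable_closed bc by (simp add: X.m_assoc[symmetric])
  finally show ?thesis ..
qed

lemma Hig_hom: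
  assumes L: "group L" and f: "f \<in> hom G L" and s: "s \<in> carrier L" "s [^]\<^bsub>L\<^esub> k = \<one>\<^bsub>L\<^esub>"
    and fs: "\<And>b. b \<in> B \<Longrightarrow> f b \<otimes>\<^bsub>L\<^esub> s = s \<otimes>\<^bsub>L\<^esub> f (\<phi> b)"
  shows "\<exists>h\<in>hom T.presented L. (\<forall>g\<in>carrier G. h (base g) = f g) \<and> h stable = s"
proof -
  interpret L: group L by fact
  define f' where "f' i = case_sum f (\<lambda>z::int. s [^]\<^bsub>L\<^esub> z)" for i :: bool
  have f': "f' i \<in> hom (G_and_Z G i) L" for i
    unfolding f'_def by (rule hom_G_and_Z[OF grp L f s(1)])
  have carrier_True: "Inl g \<in> carrier (G_and_Z G True)" if "g \<in> carrier G" for g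
    using that by (simp add: G_and_Z_def image_group_carrier)
  have carrier_False: "Inr z \<in> carrier (G_and_Z G False)" for z
    by (simp add: G_and_Z_def image_group_carrier)
  have "\<exists>h\<in>hom T.presented L. \<forall>i\<in>UNIV. \<forall>x\<in>carrier (G_and_Z G i). h (T.gen i x) = f' i x"
  proof (rule T.presented_hom[OF L f'])
    fix h x
    assume h: "h \<in> hom T.F L"
      and gens: "\<And>i x. \<lbrakk>i \<in> UNIV; x \<in> carrier (G_and_Z G i)\<rbrakk> \<Longrightarrow> h (T.\<iota> i x) = f' i x"
      and x: "x \<in> Hig_relators k G B \<phi>"
    interpret h: group_hom T.F L h
      by (intro group_hom.intro T.group_free_product L group_hom_axioms.intro h)
    have h_t: "h (T.\<iota> False (Inr 1)) = s" using gens[of False "Inr 1"] carrier_False s by (simp add: f'_def)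
    have h_g: "h (T.\<iota> True (Inl g)) = f g" if "g \<in> carrier G" for g
      using gens[of True "Inl g"] carrier_True[OF that] by (simp add: f'_def)
    have t: "T.\<iota> False (Inr 1) \<in> carrier T.F"
      by (rule hom_in_carrier[OF T.incl_hom carrier_False]) simp
    have \<iota>: "T.\<iota> True (Inl g) \<in> carrier T.F" if "g \<in> carrier G" for g
      by (rule hom_in_carrier[OF T.incl_hom carrier_True[OF that]]) simp
    from x consider "x = T.\<iota> False (Inr 1) [^]\<^bsub>T.F\<^esub> k"
      | b where "b \<in> B" "x = inv\<^bsub>T.F\<^esub> (inv\<^bsub>T.F\<^esub> T.\<iota> False (Inr 1) \<otimes>\<^bsub>T.F\<^esub> T.\<iota> True (Inl b) \<otimes>\<^bsub>T.F\<^esub> T.\<iota> False (Inr 1))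
      \<otimes>\<^bsub>T.F\<^esub> T.\<iota> True (Inl (\<phi> b))"
      unfolding Hig_relators_def Let_def by blast
    then show "h x = \<one>\<^bsub>L\<^esub>"
    proof cases
      case 1
      then show ?thesis using h.hom_nat_pow[OF t, of k] h_t s(2) by simp
    next
      case 2
      note c = \<iota>[OF B_sub[OF 2(1)]] \<iota>[OF \<phi>_closed[OF 2(1)]]
      note fc = hom_in_carrier[OF f B_sub[OF 2(1)]] hom_in_carrier[OF f \<phi>_closed[OF 2(1)]]
      have "h x = inv\<^bsub>L\<^esub> (inv\<^bsub>L\<^esub> s \<otimes>\<^bsub>L\<^esub> f b \<otimes>\<^bsub>L\<^esub> s) \<otimes>\<^bsub>L\<^esub> f (\<phi> b)"
        unfolding 2(2) using c t h_t h_g B_sub[OF 2(1)] \<phi>_closed[OF 2(1)]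
        by (simp only: h.hom_mult h.hom_inv h.G.inv_closed h.G.m_closed)
      also have "inv\<^bsub>L\<^esub> s \<otimes>\<^bsub>L\<^esub> f b \<otimes>\<^bsub>L\<^esub> s = inv\<^bsub>L\<^esub> s \<otimes>\<^bsub>L\<^esub> (s \<otimes>\<^bsub>L\<^esub> f (\<phi> b))"
        using fs[OF 2(1)] s fc by (simp add: L.m_assoc)
      also have "\<dots> = f (\<phi> b)" using s fc by (simp add: L.m_assoc[symmetric])
      finally show ?thesis using fc by simp
    qed
  qed
  then obtain h where h: "h \<in> hom T.presented L"
    "\<And>i x. x \<in> carrier (G_and_Z G i) \<Longrightarrow> h (T.gen i x) = f' i x" by auto
  have "h (base g) = f g" if "g \<in> carrier G" for g
    unfolding base_def using h(2)[OF carrier_True[OF that]] by (simp add: f'_def)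
  moreover have "h stable = s"
    unfolding stable_def using h(2)[OF carrier_False] s by (simp add: f'_def)
  ultimately show ?thesis using h(1) by blast
qed

text \<open>Rotating the cycle maps edges to edges and therefore respects the gluing. Inside
  \<open>Hig\<close> this rotation becomes conjugation by \<open>t\<close>.\<close>

lemma shift_exists:
  "\<exists>\<alpha>\<in>hom C.presented C.presented. \<forall>i\<in>{0..<k}. \<forall>g\<in>carrier G. \<alpha> (C.gen i g) = C.gen (Suc i mod k) g"
proof (rule C.glue_hom[OF C.group_presented])
  show "C.gen (Suc i mod k) \<in> hom G C.presented" for i using C.gen_hom k_pos by simp
  fix i j b assume ij: "(i, j) \<in> cycle_edges k" and b: "b \<in> B"
  have "(Suc i mod k, Suc j mod k) \<in> cycle_edges k"
  proof -
    have "Suc i mod k < k" using k_pos by simp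
    moreover have "j = Suc i mod k" using ij by auto
    ultimately show ?thesis by (auto simp: cycle_edges_def simp del: cycle_edges_iff)
  qed
  then show "C.gen (Suc i mod k) b = C.gen (Suc j mod k) (\<phi> b)" by (rule C.gen_glue[OF _ b])
qed

text \<open>It suffices that the homomorphism \<open>\<Psi>\<close> from \<open>Hig\<close> to the
  cyclic extension of the cycle group is injective. In \<open>Hig\<close> every element has the form
  \<open>\<theta> y\<close> times \<open>t^m\<close>, where \<open>\<theta>\<close> comes from the
  cycle group. Its image under \<open>\<Psi>\<close> is \<open>(y, m mod k)\<close>, which
  determines it because \<open>t^k = 1\<close>.\<close>

theorem residually_solvable_Hig:
  assumes rs: "residually_solvable C.presented"
  shows "residually_solvable (Hig k G B \<phi>)"
proof -
  interpret T: group T.presented by (rule T.group_presented)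
  interpret C: group C.presented by (rule C.group_presented)
  obtain \<alpha> where \<alpha>: "\<alpha> \<in> hom C.presented C.presented"
    "\<And>i g. \<lbrakk>i < k; g \<in> carrier G\<rbrakk> \<Longrightarrow> \<alpha> (C.gen i g) = C.gen (Suc i mod k) g"
    using shift_exists by auto
  have \<alpha>_pow: "(\<alpha> ^^ m) (C.gen i g) = C.gen ((i + m) mod k) g" if "i < k" "g \<in> carrier G" for m i g
    using that by (induction m) (simp_all add: \<alpha>(2) k_pos mod_Suc_eq)
  have \<alpha>_pow_hom: "\<alpha> ^^ m \<in> hom C.presented C.presented" for m
  proof (induction m)
    case 0
    then show ?case by (auto intro: homI)
  next
    case (Suc m)
    show ?case unfolding funpow.simps(2) by (rule Group.hom_compose[OF Suc \<alpha>(1)])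
  qed
  have id_hom: "(\<lambda>x. x) \<in> hom C.presented C.presented" by (rule homI) auto
  interpret A: cyclic_action C.presented \<alpha> k
  proof unfold_locales
    show "\<alpha> \<in> hom C.presented C.presented" by (rule \<alpha>(1))
    show "0 < k" by (rule k_pos)
    show "(\<alpha> ^^ k) x = x" if "x \<in> carrier C.presented" for x
      by (rule C.presented_hom_eq[OF C.group_presented \<alpha>_pow_hom id_hom _ that]) (simp add: \<alpha>_pow)
  qed
  interpret K: group A.K by (rule A.group_K)
  have gen_hom0: "C.gen 0 \<in> hom G C.presented" using C.gen_hom[of 0] k_pos by simp
  \<comment> \<open>The exponent \<open>1 mod k\<close> stays below \<open>k\<close> also for
    \<open>k = 1\<close>.\<close>
  define s where "s = (\<one>\<^bsub>C.presented\<^esub>, 1 mod k)"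
  have sK: "s \<in> carrier A.K" using k_pos by (simp add: s_def A.carrier_K)
  have s_pow: "s [^]\<^bsub>A.K\<^esub> m = (\<one>\<^bsub>C.presented\<^esub>, m mod k)" for m :: nat
    by (induction m) (simp_all add: s_def mod_add_left_eq mod_add_right_eq)
  have f_hom: "(\<lambda>g. (C.gen 0 g, 0)) \<in> hom G A.K"
    using Group.hom_compose[OF gen_hom0 A.embedding_hom] by (simp add: comp_def)
  have f_s: "(C.gen 0 b, 0) \<otimes>\<^bsub>A.K\<^esub> s = s \<otimes>\<^bsub>A.K\<^esub> (C.gen 0 (\<phi> b), 0)" if b: "b \<in> B" for b
  proof -
    have "(0, 1 mod k) \<in> cycle_edges k" using k_pos by (auto simp: cycle_edges_def simp del: cycle_edges_iff)
    then have 1: "C.gen 0 b = C.gen (1 mod k) (\<phi> b)" by (rule C.gen_glue[OF _ b])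
    have "(\<alpha> ^^ (1 mod k)) (C.gen 0 (\<phi> b)) = C.gen (1 mod k) (\<phi> b)"
      using \<alpha>_pow[OF k_pos \<phi>_closed[OF b], of "1 mod k"] by simp
    then show ?thesis
      using 1 C.gen_closed[of 0] B_sub[OF b] \<phi>_closed[OF b] k_pos C.gen_closed[of "1 mod k"]
      by (simp add: s_def)
  qed
  obtain \<Psi> where \<Psi>: "\<Psi> \<in> hom T.presented A.K" "\<And>g. g \<in> carrier G \<Longrightarrow> \<Psi> (base g) = (C.gen 0 g, 0)"
    "\<Psi> stable = s"
    using Hig_hom[OF A.group_K f_hom sK _ f_s] s_pow[of k] by auto
  interpret \<Psi>: group_hom T.presented A.K \<Psi> by unfold_locales (rule \<Psi>(1))
  have conj_hom: "(\<lambda>x. c \<otimes>\<^bsub>T.presented\<^esub> x \<otimes>\<^bsub>T.presented\<^esub> inv\<^bsub>T.presented\<^esub> c) \<in> hom T.presented T.presented"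
    if "c \<in> carrier T.presented" for c
  proof (rule homI)
    fix x y assume "x \<in> carrier T.presented" "y \<in> carrier T.presented"
    then show "c \<otimes>\<^bsub>T.presented\<^esub> (x \<otimes>\<^bsub>T.presented\<^esub> y) \<otimes>\<^bsub>T.presented\<^esub> inv\<^bsub>T.presented\<^esub> c =
        c \<otimes>\<^bsub>T.presented\<^esub> x \<otimes>\<^bsub>T.presented\<^esub> inv\<^bsub>T.presented\<^esub> c \<otimes>\<^bsub>T.presented\<^esub>
        (c \<otimes>\<^bsub>T.presented\<^esub> y \<otimes>\<^bsub>T.presented\<^esub> inv\<^bsub>T.presented\<^esub> c)"
      using that by (simp add: T.m_assoc T.inv_solve_left)
  qed (use that in simp)
  let ?p = "\<lambda>i::nat. stable [^]\<^bsub>T.presented\<^esub> i"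
  have pc: "?p i \<in> carrier T.presented" for i by (rule T.nat_pow_closed[OF stable_closed])
  \<comment> \<open>As \<open>\<phi> b = t\<^sup>-\<^sup>1 b t\<close>, the copy of \<open>G\<close> with index \<open>i\<close> is \<open>t\<^sup>i G t\<^sup>-\<^sup>i\<close>.\<close>
  define f where "f i = (\<lambda>x. ?p i \<otimes>\<^bsub>T.presented\<^esub> x \<otimes>\<^bsub>T.presented\<^esub> inv\<^bsub>T.presented\<^esub> ?p i) \<circ> base" for i
  have bc: "base g \<in> carrier T.presented" if "g \<in> carrier G" for g by (rule hom_in_carrier[OF base_hom that])
  have p_mod: "?p (m mod k) = ?p m" for m
  proof -
    have "?p m = ?p (m mod k + k * (m div k))" by simp
    also have "\<dots> = ?p (m mod k) \<otimes>\<^bsub>T.presented\<^esub> (?p k [^]\<^bsub>T.presented\<^esub> (m div k))"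
      using stable_closed by (simp only: T.nat_pow_mult T.nat_pow_pow)
    also have "\<dots> = ?p (m mod k)" using pc by (simp add: stable_pow_k)
    finally show ?thesis by simp
  qed
  have p_Suc: "?p (Suc i) = stable \<otimes>\<^bsub>T.presented\<^esub> ?p i" for i by (rule T.nat_pow_Suc2[OF stable_closed])
  have f_Suc: "f (Suc i mod k) g = stable \<otimes>\<^bsub>T.presented\<^esub> f i g \<otimes>\<^bsub>T.presented\<^esub> inv\<^bsub>T.presented\<^esub> stable"
    if "g \<in> carrier G" for i g
    unfolding f_def comp_apply p_mod p_Suc using that bc pc stable_closed
    by (simp add: T.inv_mult_group T.m_assoc)
  have "\<exists>\<theta>\<in>hom C.presented T.presented. \<forall>i\<in>{0..<k}. \<forall>g\<in>carrier G. \<theta> (C.gen i g) = f i g"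
  proof (rule C.glue_hom[OF T.group_presented])
    show "f i \<in> hom G T.presented" for i
      unfolding f_def by (rule Group.hom_compose[OF base_hom conj_hom[OF pc]])
    fix i j b assume ij: "(i, j) \<in> cycle_edges k" and b: "b \<in> B"
    have j: "j = Suc i mod k" using ij by auto
    note c = bc[OF B_sub[OF b]] bc[OF \<phi>_closed[OF b]]
    have "f j (\<phi> b) = ?p i \<otimes>\<^bsub>T.presented\<^esub> (stable \<otimes>\<^bsub>T.presented\<^esub> base (\<phi> b)) \<otimes>\<^bsub>T.presented\<^esub>
        (inv\<^bsub>T.presented\<^esub> stable \<otimes>\<^bsub>T.presented\<^esub> inv\<^bsub>T.presented\<^esub> ?p i)"
      unfolding j f_def comp_apply p_mod T.nat_pow_Suc using c pc stable_closed
      by (simp add: T.inv_mult_group T.m_assoc)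
    also have "\<dots> = ?p i \<otimes>\<^bsub>T.presented\<^esub> (base b \<otimes>\<^bsub>T.presented\<^esub> stable) \<otimes>\<^bsub>T.presented\<^esub>
        (inv\<^bsub>T.presented\<^esub> stable \<otimes>\<^bsub>T.presented\<^esub> inv\<^bsub>T.presented\<^esub> ?p i)"
      unfolding base_stable[OF b] ..
    also have "\<dots> = f i b"
    proof -
      have "stable \<otimes>\<^bsub>T.presented\<^esub> (inv\<^bsub>T.presented\<^esub> stable \<otimes>\<^bsub>T.presented\<^esub> inv\<^bsub>T.presented\<^esub> ?p i) = inv\<^bsub>T.presented\<^esub> ?p i"
        using pc stable_closed by (simp add: T.m_assoc[symmetric])
      then show ?thesis unfolding f_def comp_apply using c pc stable_closed by (simp add: T.m_assoc)
    qed
    finally show "f i b = f j (\<phi> b)" ..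
  qed
  then obtain \<theta> where \<theta>: "\<theta> \<in> hom C.presented T.presented"
    "\<And>i g. \<lbrakk>i < k; g \<in> carrier G\<rbrakk> \<Longrightarrow> \<theta> (C.gen i g) = f i g" by auto
  have \<theta>c: "\<theta> y \<in> carrier T.presented" if "y \<in> carrier C.presented" for y by (rule hom_in_carrier[OF \<theta>(1) that])
  \<comment> \<open>Turning the rotation into conjugation by \<open>t\<close> makes it possible to
    collect the powers of \<open>t\<close> on the right of a product.\<close>
  have conj: "\<theta> (\<alpha> y) = stable \<otimes>\<^bsub>T.presented\<^esub> \<theta> y \<otimes>\<^bsub>T.presented\<^esub> inv\<^bsub>T.presented\<^esub> stable"
    if y: "y \<in> carrier C.presented" for y
  proof -
    have "(\<theta> \<circ> \<alpha>) y = ((\<lambda>x. stable \<otimes>\<^bsub>T.presented\<^esub> x \<otimes>\<^bsub>T.presented\<^esub> inv\<^bsub>T.presented\<^esub> stable) \<circ> \<theta>) y"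
    proof (rule C.presented_hom_eq[OF T.group_presented _ _ _ y])
      show "\<theta> \<circ> \<alpha> \<in> hom C.presented T.presented" by (rule Group.hom_compose[OF \<alpha>(1) \<theta>(1)])
      show "(\<lambda>x. stable \<otimes>\<^bsub>T.presented\<^esub> x \<otimes>\<^bsub>T.presented\<^esub> inv\<^bsub>T.presented\<^esub> stable) \<circ> \<theta> \<in> hom C.presented T.presented"
        by (rule Group.hom_compose[OF \<theta>(1) conj_hom[OF stable_closed]])
    qed (simp add: \<alpha>(2) \<theta>(2) f_Suc k_pos)
    then show ?thesis by simp
  qed
  have stable_\<theta>: "stable \<otimes>\<^bsub>T.presented\<^esub> \<theta> y = \<theta> (\<alpha> y) \<otimes>\<^bsub>T.presented\<^esub> stable"
    if y: "y \<in> carrier C.presented" for y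
    unfolding conj[OF y] using \<theta>c[OF y] stable_closed by (simp add: T.m_assoc)
  \<comment> \<open>These are the normal forms. Left multiplication by \<open>t\<close> and by
    elements of \<open>G\<close> preserves them, and by induction along the presentation they
    exhaust \<open>Hig\<close>.\<close>
  define N where "N = {\<theta> y \<otimes>\<^bsub>T.presented\<^esub> ?p m | y m. y \<in> carrier C.presented}"
  have N_stable: "stable \<otimes>\<^bsub>T.presented\<^esub> x \<in> N" if "x \<in> N" for x
  proof -
    obtain y m where y: "y \<in> carrier C.presented" and x: "x = \<theta> y \<otimes>\<^bsub>T.presented\<^esub> ?p m"
      using \<open>x \<in> N\<close> unfolding N_def by blast
    have \<alpha>y: "\<alpha> y \<in> carrier C.presented" by (rule hom_in_carrier[OF \<alpha>(1) y])
    have "stable \<otimes>\<^bsub>T.presented\<^esub> x = (stable \<otimes>\<^bsub>T.presented\<^esub> \<theta> y) \<otimes>\<^bsub>T.presented\<^esub> ?p m"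
      unfolding x using stable_closed \<theta>c[OF y] pc by (simp add: T.m_assoc)
    also have "\<dots> = \<theta> (\<alpha> y) \<otimes>\<^bsub>T.presented\<^esub> ?p (Suc m)"
      unfolding stable_\<theta>[OF y] p_Suc using stable_closed \<theta>c[OF \<alpha>y] pc by (simp add: T.m_assoc)
    finally show ?thesis unfolding N_def using \<alpha>y by blast
  qed
  have N_carrier: "N \<subseteq> carrier T.presented" unfolding N_def using \<theta>c pc by auto
  have N_pow: "?p c \<otimes>\<^bsub>T.presented\<^esub> x \<in> N" if x: "x \<in> N" for x c
  proof (induction c)
    case 0
    then show ?case using x N_carrier by auto
  next
    case (Suc c)
    have "?p (Suc c) \<otimes>\<^bsub>T.presented\<^esub> x = stable \<otimes>\<^bsub>T.presented\<^esub> (?p c \<otimes>\<^bsub>T.presented\<^esub> x)"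
      unfolding p_Suc using x N_carrier stable_closed pc by (intro T.m_assoc) auto
    then show ?case using N_stable[OF Suc] by simp
  qed
  have N_base: "base g \<otimes>\<^bsub>T.presented\<^esub> x \<in> N" if x: "x \<in> N" and g: "g \<in> carrier G" for x g
  proof -
    obtain y m where y: "y \<in> carrier C.presented" and x: "x = \<theta> y \<otimes>\<^bsub>T.presented\<^esub> ?p m"
      using \<open>x \<in> N\<close> unfolding N_def by blast
    have gc: "C.gen 0 g \<in> carrier C.presented" using C.gen_closed[of 0 g] k_pos g by simp
    have "\<theta> (C.gen 0 g) = base g" using \<theta>(2)[OF k_pos g] bc[OF g] by (simp add: f_def)
    then have "base g \<otimes>\<^bsub>T.presented\<^esub> x = \<theta> (C.gen 0 g \<otimes>\<^bsub>C.presented\<^esub> y) \<otimes>\<^bsub>T.presented\<^esub> ?p m"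
      unfolding x hom_mult[OF \<theta>(1) gc y] using \<theta>c[OF y] pc bc[OF g] by (simp add: T.m_assoc)
    moreover have "C.gen 0 g \<otimes>\<^bsub>C.presented\<^esub> y \<in> carrier C.presented" using gc y by simp
    ultimately show ?thesis unfolding N_def by blast
  qed
  have all: "x \<in> N" if "x \<in> carrier T.presented" for x
    using that
  proof (induction rule: T.presented_induct)
    case one
    have "\<one>\<^bsub>T.presented\<^esub> = \<theta> \<one>\<^bsub>C.presented\<^esub> \<otimes>\<^bsub>T.presented\<^esub> ?p 0"
      using hom_one[OF \<theta>(1) C.group_presented T.group_presented] by simp
    then show ?case unfolding N_def by blast
  next
    case (mult i x z)
    show ?case
    proof (cases i)
      case True
      then obtain g where "g \<in> carrier G" "x = Inl g"
        using mult(2) by (auto simp: G_and_Z_def image_group_carrier)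
      then show ?thesis using N_base[OF mult(4)] True by (simp add: base_def)
    next
      case False
      then obtain c where c: "x = Inr c"
        using mult(2) by (auto simp: G_and_Z_def image_group_carrier)
      \<comment> \<open>Letters of the infinite cyclic factor have integer exponents; the relation
        \<open>t^k = 1\<close> turns them into the natural exponents used in
        \<open>N\<close>.\<close>
      have "stable [^]\<^bsub>T.presented\<^esub> c = ?p (nat (c mod int k))"
      proof -
        have "stable [^]\<^bsub>T.presented\<^esub> c = stable [^]\<^bsub>T.presented\<^esub> (int k * (c div int k) + int (nat (c mod int k)))"
          using k_pos by simp
        also have "\<dots> = (?p k [^]\<^bsub>T.presented\<^esub> (c div int k)) \<otimes>\<^bsub>T.presented\<^esub> ?p (nat (c mod int k))"
          using stable_closed by (simp only: T.int_pow_mult T.int_pow_pow[symmetric] int_pow_int)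
        also have "\<dots> = ?p (nat (c mod int k))" using pc by (simp add: stable_pow_k)
        finally show ?thesis .
      qed
      then show ?thesis using N_pow[OF mult(4)] False c gen_Inr by simp
    qed
  qed
  have \<Psi>\<theta>: "\<Psi> (\<theta> y) = (y, 0)" if y: "y \<in> carrier C.presented" for y
  proof -
    have "(\<Psi> \<circ> \<theta>) y = (\<lambda>y. (y, 0)) y"
    proof (rule C.presented_hom_eq[OF A.group_K _ A.embedding_hom _ y])
      show "\<Psi> \<circ> \<theta> \<in> hom C.presented A.K" by (rule Group.hom_compose[OF \<theta>(1) \<Psi>(1)])
      fix i g assume i: "i \<in> {0..<k}" and g: "g \<in> carrier G"
      have gc: "C.gen 0 g \<in> carrier C.presented" "C.gen i g \<in> carrier C.presented"
        using C.gen_closed i g k_pos by simp_all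
      have "\<Psi> (\<theta> (C.gen i g)) = s [^]\<^bsub>A.K\<^esub> i \<otimes>\<^bsub>A.K\<^esub> (C.gen 0 g, 0) \<otimes>\<^bsub>A.K\<^esub> inv\<^bsub>A.K\<^esub> (s [^]\<^bsub>A.K\<^esub> i)"
        using \<theta>(2)[of i g] i g bc[OF g] pc stable_closed
        by (simp add: f_def \<Psi>(2,3) \<Psi>.hom_nat_pow)
      \<comment> \<open>Moving \<open>s^i\<close> past copy 0 rotates that copy into copy
        \<open>i\<close>.\<close>
      also have "s [^]\<^bsub>A.K\<^esub> i \<otimes>\<^bsub>A.K\<^esub> (C.gen 0 g, 0) = (C.gen i g, 0) \<otimes>\<^bsub>A.K\<^esub> s [^]\<^bsub>A.K\<^esub> i"
        using i gc \<alpha>_pow[OF k_pos g, of i] by (simp add: s_pow)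
      also have "\<dots> \<otimes>\<^bsub>A.K\<^esub> inv\<^bsub>A.K\<^esub> (s [^]\<^bsub>A.K\<^esub> i) = (C.gen i g, 0)"
      proof -
        have "(C.gen i g, 0) \<in> carrier A.K" using gc k_pos by (simp add: A.carrier_K)
        then show ?thesis using K.nat_pow_closed[OF sK, of i] by (simp only: K.m_assoc K.r_inv K.r_one K.inv_closed)
      qed
      finally show "(\<Psi> \<circ> \<theta>) (C.gen i g) = (C.gen i g, 0)" by simp
    qed
    then show ?thesis by simp
  qed
  show ?thesis
    unfolding Hig_eq
  proof (rule residually_solvable_inj_hom[OF T.group_presented A.residually_solvable_K[OF rs] \<Psi>(1)])
    fix x assume x: "x \<in> carrier T.presented" and one: "\<Psi> x = \<one>\<^bsub>A.K\<^esub>"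
    obtain y m where y: "y \<in> carrier C.presented" and xy: "x = \<theta> y \<otimes>\<^bsub>T.presented\<^esub> ?p m"
      using all[OF x] unfolding N_def by blast
    have "\<Psi> x = (y, m mod k)"
      unfolding xy using \<theta>c[OF y] pc stable_closed \<Psi>\<theta>[OF y] y by (simp add: \<Psi>.hom_nat_pow \<Psi>(3) s_pow)
    then have ym: "y = \<one>\<^bsub>C.presented\<^esub>" "m mod k = 0" using one by simp_all
    have "?p m = \<one>\<^bsub>T.presented\<^esub>" using p_mod[of m] unfolding ym(2) by simp
    moreover have "\<theta> y = \<one>\<^bsub>T.presented\<^esub>"
      unfolding ym(1) by (rule hom_one[OF \<theta>(1) C.group_presented T.group_presented])
    ultimately show "x = \<one>\<^bsub>T.presented\<^esub>" unfolding xy by simp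
  qed
qed

end

text \<open>The first component of \<open>\<pi>\<close> is trivial on \<open>B\<close> and the
  second on \<open>A\<close>, the image of \<open>\<phi>\<close>, which gives the vanishing rules.
  The first component is followed by the inverse of \<open>\<phi>\<close> because edges are
  parametrised by \<open>B\<close>.\<close>

lemma retracting_of_projection:
  fixes G :: "('a, 'm) monoid_scheme"
  assumes rs: "residually_solvable G" and A: "subgroup A G" and B: "subgroup B G"
    and \<phi>: "\<phi> \<in> iso (G\<lparr>carrier := B\<rparr>) (G\<lparr>carrier := A\<rparr>)"
    and \<pi>: "\<pi> \<in> hom G (G\<lparr>carrier := A\<rparr> \<times>\<times> G\<lparr>carrier := B\<rparr>)"
    and \<pi>A: "\<And>a. a \<in> A \<Longrightarrow> \<pi> a = (a, \<one>\<^bsub>G\<^esub>)" and \<pi>B: "\<And>b. b \<in> B \<Longrightarrow> \<pi> b = (\<one>\<^bsub>G\<^esub>, b)"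
  shows "retracting G B \<phi> (\<lambda>g. inv_into B \<phi> (fst (\<pi> g))) (\<lambda>g. snd (\<pi> g))"
proof -
  have G: "group G" using rs by (simp add: residually_solvable_def)
  interpret group G by (rule G)
  interpret A: subgroup A G by (rule A)
  interpret B: subgroup B G by (rule B)
  have bij: "bij_betw \<phi> B A" using \<phi> by (simp add: iso_def)
  have \<phi>_mult: "\<phi> (x \<otimes>\<^bsub>G\<^esub> y) = \<phi> x \<otimes>\<^bsub>G\<^esub> \<phi> y" if "x \<in> B" "y \<in> B" for x y
    using \<phi> that by (auto simp: iso_def hom_def)
  have \<phi>A: "\<phi> b \<in> A" if "b \<in> B" for b using bij_betwE[OF bij] that by blast
  let ?\<alpha> = "\<lambda>g. inv_into B \<phi> (fst (\<pi> g))" and ?\<rho> = "\<lambda>g. snd (\<pi> g)"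
  have \<pi>_closed: "fst (\<pi> g) \<in> A" "?\<rho> g \<in> B" if "g \<in> carrier G" for g
    using hom_in_carrier[OF \<pi> that] by (auto simp: DirProd_def)
  have \<pi>_mult: "fst (\<pi> (x \<otimes>\<^bsub>G\<^esub> y)) = fst (\<pi> x) \<otimes>\<^bsub>G\<^esub> fst (\<pi> y)" "?\<rho> (x \<otimes>\<^bsub>G\<^esub> y) = ?\<rho> x \<otimes>\<^bsub>G\<^esub> ?\<rho> y"
    if "x \<in> carrier G" "y \<in> carrier G" for x y
    using hom_mult[OF \<pi> that] by (simp_all add: DirProd_def case_prod_unfold)
  have \<alpha>_closed: "?\<alpha> g \<in> B" if "g \<in> carrier G" for g
    using \<pi>_closed(1)[OF that] bij by (simp add: bij_betw_def inv_into_into)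
  have \<phi>_\<alpha>: "\<phi> (?\<alpha> g) = fst (\<pi> g)" if "g \<in> carrier G" for g
    by (rule bij_betw_inv_into_right[OF bij \<pi>_closed(1)[OF that]])
  have \<alpha>_\<phi>: "inv_into B \<phi> (\<phi> b) = b" if "b \<in> B" for b
    by (rule bij_betw_inv_into_left[OF bij that])
  have \<phi>_one: "\<phi> \<one>\<^bsub>G\<^esub> = \<one>\<^bsub>G\<^esub>"
  proof -
    have "\<phi> \<one>\<^bsub>G\<^esub> \<otimes>\<^bsub>G\<^esub> \<phi> \<one>\<^bsub>G\<^esub> = \<phi> \<one>\<^bsub>G\<^esub>" using \<phi>_mult[of "\<one>\<^bsub>G\<^esub>" "\<one>\<^bsub>G\<^esub>"] by simp
    then show ?thesis using \<phi>A[OF B.one_closed] A.mem_carrier by (metis l_cancel_one)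
  qed
  show ?thesis
  proof
    show "residually_solvable G" by (rule rs)
    show "b \<in> carrier G" "\<phi> b \<in> carrier G" if "b \<in> B" for b
      using that \<phi>A A.mem_carrier B.mem_carrier by blast+
    show "?\<alpha> \<in> hom G G"
    proof (rule homI)
      fix x y assume xy: "x \<in> carrier G" "y \<in> carrier G"
      have "\<phi> (?\<alpha> x \<otimes>\<^bsub>G\<^esub> ?\<alpha> y) = fst (\<pi> (x \<otimes>\<^bsub>G\<^esub> y))"
        using \<phi>_mult[OF \<alpha>_closed \<alpha>_closed] \<phi>_\<alpha> \<pi>_mult(1) xy by simp
      then show "?\<alpha> (x \<otimes>\<^bsub>G\<^esub> y) = ?\<alpha> x \<otimes>\<^bsub>G\<^esub> ?\<alpha> y"
        using \<alpha>_\<phi>[OF B.m_closed[OF \<alpha>_closed \<alpha>_closed]] xy by metis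
    qed (use \<alpha>_closed B.mem_carrier in blast)
    show "?\<rho> \<in> hom G G"
      using \<pi>_closed(2) B.mem_carrier \<pi>_mult(2) by (intro homI) blast+
    show "\<phi> \<circ> ?\<rho> \<in> hom G G"
      using \<phi>A[OF \<pi>_closed(2)] A.mem_carrier \<pi>_mult(2) \<phi>_mult[OF \<pi>_closed(2) \<pi>_closed(2)]
      by (intro homI) simp_all
    show "?\<alpha> g \<in> B" "?\<rho> g \<in> B" if "g \<in> carrier G" for g
      using \<alpha>_closed \<pi>_closed that by blast+
    show "?\<alpha> b = \<one>\<^bsub>G\<^esub>" "?\<rho> b = b" if "b \<in> B" for b
      using \<alpha>_\<phi>[OF B.one_closed] \<phi>_one \<pi>B[OF that] by simp_all
    show "?\<alpha> (\<phi> b) = b" "?\<rho> (\<phi> b) = \<one>\<^bsub>G\<^esub>" if "b \<in> B" for b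
      using \<alpha>_\<phi>[OF that] \<pi>A[OF \<phi>A[OF that]] by simp_all
  qed
qed

theorem theorem1p1:
  fixes G :: "('a, 'm) monoid_scheme"
    and A B :: "'a set"
    and \<phi> :: "'a \<Rightarrow> 'a"
    and \<pi> :: "'a \<Rightarrow> 'a \<times> 'a"
    and k :: nat
  assumes "group G"
    and "residually_solvable G"
    and "subgroup A G"
    and "subgroup B G"
    and "\<phi> \<in> iso (G\<lparr>carrier := B\<rparr>) (G\<lparr>carrier := A\<rparr>)"
    and "\<pi> \<in> hom G (G\<lparr>carrier := A\<rparr> \<times>\<times> G\<lparr>carrier := B\<rparr>)"
    and "\<And>a. a \<in> A \<Longrightarrow> \<pi> a = (a, \<one>\<^bsub>G\<^esub>)"
    and "\<And>b. b \<in> B \<Longrightarrow> \<pi> b = (\<one>\<^bsub>G\<^esub>, b)"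
    and "k \<ge> 4"
  shows "residually_solvable (Hig k G B \<phi>) \<and> residually_solvable (Hig_bar k G B \<phi>)"
proof -
  interpret retracting G B \<phi> "\<lambda>g. inv_into B \<phi> (fst (\<pi> g))" "\<lambda>g. snd (\<pi> g)"
    by (rule retracting_of_projection[OF assms(2-8)])
  interpret Hig_presentation G B \<phi> "\<lambda>g. inv_into B \<phi> (fst (\<pi> g))" "\<lambda>g. snd (\<pi> g)" k
    by unfold_locales (use assms(9) in simp)
  have "residually_solvable C.presented" by (rule residually_solvable_cycle[OF assms(9)])
  then show ?thesis
    using residually_solvable_Hig Hig_bar_eq_cycle[OF C.presentation_axioms] by simp
qed

end
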